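(* Let $\alpha\in(0,1)$, $b_1,b_2,b_3>0$, $\Omega=\prod_{i=1}^{3}(0,b_{i})\subseteq\mathbb{R}^3$, and consider $a\equiv I$ (the identity matrix), $q\equiv1$ in $\Omega$. Then for a generic $g\in C^{1,\alpha}(\overline{\Omega};\mathbb{R})$ the following holds: for every $x\in\Omega$ there exists $\lambda\in\Sigma$ such that $$\sum_{l:\lambda_{l}=\lambda}(g,\psi_{l})_{L^{2}(\partial\Omega;\mathbb{R})}\,\partial_{x_{1}}\varphi_{l}(x)\neq0.$$
   Context: A property holds for a generic element of a space if it holds on a residual subset, i.e. on a set containing (or equal to) a countable intersection of dense open sets. Here $C^{1,\alpha}(\overline\Omega;\mathbb{R})$ carries its usual Banach norm. $\lambda_l$ ($l\in\mathbb{N}^*=\{1,2,\dots\}$) are the Dirichlet eigenvalues, counted with multiplicity, of $-\Delta\varphi_l=\lambda_l\varphi_l$ in $\Omega$, $\varphi_l\in H^1_0(\Omega;\mathbb{R})$, with $\{\varphi_l\}$ an orthonormal basis of $L^2(\Omega;\mathbb{R})$. $\Sigma=\{\lambda_l:l\in\mathbb{N}^*\}$. $\psi_l=\nabla\varphi_l\cdot\nu$ on $\partial\Omega$ (defined on the open faces), where $\nu$ is the unit outer normal. *)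

theory Defs
  imports "HOL-Analysis.Analysis"
begin

section \<open>Classical derivatives on \<open>real ^ 'n\<close>\<close>

definition partial :: "'n::finite \<Rightarrow> (real ^ 'n \<Rightarrow> real) \<Rightarrow> real ^ 'n \<Rightarrow> real" where
  "partial i f x = deriv (\<lambda>t. f (x + t *\<^sub>R axis i 1)) 0"

definition grad :: "(real ^ 'n::finite \<Rightarrow> real) \<Rightarrow> real ^ 'n \<Rightarrow> real ^ 'n" where
  "grad f x = (\<chi> i. partial i f x)"

definition laplacian :: "(real ^ 'n::finite \<Rightarrow> real) \<Rightarrow> real ^ 'n \<Rightarrow> real" where
  "laplacian f x = (\<Sum>i\<in>UNIV. partial i (partial i f) x)"

text \<open>All iterated partial derivatives exist and are (Frechet) differentiable, hence continuous.\<close>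

definition smooth :: "(real ^ 'n::finite \<Rightarrow> real) \<Rightarrow> bool" where
  "smooth f \<longleftrightarrow> (\<forall>is. foldr partial is f differentiable_on UNIV)"

definition test_functions :: "(real ^ 'n::finite) set \<Rightarrow> (real ^ 'n \<Rightarrow> real) set" where
  "test_functions \<Omega> =
     {v. smooth v \<and> compact (closure {x. v x \<noteq> 0}) \<and> closure {x. v x \<noteq> 0} \<subseteq> \<Omega>}"


section \<open>\<open>L\<^sup>2\<close>, \<open>H\<^sub>0\<^sup>1\<close> and Dirichlet eigenfunctions\<close>

text \<open>Elements of these spaces are functions, not classes modulo null sets; values outside
  \<open>\<Omega>\<close> are irrelevant.\<close>

definition L2 :: "(real ^ 'n::finite) set \<Rightarrow> (real ^ 'n \<Rightarrow> real) set" where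
  "L2 \<Omega> = {u. u \<in> borel_measurable (lebesgue_on \<Omega>) \<and> integrable (lebesgue_on \<Omega>) (\<lambda>x. (u x)\<^sup>2)}"

definition L2_inner :: "(real ^ 'n::finite) set \<Rightarrow> (real ^ 'n \<Rightarrow> real) \<Rightarrow> (real ^ 'n \<Rightarrow> real) \<Rightarrow> real" where
  "L2_inner \<Omega> u v = (\<integral>x. u x * v x \<partial>lebesgue_on \<Omega>)"

definition L2_norm :: "(real ^ 'n::finite) set \<Rightarrow> (real ^ 'n \<Rightarrow> real) \<Rightarrow> real" where
  "L2_norm \<Omega> u = sqrt (L2_inner \<Omega> u u)"

definition weak_gradient :: "(real ^ 'n::finite) set \<Rightarrow> (real ^ 'n \<Rightarrow> real) \<Rightarrow> (real ^ 'n \<Rightarrow> real ^ 'n) \<Rightarrow> bool" where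
  "weak_gradient \<Omega> u w \<longleftrightarrow>
     (\<forall>i. \<forall>v\<in>test_functions \<Omega>. L2_inner \<Omega> u (partial i v) = - L2_inner \<Omega> (\<lambda>x. w x $ i) v)"

text \<open>The closure of the test functions in \<open>H\<^sup>1\<close>.\<close>

definition H10 :: "(real ^ 'n::finite) set \<Rightarrow> (real ^ 'n \<Rightarrow> real) set" where
  "H10 \<Omega> = {u \<in> L2 \<Omega>. \<exists>w. weak_gradient \<Omega> u w \<and> (\<forall>i. (\<lambda>x. w x $ i) \<in> L2 \<Omega>) \<and>
     (\<exists>v. (\<forall>n::nat. v n \<in> test_functions \<Omega>) \<and>
          (\<lambda>n. L2_norm \<Omega> (\<lambda>x. v n x - u x)) \<longlonglongrightarrow> 0 \<and>
          (\<forall>i. (\<lambda>n. L2_norm \<Omega> (\<lambda>x. partial i (v n) x - w x $ i)) \<longlonglongrightarrow> 0))}"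

text \<open>The equation \<open>- \<Delta> u = \<mu> u\<close> is understood in the sense of distributions. By interior
  regularity every solution has a unique representative that is continuous (and then smooth) on
  \<open>\<Omega>\<close>; continuity only selects this representative, so that point values are meaningful.\<close>

definition dirichlet_eigenfunction :: "(real ^ 'n::finite) set \<Rightarrow> real \<Rightarrow> (real ^ 'n \<Rightarrow> real) \<Rightarrow> bool" where
  "dirichlet_eigenfunction \<Omega> \<mu> u \<longleftrightarrow>
     u \<in> H10 \<Omega> \<and> continuous_on \<Omega> u \<and>
     (\<forall>v\<in>test_functions \<Omega>. - L2_inner \<Omega> u (laplacian v) = \<mu> * L2_inner \<Omega> u v)"

text \<open>Sequences are indexed by the positive integers; index \<open>0\<close> is unused.\<close>

definition L2_orthonormal_basis :: "(real ^ 'n::finite) set \<Rightarrow> (nat \<Rightarrow> real ^ 'n \<Rightarrow> real) \<Rightarrow> bool" where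
  "L2_orthonormal_basis \<Omega> \<phi> \<longleftrightarrow>
     (\<forall>l\<ge>1. \<phi> l \<in> L2 \<Omega>) \<and>
     (\<forall>k\<ge>1. \<forall>l\<ge>1. L2_inner \<Omega> (\<phi> k) (\<phi> l) = (if k = l then 1 else 0)) \<and>
     (\<forall>u\<in>L2 \<Omega>. (\<lambda>N. L2_norm \<Omega> (\<lambda>x. u x - (\<Sum>l=1..N. L2_inner \<Omega> u (\<phi> l) * \<phi> l x))) \<longlonglongrightarrow> 0)"

definition dirichlet_eigenbasis ::
    "(real ^ 'n::finite) set \<Rightarrow> (nat \<Rightarrow> real) \<Rightarrow> (nat \<Rightarrow> real ^ 'n \<Rightarrow> real) \<Rightarrow> bool" where
  "dirichlet_eigenbasis \<Omega> ev \<phi> \<longleftrightarrow>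
     (\<forall>l\<ge>1. dirichlet_eigenfunction \<Omega> (ev l) (\<phi> l)) \<and> L2_orthonormal_basis \<Omega> \<phi>"


section \<open>The boundary of a box\<close>

text \<open>For \<open>y\<close> on an open face of \<open>box 0 b\<close> exactly one coordinate is extreme, and this is the
  unit outer normal. Edges and corners form a null set and play no role.\<close>

definition box_normal :: "real ^ 'n::finite \<Rightarrow> real ^ 'n \<Rightarrow> real ^ 'n" where
  "box_normal b y = (\<chi> i. if y $ i = 0 then - 1 else if y $ i = b $ i then 1 else 0)"

text \<open>\<open>\<nabla>u \<sqdot> \<nu>\<close> at a boundary point, with \<open>\<nabla>u\<close> extended from the interior by its limit.\<close>

definition normal_derivative :: "real ^ 'n::finite \<Rightarrow> (real ^ 'n \<Rightarrow> real) \<Rightarrow> real ^ 'n \<Rightarrow> real" where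
  "normal_derivative b u y = Lim (at y within box 0 b) (\<lambda>x. grad u x \<bullet> box_normal b y)"

definition face_point :: "'n::finite \<Rightarrow> real \<Rightarrow> ('n \<Rightarrow> real) \<Rightarrow> real ^ 'n" where
  "face_point i s z = (\<chi> j. if j = i then s else z j)"

text \<open>The surface integral over the boundary of \<open>box 0 b\<close>: on each of the faces \<open>y $ i = s\<close>,
  \<open>s \<in> {0, b $ i}\<close>, integrate with respect to Lebesgue measure in the remaining coordinates.\<close>

definition box_boundary_integral :: "real ^ 'n::finite \<Rightarrow> (real ^ 'n \<Rightarrow> real) \<Rightarrow> real" where
  "box_boundary_integral b f =
     (\<Sum>i\<in>UNIV. \<Sum>s\<in>{0, b $ i}.
        LINT z:(\<Pi>\<^sub>E j\<in>UNIV - {i}. {0<..<b $ j})|(\<Pi>\<^sub>M j\<in>UNIV - {i}. lborel). f (face_point i s z))"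

definition L2_boundary_inner :: "real ^ 'n::finite \<Rightarrow> (real ^ 'n \<Rightarrow> real) \<Rightarrow> (real ^ 'n \<Rightarrow> real) \<Rightarrow> real" where
  "L2_boundary_inner b f h = box_boundary_integral b (\<lambda>y. f y * h y)"


section \<open>The Banach space \<open>C\<^sup>1\<^sup>,\<^sup>\<alpha>\<close> on the closure of an open set\<close>

text \<open>A function on \<open>closure \<Omega>\<close> is represented by its extension by \<open>0\<close>. Derivatives are taken in
  \<open>\<Omega>\<close>; Hoelder continuity makes them extend continuously to \<open>closure \<Omega>\<close>, so suprema over \<open>\<Omega>\<close>
  and over \<open>closure \<Omega>\<close> agree.\<close>

definition C1alpha :: "real \<Rightarrow> (real ^ 'n::finite) set \<Rightarrow> (real ^ 'n \<Rightarrow> real) set" where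
  "C1alpha \<alpha> \<Omega> = {g.
     (\<forall>x. x \<notin> closure \<Omega> \<longrightarrow> g x = 0) \<and> continuous_on (closure \<Omega>) g \<and> bounded (g ` \<Omega>) \<and>
     g differentiable_on \<Omega> \<and> bounded (grad g ` \<Omega>) \<and>
     (\<exists>C. \<forall>x\<in>\<Omega>. \<forall>y\<in>\<Omega>. norm (grad g x - grad g y) \<le> C * dist x y powr \<alpha>)}"

definition C1alpha_norm :: "real \<Rightarrow> (real ^ 'n::finite) set \<Rightarrow> (real ^ 'n \<Rightarrow> real) \<Rightarrow> real" where
  "C1alpha_norm \<alpha> \<Omega> g =
     (SUP x\<in>\<Omega>. \<bar>g x\<bar>) + (SUP x\<in>\<Omega>. norm (grad g x)) +
     Sup {norm (grad g x - grad g y) / dist x y powr \<alpha> | x y. x \<in> \<Omega> \<and> y \<in> \<Omega> \<and> x \<noteq> y}"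

text \<open>The value outside the space is immaterial, but the locale \<open>Metric_space\<close> asks for
  nonnegativity and symmetry on the whole type.\<close>

definition C1alpha_dist :: "real \<Rightarrow> (real ^ 'n::finite) set \<Rightarrow> (real ^ 'n \<Rightarrow> real) \<Rightarrow> (real ^ 'n \<Rightarrow> real) \<Rightarrow> real" where
  "C1alpha_dist \<alpha> \<Omega> g h =
     (if g \<in> C1alpha \<alpha> \<Omega> \<and> h \<in> C1alpha \<alpha> \<Omega> then C1alpha_norm \<alpha> \<Omega> (\<lambda>x. g x - h x) else 0)"

definition C1alpha_topology :: "real \<Rightarrow> (real ^ 'n::finite) set \<Rightarrow> (real ^ 'n \<Rightarrow> real) topology" where
  "C1alpha_topology \<alpha> \<Omega> = Metric_space.mtopology (C1alpha \<alpha> \<Omega>) (C1alpha_dist \<alpha> \<Omega>)"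


section \<open>Genericity\<close>

definition residual_in :: "'a topology \<Rightarrow> 'a set \<Rightarrow> bool" where
  "residual_in X S \<longleftrightarrow> S \<subseteq> topspace X \<and>
     (\<exists>\<U>. countable \<U> \<and> (\<forall>U\<in>\<U>. openin X U \<and> X closure_of U = topspace X) \<and>
          topspace X \<inter> \<Inter>\<U> \<subseteq> S)"

definition generic_in :: "'a topology \<Rightarrow> ('a \<Rightarrow> bool) \<Rightarrow> bool" where
  "generic_in X P \<longleftrightarrow> residual_in X {g \<in> topspace X. P g}"


section \<open>The \<open>C\<^sup>1\<^sup>,\<^sup>\<alpha>\<close> distance is a metric\<close>

lemma GDERIV_grad:
  assumes "f differentiable (at x)"
  shows "GDERIV f x :> grad f x"
proof -
  obtain f' where f': "(f has_derivative f') (at x)"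
    using assms by (auto simp: differentiable_def)
  have lin: "linear f'" using f' by (rule has_derivative_linear)
  have p: "partial i f x = f' (axis i 1)" for i
  proof -
    have "((\<lambda>t::real. x + t *\<^sub>R axis i 1) has_derivative (\<lambda>t. t *\<^sub>R axis i 1)) (at 0)"
      by (auto intro!: derivative_eq_intros)
    moreover have "(f has_derivative f') (at (x + 0 *\<^sub>R axis i 1))"
      using f' by simp
    ultimately have "((\<lambda>t. f (x + t *\<^sub>R axis i 1)) has_derivative (\<lambda>t. f' (t *\<^sub>R axis i 1))) (at 0)"
      by (rule has_derivative_compose)
    then have "((\<lambda>t. f (x + t *\<^sub>R axis i 1)) has_field_derivative f' (axis i 1)) (at 0)"
      by (simp add: has_field_derivative_def linear_cmul[OF lin] mult_commute_abs)
    then show ?thesis unfolding partial_def by (rule DERIV_imp_deriv)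
  qed
  have "f' h = h \<bullet> grad f x" for h
  proof -
    have "f' h = f' (\<Sum>i\<in>UNIV. h $ i *\<^sub>R axis i 1)"
      using basis_expansion[of h] by (simp add: scalar_mult_eq_scaleR)
    also have "\<dots> = (\<Sum>i\<in>UNIV. h $ i * f' (axis i 1))"
      by (simp add: linear_sum[OF lin] linear_cmul[OF lin])
    finally show ?thesis by (simp add: inner_vec_def grad_def p)
  qed
  then have "f' = (\<lambda>h. h \<bullet> grad f x)" by auto
  with f' show ?thesis by (simp add: gderiv_def)
qed

lemma grad_eqI:
  assumes "GDERIV f x :> D"
  shows "grad f x = D"
proof -
  have D: "(f has_derivative (\<lambda>h. h \<bullet> D)) (at x)" using assms by (simp add: gderiv_def)
  then have "(f has_derivative (\<lambda>h. h \<bullet> grad f x)) (at x)"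
    using GDERIV_grad by (auto simp: gderiv_def differentiable_def)
  from has_derivative_unique[OF this D] have "\<forall>h. h \<bullet> grad f x = h \<bullet> D" by (simp add: fun_eq_iff)
  then show ?thesis by (simp only: vector_eq_ldot)
qed

lemma grad_diff:
  assumes "f differentiable (at x)" "g differentiable (at x)"
  shows "grad (\<lambda>y. f y - g y) x = grad f x - grad g x"
  by (intro grad_eqI GDERIV_diff GDERIV_grad assms)

lemma C1alpha_diff:
  assumes "open \<Omega>" "g \<in> C1alpha \<alpha> \<Omega>" "h \<in> C1alpha \<alpha> \<Omega>"
  shows "(\<lambda>x. g x - h x) \<in> C1alpha \<alpha> \<Omega>"
    and "\<And>x. x \<in> \<Omega> \<Longrightarrow> grad (\<lambda>x. g x - h x) x = grad g x - grad h x"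
proof -
  have d: "g differentiable (at x)" "h differentiable (at x)" if "x \<in> \<Omega>" for x
    using assms that by (auto simp: C1alpha_def differentiable_on_eq_differentiable_at)
  show gr: "grad (\<lambda>x. g x - h x) x = grad g x - grad h x" if "x \<in> \<Omega>" for x
    using d that by (simp add: grad_diff)
  obtain A B where
    A: "\<And>x y. x \<in> \<Omega> \<Longrightarrow> y \<in> \<Omega> \<Longrightarrow> norm (grad g x - grad g y) \<le> A * dist x y powr \<alpha>" and
    B: "\<And>x y. x \<in> \<Omega> \<Longrightarrow> y \<in> \<Omega> \<Longrightarrow> norm (grad h x - grad h y) \<le> B * dist x y powr \<alpha>"
    using assms(2,3) unfolding C1alpha_def by blast
  have "norm (grad (\<lambda>x. g x - h x) x - grad (\<lambda>x. g x - h x) y) \<le> (A + B) * dist x y powr \<alpha>"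
    if "x \<in> \<Omega>" "y \<in> \<Omega>" for x y
  proof -
    have "norm ((grad g x - grad g y) - (grad h x - grad h y))
      \<le> norm (grad g x - grad g y) + norm (grad h x - grad h y)"
      by (rule norm_triangle_ineq4)
    also have "\<dots> \<le> (A + B) * dist x y powr \<alpha>"
      using A[OF that] B[OF that] by (simp add: distrib_right)
    finally show ?thesis using that by (simp add: gr algebra_simps)
  qed
  moreover have "bounded ((\<lambda>x. g x - h x) ` \<Omega>)"
    using assms(2,3) by (intro bounded_minus_comp) (auto simp: C1alpha_def)
  moreover have "bounded (grad (\<lambda>x. g x - h x) ` \<Omega>)"
  proof -
    have "bounded ((\<lambda>x. grad g x - grad h x) ` \<Omega>)"
      using assms(2,3) by (intro bounded_minus_comp) (auto simp: C1alpha_def)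
    then show ?thesis using gr by (simp cong: image_cong)
  qed
  ultimately show "(\<lambda>x. g x - h x) \<in> C1alpha \<alpha> \<Omega>"
    using assms(2,3) unfolding C1alpha_def
    by (auto intro!: continuous_on_diff differentiable_on_diff)
qed

lemma C1alpha_bdd:
  assumes "g \<in> C1alpha \<alpha> \<Omega>"
  shows "bdd_above ((\<lambda>x. \<bar>g x\<bar>) ` \<Omega>)" "bdd_above ((\<lambda>x. norm (grad g x)) ` \<Omega>)"
    "bdd_above {norm (grad g x - grad g y) / dist x y powr \<alpha> | x y. x \<in> \<Omega> \<and> y \<in> \<Omega> \<and> x \<noteq> y}"
proof -
  show "bdd_above ((\<lambda>x. \<bar>g x\<bar>) ` \<Omega>)" "bdd_above ((\<lambda>x. norm (grad g x)) ` \<Omega>)"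
    using assms by (auto simp: C1alpha_def bounded_iff bdd_above_def)
  obtain A where A: "\<And>x y. x \<in> \<Omega> \<Longrightarrow> y \<in> \<Omega> \<Longrightarrow> norm (grad g x - grad g y) \<le> A * dist x y powr \<alpha>"
    using assms unfolding C1alpha_def by blast
  show "bdd_above {norm (grad g x - grad g y) / dist x y powr \<alpha> | x y. x \<in> \<Omega> \<and> y \<in> \<Omega> \<and> x \<noteq> y}"
    by (rule bdd_aboveI[where M = A]) (auto simp: A divide_le_eq)
qed

lemma C1alpha_norm_bounds:
  assumes "g \<in> C1alpha \<alpha> \<Omega>"
  shows "x \<in> \<Omega> \<Longrightarrow> \<bar>g x\<bar> \<le> (SUP x\<in>\<Omega>. \<bar>g x\<bar>)"
    and "x \<in> \<Omega> \<Longrightarrow> norm (grad g x) \<le> (SUP x\<in>\<Omega>. norm (grad g x))"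
    and "x \<in> \<Omega> \<Longrightarrow> y \<in> \<Omega> \<Longrightarrow> x \<noteq> y \<Longrightarrow> norm (grad g x - grad g y) / dist x y powr \<alpha> \<le>
      Sup {norm (grad g x - grad g y) / dist x y powr \<alpha> | x y. x \<in> \<Omega> \<and> y \<in> \<Omega> \<and> x \<noteq> y}"
  using C1alpha_bdd[OF assms] by (auto intro!: cSUP_upper cSup_upper)

lemma open_two_points:
  fixes \<Omega> :: "(real ^ 'n::finite) set"
  assumes "open \<Omega>" "\<Omega> \<noteq> {}"
  obtains x y where "x \<in> \<Omega>" "y \<in> \<Omega>" "x \<noteq> y"
proof -
  obtain x where x: "x \<in> \<Omega>" using assms by auto
  have "\<Omega> \<noteq> {x}" using assms(1) not_open_singleton by metis
  with x that show ?thesis by blast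
qed

lemma C1alpha_norm_nonneg:
  fixes \<Omega> :: "(real ^ 'n::finite) set"
  assumes "open \<Omega>" "\<Omega> \<noteq> {}" "g \<in> C1alpha \<alpha> \<Omega>"
  shows "0 \<le> C1alpha_norm \<alpha> \<Omega> g" and "x \<in> \<Omega> \<Longrightarrow> \<bar>g x\<bar> \<le> C1alpha_norm \<alpha> \<Omega> g"
proof -
  obtain u v where uv: "u \<in> \<Omega>" "v \<in> \<Omega>" "u \<noteq> v" by (rule open_two_points[OF assms(1,2)])
  have 1: "0 \<le> (SUP x\<in>\<Omega>. norm (grad g x))"
    by (rule order_trans[OF norm_ge_zero C1alpha_norm_bounds(2)[OF assms(3) uv(1)]])
  have "0 \<le> norm (grad g u - grad g v) / dist u v powr \<alpha>" by simp
  then have 2: "0 \<le> Sup {norm (grad g x - grad g y) / dist x y powr \<alpha> | x y. x \<in> \<Omega> \<and> y \<in> \<Omega> \<and> x \<noteq> y}"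
    using C1alpha_norm_bounds(3)[OF assms(3) uv] by linarith
  show *: "\<bar>g x\<bar> \<le> C1alpha_norm \<alpha> \<Omega> g" if "x \<in> \<Omega>" for x
    using C1alpha_norm_bounds(1)[OF assms(3) that] 1 2 by (simp add: C1alpha_norm_def)
  show "0 \<le> C1alpha_norm \<alpha> \<Omega> g" using *[OF uv(1)] by linarith
qed

lemma C1alpha_zero_iff:
  fixes \<Omega> :: "(real ^ 'n::finite) set"
  assumes "open \<Omega>" "\<Omega> \<noteq> {}" "g \<in> C1alpha \<alpha> \<Omega>" "h \<in> C1alpha \<alpha> \<Omega>"
  shows "C1alpha_dist \<alpha> \<Omega> g h = 0 \<longleftrightarrow> g = h"
proof
  assume 0: "C1alpha_dist \<alpha> \<Omega> g h = 0"
  have eq: "g x = h x" if "x \<in> \<Omega>" for x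
    using C1alpha_norm_nonneg(2)[OF assms(1,2) C1alpha_diff(1)[OF assms(1,3,4)] that] 0
    by (simp add: C1alpha_dist_def assms(3,4))
  have "g x = h x" for x
  proof (cases "x \<in> closure \<Omega>")
    case True
    have "continuous_on (closure \<Omega>) (\<lambda>x. g x - h x)"
      using assms(3,4) by (intro continuous_on_diff) (auto simp: C1alpha_def)
    from continuous_constant_on_closure[OF this, of 0] eq True show ?thesis by auto
  qed (use assms in \<open>auto simp: C1alpha_def\<close>)
  then show "g = h" by auto
next
  assume eq: "g = h"
  obtain u v where uv: "u \<in> \<Omega>" "v \<in> \<Omega>" "u \<noteq> v" by (rule open_two_points[OF assms(1,2)])
  have gr: "grad (\<lambda>x. 0) x = 0" for x :: "real ^ 'n"
    by (intro grad_eqI GDERIV_const)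
  have "{norm (grad (\<lambda>x. 0) x - grad (\<lambda>x. 0) y) / dist x y powr \<alpha> | x y. x \<in> \<Omega> \<and> y \<in> \<Omega> \<and> x \<noteq> y} = {0}"
    using uv by (auto simp: gr)
  then show "C1alpha_dist \<alpha> \<Omega> g h = 0"
    using assms(2) by (simp add: C1alpha_dist_def C1alpha_norm_def eq gr)
qed

lemma C1alpha_triangle:
  fixes \<Omega> :: "(real ^ 'n::finite) set"
  assumes "open \<Omega>" "\<Omega> \<noteq> {}" "f \<in> C1alpha \<alpha> \<Omega>" "g \<in> C1alpha \<alpha> \<Omega>" "h \<in> C1alpha \<alpha> \<Omega>"
  shows "C1alpha_dist \<alpha> \<Omega> f h \<le> C1alpha_dist \<alpha> \<Omega> f g + C1alpha_dist \<alpha> \<Omega> g h"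
proof -
  let ?p = "\<lambda>x. f x - g x" and ?q = "\<lambda>x. g x - h x" and ?r = "\<lambda>x. f x - h x"
  let ?Q = "\<lambda>u. {norm (grad u x - grad u y) / dist x y powr \<alpha> | x y. x \<in> \<Omega> \<and> y \<in> \<Omega> \<and> x \<noteq> y}"
  note p = C1alpha_diff[OF assms(1,3,4)] and q = C1alpha_diff[OF assms(1,4,5)]
    and r = C1alpha_diff[OF assms(1,3,5)]
  note bp = C1alpha_norm_bounds[OF p(1)] and bq = C1alpha_norm_bounds[OF q(1)]
  obtain u v where uv: "u \<in> \<Omega>" "v \<in> \<Omega>" "u \<noteq> v" by (rule open_two_points[OF assms(1,2)])
  have gr: "grad ?r x = grad ?p x + grad ?q x" if "x \<in> \<Omega>" for x
    using that by (simp add: p(2) q(2) r(2))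
  have 1: "(SUP x\<in>\<Omega>. \<bar>?r x\<bar>) \<le> (SUP x\<in>\<Omega>. \<bar>?p x\<bar>) + (SUP x\<in>\<Omega>. \<bar>?q x\<bar>)"
  proof (rule cSUP_least[OF assms(2)])
    fix x assume x: "x \<in> \<Omega>"
    show "\<bar>?r x\<bar> \<le> (SUP x\<in>\<Omega>. \<bar>?p x\<bar>) + (SUP x\<in>\<Omega>. \<bar>?q x\<bar>)"
      using bp(1)[OF x] bq(1)[OF x] by linarith
  qed
  have 2: "(SUP x\<in>\<Omega>. norm (grad ?r x)) \<le> (SUP x\<in>\<Omega>. norm (grad ?p x)) + (SUP x\<in>\<Omega>. norm (grad ?q x))"
  proof (rule cSUP_least[OF assms(2)])
    fix x assume x: "x \<in> \<Omega>"
    show "norm (grad ?r x) \<le> (SUP x\<in>\<Omega>. norm (grad ?p x)) + (SUP x\<in>\<Omega>. norm (grad ?q x))"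
      unfolding gr[OF x]
      using norm_triangle_ineq[of "grad ?p x" "grad ?q x"] bp(2)[OF x] bq(2)[OF x] by linarith
  qed
  have 3: "Sup (?Q ?r) \<le> Sup (?Q ?p) + Sup (?Q ?q)"
  proof (rule cSup_least)
    show "?Q ?r \<noteq> {}" using uv by blast
  next
    fix z assume "z \<in> ?Q ?r"
    then obtain x y where xy: "x \<in> \<Omega>" "y \<in> \<Omega>" "x \<noteq> y"
      and z: "z = norm (grad ?r x - grad ?r y) / dist x y powr \<alpha>" by blast
    have "grad ?r x - grad ?r y = (grad ?p x - grad ?p y) + (grad ?q x - grad ?q y)"
      by (simp add: gr[OF xy(1)] gr[OF xy(2)])
    then have "norm (grad ?r x - grad ?r y) \<le> norm (grad ?p x - grad ?p y) + norm (grad ?q x - grad ?q y)"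
      by (simp only: norm_triangle_ineq)
    from divide_right_mono[OF this powr_ge_zero]
    have "z \<le> norm (grad ?p x - grad ?p y) / dist x y powr \<alpha> + norm (grad ?q x - grad ?q y) / dist x y powr \<alpha>"
      unfolding z add_divide_distrib .
    with bp(3)[OF xy] bq(3)[OF xy] show "z \<le> Sup (?Q ?p) + Sup (?Q ?q)" by linarith
  qed
  have "C1alpha_norm \<alpha> \<Omega> ?r \<le> C1alpha_norm \<alpha> \<Omega> ?p + C1alpha_norm \<alpha> \<Omega> ?q"
    unfolding C1alpha_norm_def using 1 2 3 by linarith
  then show ?thesis by (simp only: C1alpha_dist_def assms(3-5) simp_thms if_True)
qed

lemma C1alpha_dist_commute:
  fixes \<Omega> :: "(real ^ 'n::finite) set"
  assumes "open \<Omega>"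
  shows "C1alpha_dist \<alpha> \<Omega> g h = C1alpha_dist \<alpha> \<Omega> h g"
proof (cases "g \<in> C1alpha \<alpha> \<Omega> \<and> h \<in> C1alpha \<alpha> \<Omega>")
  case True
  let ?p = "\<lambda>x. g x - h x" and ?q = "\<lambda>x. h x - g x"
  let ?Q = "\<lambda>u. {norm (grad u x - grad u y) / dist x y powr \<alpha> | x y. x \<in> \<Omega> \<and> y \<in> \<Omega> \<and> x \<noteq> y}"
  have gr: "grad ?p x = - grad ?q x" if "x \<in> \<Omega>" for x
    using that True C1alpha_diff(2)[OF assms, of g \<alpha> h x] C1alpha_diff(2)[OF assms, of h \<alpha> g x] by simp
  have n: "norm (grad ?p x - grad ?p y) = norm (grad ?q x - grad ?q y)" if "x \<in> \<Omega>" "y \<in> \<Omega>" for x y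
    by (simp add: gr[OF that(1)] gr[OF that(2)] norm_minus_commute)
  have "?Q ?p = ?Q ?q" by (intro Collect_cong ex_cong1) (auto simp: n)
  moreover have "(SUP x\<in>\<Omega>. norm (grad ?p x)) = (SUP x\<in>\<Omega>. norm (grad ?q x))"
    by (rule SUP_cong) (simp_all add: gr)
  moreover have "(SUP x\<in>\<Omega>. \<bar>?p x\<bar>) = (SUP x\<in>\<Omega>. \<bar>?q x\<bar>)"
    by (simp add: abs_minus_commute)
  ultimately show ?thesis using True by (simp add: C1alpha_dist_def C1alpha_norm_def)
qed (auto simp: C1alpha_dist_def)

lemma Metric_space_C1alpha:
  fixes \<Omega> :: "(real ^ 'n::finite) set"
  assumes "open \<Omega>" "\<Omega> \<noteq> {}"
  shows "Metric_space (C1alpha \<alpha> \<Omega>) (C1alpha_dist \<alpha> \<Omega>)"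
proof
  show "0 \<le> C1alpha_dist \<alpha> \<Omega> g h" for g h
    using C1alpha_norm_nonneg(1)[OF assms C1alpha_diff(1)[OF assms(1)]]
    by (auto simp: C1alpha_dist_def)
next
  show "C1alpha_dist \<alpha> \<Omega> g h = C1alpha_dist \<alpha> \<Omega> h g" for g h
    by (rule C1alpha_dist_commute[OF assms(1)])
next
  fix g h assume "g \<in> C1alpha \<alpha> \<Omega>" "h \<in> C1alpha \<alpha> \<Omega>"
  then show "C1alpha_dist \<alpha> \<Omega> g h = 0 \<longleftrightarrow> g = h"
    by (rule C1alpha_zero_iff[OF assms])
next
  fix f g h assume "f \<in> C1alpha \<alpha> \<Omega>" "g \<in> C1alpha \<alpha> \<Omega>" "h \<in> C1alpha \<alpha> \<Omega>"
  then show "C1alpha_dist \<alpha> \<Omega> f h \<le> C1alpha_dist \<alpha> \<Omega> f g + C1alpha_dist \<alpha> \<Omega> g h"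
    by (rule C1alpha_triangle[OF assms])
qed

end

theory Submission
  imports Defs
begin

text \<open>By separation of variables and Stone--Weierstrass the products of sines are a complete
  orthogonal system of eigenfunctions, so any eigenbasis arises from them by an orthogonal change
  of basis inside each (finite-dimensional) eigenspace. Hence the sum over \<open>\<lambda>\<^sub>l = \<lambda>\<close> may be computed
  with the (normalised) product basis.
  At points off the plane \<open>x\<^sub>1 = b\<^sub>1 / 2\<close> the simple lowest eigenvalue, with mode \<open>(1,1,1)\<close>, gives
  a nonzero value as soon as \<open>g\<close> pairs nontrivially with its normal derivative. On that plane, use the
  eigenvalue of \<open>(2,1,1)\<close>: it may be multiple, but every other mode \<open>k\<close> in its eigenspace has \<open>k\<^sub>1\<close> odd
  (\<open>k\<^sub>1\<close> even would force \<open>k \<ge> (2,1,1)\<close>), hence \<open>\<partial>\<^sub>1 \<phi>\<^sub>k = 0\<close> there. So it suffices that two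
  nonzero continuous linear functionals do not vanish at \<open>g\<close>, which is an open dense condition.\<close>

section \<open>Smooth functions of one variable\<close>

text \<open>An eigenfunction is known only weakly: its equation may be tested only with compactly
  supported smooth functions, and its zero boundary values exist only as membership in the closure
  \<open>H10\<close>. Sine modes are not such test functions, so each is approximated by cut-off
  copies. A cut-off of parameter n has a derivative of order n, which the linear vanishing of the
  sine at the ends of the interval compensates; hence gradients stay bounded and converge pointwise,
  and dominated convergence removes the cut-off. Stone--Weierstrass cannot be applied to the span of
  the sine modes itself, which contains no nonzero constants and whose members vanish on the
  boundary. It is applied to the continuous functions that multiply this span into itself; suitable
  cosines are among them. The sum over \<open>l\<close> needs care as well: it is meaningful only
  because each eigenvalue belongs to finitely many indices, which is proved by a Bessel
  count.\<close>

primrec times_diff :: "nat \<Rightarrow> (real \<Rightarrow> real) \<Rightarrow> bool" where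
  "times_diff 0 f \<longleftrightarrow> True"
| "times_diff (Suc n) f \<longleftrightarrow> (\<exists>f'. (\<forall>t. (f has_real_derivative f' t) (at t)) \<and> times_diff n f')"

text \<open>The counter n makes the closure rules provable by induction: differentiating once
  replaces n + 1 by n. The derivative is an existential witness in \<open>times_diff\<close>;
  \<open>smooth1_DERIV\<close> identifies it with \<open>deriv\<close>.\<close>

definition smooth1 :: "(real \<Rightarrow> real) \<Rightarrow> bool" where
  "smooth1 f \<longleftrightarrow> (\<forall>n. times_diff n f)"

lemma times_diff_SucD: "times_diff (Suc n) f \<Longrightarrow> times_diff n f"
proof (induction n arbitrary: f)
  case (Suc n)
  then show ?case by (metis times_diff.simps(2))
qed simp

lemma times_diff_const: "times_diff n (\<lambda>t. c)"
proof (induction n arbitrary: c)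
  case (Suc n)
  then show ?case by (auto intro!: exI[of _ "\<lambda>t. 0"])
qed simp

lemma times_diff_add:
  "times_diff n f \<Longrightarrow> times_diff n g \<Longrightarrow> times_diff n (\<lambda>t. f t + g t)"
proof (induction n arbitrary: f g)
  case (Suc n)
  then obtain f' g' where "\<And>t. (f has_real_derivative f' t) (at t)" "times_diff n f'"
    "\<And>t. (g has_real_derivative g' t) (at t)" "times_diff n g'"
    by auto
  with Suc.IH[of f' g'] show ?case
    by (auto intro!: exI[of _ "\<lambda>t. f' t + g' t"] derivative_intros)
qed simp

lemma times_diff_mult:
  "times_diff n f \<Longrightarrow> times_diff n g \<Longrightarrow> times_diff n (\<lambda>t. f t * g t)"
proof (induction n arbitrary: f g)
  case (Suc n)
  then obtain f' g' where *: "\<And>t. (f has_real_derivative f' t) (at t)" "times_diff n f'"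
    "\<And>t. (g has_real_derivative g' t) (at t)" "times_diff n g'"
    by auto
  \<comment> \<open>Each summand keeps one factor undifferentiated, so that factor has to be
    weakened from n + 1 to n derivatives.\<close>
  have "times_diff n (\<lambda>t. f' t * g t + f t * g' t)"
    by (intro times_diff_add Suc.IH * times_diff_SucD[OF Suc.prems(1)]
        times_diff_SucD[OF Suc.prems(2)])
  moreover have "((\<lambda>t. f t * g t) has_real_derivative f' t * g t + f t * g' t) (at t)" for t
    by (auto intro!: derivative_eq_intros *)
  ultimately show ?case by (auto intro!: exI[of _ "\<lambda>t. f' t * g t + f t * g' t"])
qed simp

lemma times_diff_compose:
  "times_diff n f \<Longrightarrow> times_diff n g \<Longrightarrow> times_diff n (\<lambda>t. f (g t))"
proof (induction n arbitrary: f g)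
  case (Suc n)
  then obtain f' g' where *: "\<And>t. (f has_real_derivative f' t) (at t)" "times_diff n f'"
    "\<And>t. (g has_real_derivative g' t) (at t)" "times_diff n g'"
    by auto
  have "times_diff n (\<lambda>t. f' (g t) * g' t)"
    by (rule times_diff_mult[OF Suc.IH[OF *(2) times_diff_SucD[OF Suc.prems(2)]] *(4)])
  moreover have "((\<lambda>t. f (g t)) has_real_derivative f' (g t) * g' t) (at t)" for t
    using DERIV_chain2 * by blast
  ultimately show ?case by (auto intro!: exI[of _ "\<lambda>t. f' (g t) * g' t"])
qed simp

lemma times_diff_ident: "times_diff n (\<lambda>t. t)"
proof (cases n)
  case (Suc m)
  with times_diff_const[of m 1] show ?thesis
    by (auto intro!: exI[of _ "\<lambda>t. 1"])
qed simp

lemma times_diff_sin_cos: "times_diff n sin \<and> times_diff n cos"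
proof (induction n)
  case (Suc n)
  have "times_diff n (\<lambda>t. (-1) * sin t)"
    using Suc by (intro times_diff_mult times_diff_const) auto
  then have "times_diff (Suc n) cos"
    by (auto intro!: exI[of _ "\<lambda>t. - sin t"] derivative_eq_intros)
  with Suc show ?case
    by (auto intro!: exI[of _ cos] derivative_eq_intros)
qed simp

lemma smooth1_const: "smooth1 (\<lambda>t. c)"
  and smooth1_ident: "smooth1 (\<lambda>t. t)"
  and smooth1_add: "smooth1 f \<Longrightarrow> smooth1 g \<Longrightarrow> smooth1 (\<lambda>t. f t + g t)"
  and smooth1_mult: "smooth1 f \<Longrightarrow> smooth1 g \<Longrightarrow> smooth1 (\<lambda>t. f t * g t)"
  and smooth1_compose: "smooth1 f \<Longrightarrow> smooth1 g \<Longrightarrow> smooth1 (\<lambda>t. f (g t))"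
  and smooth1_sin: "smooth1 sin"
  using times_diff_sin_cos
  by (simp_all add: smooth1_def times_diff_const times_diff_ident times_diff_add times_diff_mult
      times_diff_compose)

lemma smooth1_sin_mult: "smooth1 (\<lambda>t. sin (c * t))"
  by (intro smooth1_compose[OF smooth1_sin] smooth1_mult smooth1_const smooth1_ident)

lemma smooth1_DERIV:
  assumes "smooth1 f"
  shows "(f has_real_derivative deriv f t) (at t)" "smooth1 (deriv f)"
proof -
  have *: "\<exists>f'. (\<forall>t. (f has_real_derivative f' t) (at t)) \<and> times_diff n f'" for n
    using assms times_diff.simps(2) unfolding smooth1_def by blast
  show 1: "(f has_real_derivative deriv f t) (at t)" for t
    using * DERIV_imp_deriv by metis
  have "times_diff n (deriv f)" for n
  proof -
    obtain f' where f': "\<And>t. (f has_real_derivative f' t) (at t)" "times_diff n f'"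
      using * by blast
    then have "f' = deriv f" using DERIV_imp_deriv by (metis ext)
    with f'(2) show ?thesis by simp
  qed
  then show "smooth1 (deriv f)" by (simp add: smooth1_def)
qed

section \<open>Flat functions built from exp (- 1 / t)\<close>

definition flat_exp :: "nat \<Rightarrow> real \<Rightarrow> real" where
  "flat_exp m t = (if t > 0 then exp (- 1 / t) / t ^ m else 0)"

text \<open>For t > 0 the term of index m in the exponential series of 1 / t is at most the whole
  sum, so (1 / t)^m is at most m! exp (1 / t).\<close>

lemma flat_exp_bound: "\<bar>flat_exp m t\<bar> \<le> fact m"
proof (cases "t > 0")
  case True
  have "(1 / t) ^ m / fact m \<le> exp (1 / t)"
  proof -
    have "(\<lambda>n. inverse (fact n) *\<^sub>R (1 / t) ^ n) sums exp (1 / t)" by (rule exp_converges)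
    then have "(\<Sum>n\<in>{m}. inverse (fact n) *\<^sub>R (1 / t) ^ n) \<le> (\<Sum>n. inverse (fact n) *\<^sub>R (1 / t) ^ n)"
      using True by (intro sum_le_suminf) (auto simp: sums_iff)
    also have "\<dots> = exp (1 / t)"
      using \<open>_ sums _\<close> by (simp add: sums_iff)
    finally show ?thesis by (simp add: divide_inverse mult.commute)
  qed
  with True show ?thesis
    by (simp add: flat_exp_def exp_minus field_simps)
qed (simp add: flat_exp_def)

text \<open>Applied with t = n x (beta - x) - 1, where t + 1 is the growing factor left over once
  the sine has been estimated against the slope of the cut-off.\<close>

lemma flat_exp_shift: "t > 0 \<Longrightarrow> (t + 1) * flat_exp 2 t = flat_exp 1 t + flat_exp 2 t"
  by (simp add: flat_exp_def field_simps power2_eq_square)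

text \<open>The family indexed by m is closed under differentiation up to linear combinations, which
  lets one induction prove smoothness of all its members. Away from 0 this is calculus; the point 0
  needs the difference quotient.\<close>

lemma flat_exp_DERIV:
  "(flat_exp m has_real_derivative flat_exp (m + 2) t - real m * flat_exp (m + 1) t) (at t)"
proof (cases "t = 0")
  case False
  show ?thesis
  proof (cases "t > 0")
    case True
    have "((\<lambda>t. exp (- 1 / t) / t ^ m) has_real_derivative
      flat_exp (m + 2) t - real m * flat_exp (m + 1) t) (at t)"
    proof (cases m)
      case 0
      then show ?thesis using True
        by (auto intro!: derivative_eq_intros simp: flat_exp_def field_simps power2_eq_square)
    next
      case (Suc k)
      have 1: "((\<lambda>t. 1 / t) has_real_derivative - ((1 / t)\<^sup>2)) (at t)"
        using True by (auto intro!: derivative_eq_intros simp: power2_eq_square)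
      have 2: "((\<lambda>t. exp (- (1 / t))) has_real_derivative exp (- (1 / t)) * (1 / t)\<^sup>2) (at t)"
        using True by (auto intro!: derivative_eq_intros simp: power2_eq_square)
      have 3: "((\<lambda>t. (1 / t) ^ Suc k) has_real_derivative
          (1 + real k) * (- ((1 / t)\<^sup>2) * (1 / t) ^ k)) (at t)"
        by (rule DERIV_power_Suc[OF 1])
      have "((\<lambda>t. exp (- (1 / t)) * (1 / t) ^ Suc k) has_real_derivative
          flat_exp (Suc k + 2) t - real (Suc k) * flat_exp (Suc k + 1) t) (at t)"
        using DERIV_mult[OF 2 3] True
        by (simp add: flat_exp_def divide_inverse power_inverse power2_eq_square algebra_simps)
      then show ?thesis
        unfolding Suc by (simp add: divide_inverse power_inverse)
    qed
    then show ?thesis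
      by (rule has_field_derivative_transform_within_open[of _ _ _ "{0<..}"])
        (use True in \<open>auto simp: flat_exp_def\<close>)
  next
    case t: False
    have "((\<lambda>t. 0) has_real_derivative 0) (at t)" by simp
    then have "(flat_exp m has_real_derivative 0) (at t)"
      by (rule has_field_derivative_transform_within_open[of _ _ _ "{..<0}"])
        (use t False in \<open>auto simp: flat_exp_def\<close>)
    then show ?thesis using t by (simp add: flat_exp_def)
  qed
next
  case True
  have "((\<lambda>h. flat_exp m h / h) \<longlongrightarrow> 0) (at 0)"
  proof (rule tendsto_0_le[where K = "fact (m + 2)"])
    show "((\<lambda>h::real. h) \<longlongrightarrow> 0) (at 0)" by (rule tendsto_ident_at)
    have "\<bar>flat_exp m h / h\<bar> \<le> \<bar>h\<bar> * fact (m + 2)" if "h \<noteq> 0" for h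
    proof -
      \<comment> \<open>Moving up by two indices leaves a spare factor h next to a bounded function;
        one index would only show that the quotient is bounded.\<close>
      have "flat_exp m h / h = flat_exp (m + 2) h * h"
        using that by (simp add: flat_exp_def power2_eq_square)
      then show ?thesis
        using mult_left_mono[OF flat_exp_bound[of "m + 2" h], of "\<bar>h\<bar>"]
        by (simp only: abs_mult mult.commute[of "flat_exp (m + 2) h"] )
    qed
    then show "\<forall>\<^sub>F h in at 0. norm (flat_exp m h / h) \<le> norm h * fact (m + 2)"
      by (auto simp: eventually_at intro!: exI[of _ 1])
  qed
  with True show ?thesis
    by (simp add: has_field_derivative_iff flat_exp_def[of _ 0])
qed

lemma smooth1_flat_exp: "smooth1 (flat_exp m)"
proof -
  have "times_diff n (flat_exp m)" for n
  proof (induction n arbitrary: m)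
    case (Suc n)
    have "times_diff n (\<lambda>t. flat_exp (m + 2) t + (- real m) * flat_exp (m + 1) t)"
      by (intro times_diff_add times_diff_mult times_diff_const Suc)
    with flat_exp_DERIV[of m] show ?case
      by (auto intro!: exI[of _ "\<lambda>t. flat_exp (m + 2) t + (- real m) * flat_exp (m + 1) t"])
  qed simp
  then show ?thesis by (simp add: smooth1_def)
qed

text \<open>With an argument tending to infinity, \<open>flat_exp 0\<close> acts as a cut-off that
  opens up to 1, while the functions of positive index that arise from its derivative die
  out.\<close>

lemma flat_exp_tendsto:
  assumes "filterlim f at_top F"
  shows "((\<lambda>x. flat_exp 0 (f x)) \<longlongrightarrow> 1) F" and "m > 0 \<Longrightarrow> ((\<lambda>x. flat_exp m (f x)) \<longlongrightarrow> 0) F"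
proof -
  have pos: "\<forall>\<^sub>F t in at_top. (t::real) > 0" by (rule eventually_gt_at_top)
  have inv: "((\<lambda>t::real. 1 / t) \<longlongrightarrow> 0) at_top"
    using tendsto_inverse_0_at_top[OF filterlim_ident] by (simp add: inverse_eq_divide)
  have "((\<lambda>t::real. exp (- (1 / t))) \<longlongrightarrow> exp (- 0)) at_top"
    by (intro tendsto_intros inv)
  then have e: "((\<lambda>t::real. exp (- (1 / t))) \<longlongrightarrow> 1) at_top" by simp
  have "(flat_exp 0 \<longlongrightarrow> 1) at_top"
    by (rule Lim_transform_eventually[OF e])
      (use pos in \<open>eventually_elim, auto simp: flat_exp_def\<close>)
  from filterlim_compose[OF this assms] show "((\<lambda>x. flat_exp 0 (f x)) \<longlongrightarrow> 1) F" .
  show "((\<lambda>x. flat_exp m (f x)) \<longlongrightarrow> 0) F" if "m > 0"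
  proof -
    have "((\<lambda>t::real. exp (- (1 / t)) * (1 / t) ^ m) \<longlongrightarrow> 1 * 0 ^ m) at_top"
      by (intro tendsto_intros e inv)
    then have "((\<lambda>t::real. exp (- (1 / t)) * (1 / t) ^ m) \<longlongrightarrow> 0) at_top"
      using that by (simp add: power_0_left)
    then have "(flat_exp m \<longlongrightarrow> 0) at_top"
      by (rule Lim_transform_eventually)
        (use pos in \<open>eventually_elim, auto simp: flat_exp_def power_divide\<close>)
    from filterlim_compose[OF this assms] show ?thesis .
  qed
qed

section \<open>Cutting off a sine at the ends of an interval\<close>

text \<open>The parabola t (beta - t) is positive exactly between the end points. Subtracting 1
  makes the factor vanish unless n t (beta - t) > 1, which leaves a gap at both ends; as n grows the
  gap closes.\<close>

definition cut_sin :: "real \<Rightarrow> nat \<Rightarrow> nat \<Rightarrow> real \<Rightarrow> real" where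
  "cut_sin \<beta> k n t = sin (real k * pi / \<beta> * t) * flat_exp 0 (real n * (t * (\<beta> - t)) - 1)"

lemma smooth1_cut_sin: "smooth1 (cut_sin \<beta> k n)"
proof -
  have "smooth1 (\<lambda>t. real n * (t * (\<beta> + (-1) * t)) + (-1))"
    by (intro smooth1_add smooth1_mult smooth1_const smooth1_ident)
  from smooth1_compose[OF smooth1_flat_exp[of 0] this]
  have "smooth1 (\<lambda>t. flat_exp 0 (real n * (t * (\<beta> - t)) - 1))" by simp
  then show ?thesis unfolding cut_sin_def[abs_def]
    by (intro smooth1_mult smooth1_sin_mult)
qed

lemma cut_sin_nonzero: "cut_sin \<beta> k n t \<noteq> 0 \<Longrightarrow> 1 \<le> real n * (t * (\<beta> - t))"
  by (auto simp: cut_sin_def flat_exp_def split: if_splits)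

lemma cut_sin_deriv:
  "deriv (cut_sin \<beta> k n) t =
     real k * pi / \<beta> * cos (real k * pi / \<beta> * t) * flat_exp 0 (real n * (t * (\<beta> - t)) - 1) +
     sin (real k * pi / \<beta> * t) * (real n * (\<beta> - 2 * t)) * flat_exp 2 (real n * (t * (\<beta> - t)) - 1)"
proof -
  have 1: "((\<lambda>t. flat_exp 0 (real n * (t * (\<beta> - t)) - 1)) has_real_derivative
     flat_exp 2 (real n * (t * (\<beta> - t)) - 1) * (real n * (\<beta> - 2 * t))) (at t)"
  proof (rule DERIV_chain2[where f = "flat_exp 0"])
    show "(flat_exp 0 has_real_derivative flat_exp 2 (real n * (t * (\<beta> - t)) - 1))
        (at (real n * (t * (\<beta> - t)) - 1))"
      using flat_exp_DERIV[of 0] by (simp add: numeral_2_eq_2)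
    show "((\<lambda>t. real n * (t * (\<beta> - t)) - 1) has_real_derivative real n * (\<beta> - 2 * t)) (at t)"
      by (auto intro!: derivative_eq_intros simp: algebra_simps)
  qed
  have 2: "((\<lambda>t. sin (real k * pi / \<beta> * t)) has_real_derivative
      cos (real k * pi / \<beta> * t) * (real k * pi / \<beta>)) (at t)"
    by (rule DERIV_chain2[OF DERIV_sin DERIV_cmult_Id])
  show ?thesis unfolding cut_sin_def[abs_def]
    by (rule DERIV_imp_deriv) (use DERIV_mult[OF 2 1] in \<open>simp add: mult_ac add_ac\<close>)
qed

text \<open>The sine vanishes at both ends, so it is bounded by a t and, after reflecting t to beta
  - t, by a (beta - t), where a = k pi / beta. Weighting these two bounds with (beta - t) / beta and
  t / beta gives the parabola.\<close>

lemma sin_le_parabola: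
  assumes "0 < t" "t < \<beta>"
  shows "\<bar>sin (real k * pi / \<beta> * t)\<bar> \<le> 2 * real k * pi / \<beta>\<^sup>2 * (t * (\<beta> - t))"
proof -
  define a where "a = real k * pi / \<beta>"
  have a: "a \<ge> 0" using assms by (simp add: a_def)
  have 1: "\<bar>sin (a * t)\<bar> \<le> a * t"
    using abs_sin_x_le_abs_x[of "a * t"] a assms by simp
  have "sin (a * (\<beta> - t)) = sin (real k * pi - a * t)"
    using assms by (simp add: a_def field_simps)
  then have "\<bar>sin (a * t)\<bar> = \<bar>sin (a * (\<beta> - t))\<bar>"
    by (simp add: sin_diff sin_npi cos_npi abs_mult)
  then have 2: "\<bar>sin (a * t)\<bar> \<le> a * (\<beta> - t)"
    using abs_sin_x_le_abs_x[of "a * (\<beta> - t)"] a assms by simp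
  have "\<bar>sin (a * t)\<bar> * \<beta> = \<bar>sin (a * t)\<bar> * (\<beta> - t) + \<bar>sin (a * t)\<bar> * t"
    by (simp add: algebra_simps)
  also have "\<dots> \<le> a * t * (\<beta> - t) + a * (\<beta> - t) * t"
    by (intro add_mono mult_right_mono 1 2) (use assms in auto)
  finally have "\<bar>sin (a * t)\<bar> \<le> 2 * a * (t * (\<beta> - t)) / \<beta>"
    using assms by (simp add: field_simps)
  also have "\<dots> = 2 * real k * pi / \<beta>\<^sup>2 * (t * (\<beta> - t))"
    by (simp add: a_def power2_eq_square)
  finally show ?thesis by (simp add: a_def)
qed

text \<open>The dangerous part of the derivative is the sine times the slope of the cut-off.
  Bounding the sine by a multiple of t (beta - t) turns the factor n into n t (beta - t) = s + 1,
  with s the argument of \<open>flat_exp\<close>, and \<open>flat_exp_shift\<close> absorbs this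
  growth. So the bound is independent of n and this part tends to 0.\<close>

lemma cut_sin_approx:
  assumes "0 < \<beta>"
  obtains C where "\<And>n t. 0 < t \<Longrightarrow> t < \<beta> \<Longrightarrow> \<bar>cut_sin \<beta> k n t\<bar> \<le> C"
    and "\<And>n t. 0 < t \<Longrightarrow> t < \<beta> \<Longrightarrow> \<bar>deriv (cut_sin \<beta> k n) t\<bar> \<le> C"
    and "\<And>t. 0 < t \<Longrightarrow> t < \<beta> \<Longrightarrow> (\<lambda>n. cut_sin \<beta> k n t) \<longlonglongrightarrow> sin (real k * pi / \<beta> * t)"
    and "\<And>t. 0 < t \<Longrightarrow> t < \<beta> \<Longrightarrow>
      (\<lambda>n. deriv (cut_sin \<beta> k n) t) \<longlonglongrightarrow> real k * pi / \<beta> * cos (real k * pi / \<beta> * t)"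
proof -
  define a where "a = real k * pi / \<beta>"
  define D where "D = 2 * real k * pi / \<beta>\<^sup>2"
  have a: "a \<ge> 0" and D: "D \<ge> 0" using assms by (auto simp: a_def D_def)
  let ?s = "\<lambda>n t. real n * (t * (\<beta> - t)) - 1"
  let ?r = "\<lambda>n t. sin (a * t) * (real n * (\<beta> - 2 * t)) * flat_exp 2 (?s n t)"
  have rem: "\<bar>?r n t\<bar> \<le> D * \<beta> * (flat_exp 1 (?s n t) + flat_exp 2 (?s n t))"
    if t: "0 < t" "t < \<beta>" for n t
  proof (cases "?s n t > 0")
    case True
    have "\<bar>?r n t\<bar> = \<bar>sin (a * t)\<bar> * (real n * \<bar>\<beta> - 2 * t\<bar>) * flat_exp 2 (?s n t)"
      by (simp add: abs_mult flat_exp_def)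
    also have "\<dots> \<le> (D * (t * (\<beta> - t))) * (real n * \<beta>) * flat_exp 2 (?s n t)"
      using t D sin_le_parabola[OF t, of k]
      by (intro mult_mono mult_right_mono) (auto simp: a_def D_def flat_exp_def)
    also have "\<dots> = D * \<beta> * ((?s n t + 1) * flat_exp 2 (?s n t))"
      by (simp add: algebra_simps)
    also have "(?s n t + 1) * flat_exp 2 (?s n t) = flat_exp 1 (?s n t) + flat_exp 2 (?s n t)"
      by (rule flat_exp_shift[OF True])
    finally show ?thesis .
  qed (simp add: flat_exp_def)
  have lim: "filterlim (\<lambda>n. ?s n t) at_top sequentially" if "0 < t" "t < \<beta>" for t
  proof -
    have "filterlim (\<lambda>n. (t * (\<beta> - t)) * real n) at_top sequentially"
      using that by (intro filterlim_tendsto_pos_mult_at_top[OF tendsto_const _ filterlim_real_sequentially]) auto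
    from filterlim_tendsto_add_at_top[OF tendsto_const[of "-1"] this] show ?thesis
      by (simp add: mult.commute)
  qed
  have dr: "deriv (cut_sin \<beta> k n) t = a * cos (a * t) * flat_exp 0 (?s n t) + ?r n t" for n t
    by (simp only: cut_sin_deriv a_def)
  show thesis
  \<comment> \<open>The summands bound the function itself, the cosine part of the derivative and
    the remainder; 3 is 1! + 2! from \<open>flat_exp_bound\<close>.\<close>
  proof (rule that[of "1 + a + D * \<beta> * 3"])
    fix n t assume t: "0 < t" "t < \<beta>"
    have f0: "\<bar>flat_exp 0 (?s n t)\<bar> \<le> 1" using flat_exp_bound[of 0] by simp
    have "\<bar>cut_sin \<beta> k n t\<bar> \<le> 1 * 1"
      unfolding cut_sin_def abs_mult by (intro mult_mono f0) auto
    then show "\<bar>cut_sin \<beta> k n t\<bar> \<le> 1 + a + D * \<beta> * 3"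
      using a D assms by (simp add: add_increasing2)
    have "\<bar>a * cos (a * t) * flat_exp 0 (?s n t)\<bar> \<le> a * 1 * 1"
      unfolding abs_mult using a by (intro mult_mono f0) auto
    moreover have "\<bar>?r n t\<bar> \<le> D * \<beta> * 3"
    proof (rule order_trans[OF rem[OF t]])
      have "flat_exp 1 (?s n t) + flat_exp 2 (?s n t) \<le> 3"
        using flat_exp_bound[of 1 "?s n t"] flat_exp_bound[of 2 "?s n t"] by (simp add: fact_2)
      then show "D * \<beta> * (flat_exp 1 (?s n t) + flat_exp 2 (?s n t)) \<le> D * \<beta> * 3"
        using D assms by (intro mult_left_mono) auto
    qed
    ultimately show "\<bar>deriv (cut_sin \<beta> k n) t\<bar> \<le> 1 + a + D * \<beta> * 3"
      unfolding dr by linarith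
  next
    fix t assume t: "0 < t" "t < \<beta>"
    note l = flat_exp_tendsto[OF lim[OF t]]
    have "(\<lambda>n. sin (a * t) * flat_exp 0 (?s n t)) \<longlonglongrightarrow> sin (a * t) * 1"
      by (intro tendsto_intros l)
    then show "(\<lambda>n. cut_sin \<beta> k n t) \<longlonglongrightarrow> sin (real k * pi / \<beta> * t)"
      by (simp add: cut_sin_def a_def)
    have "(\<lambda>n. D * \<beta> * (flat_exp 1 (?s n t) + flat_exp 2 (?s n t))) \<longlonglongrightarrow> D * \<beta> * (0 + 0)"
      by (intro tendsto_intros l) auto
    then have "(\<lambda>n. D * \<beta> * (flat_exp 1 (?s n t) + flat_exp 2 (?s n t))) \<longlonglongrightarrow> 0" by simp
    then have "(\<lambda>n. ?r n t) \<longlonglongrightarrow> 0"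
      by (rule Lim_null_comparison[rotated]) (use rem[OF t] in simp)
    from tendsto_add[OF tendsto_mult[OF tendsto_const[of "a * cos (a * t)"] l(1)] this]
    show "(\<lambda>n. deriv (cut_sin \<beta> k n) t) \<longlonglongrightarrow> real k * pi / \<beta> * cos (real k * pi / \<beta> * t)"
      unfolding dr by (simp add: a_def)
  qed
qed

section \<open>Products of functions of one coordinate\<close>

text \<open>Sine modes, their cut-offs and \<open>probe\<close> all have this form, which reduces
  partial derivatives, smoothness and supports to one-variable statements.\<close>

definition coord_prod :: "('n \<Rightarrow> real \<Rightarrow> real) \<Rightarrow> real ^ 'n::finite \<Rightarrow> real" where
  "coord_prod F x = (\<Prod>i\<in>UNIV. F i (x $ i))"

lemma coord_prod_remove:
  "coord_prod F x = F i (x $ i) * (\<Prod>j\<in>UNIV - {i}. F j (x $ j))"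
  unfolding coord_prod_def by (rule prod.remove) auto

lemma coord_prod_update:
  "coord_prod (F(i := f)) x = f (x $ i) * (\<Prod>j\<in>UNIV - {i}. F j (x $ j))"
  unfolding coord_prod_remove[of _ _ i] by (auto intro!: prod.cong)

lemma partial_coord_prod:
  fixes F :: "'n::finite \<Rightarrow> real \<Rightarrow> real"
  assumes "smooth1 (F i)"
  shows "partial i (coord_prod F) = coord_prod (F(i := deriv (F i)))"
proof
  fix x :: "real ^ 'n"
  have "coord_prod F (x + t *\<^sub>R axis i 1) = F i (x $ i + t) * (\<Prod>j\<in>UNIV - {i}. F j (x $ j))" for t
    unfolding coord_prod_remove[of _ _ i] by (auto intro!: prod.cong simp: axis_def)
  moreover have "((\<lambda>t. F i (x $ i + t) * (\<Prod>j\<in>UNIV - {i}. F j (x $ j))) has_real_derivative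
      deriv (F i) (x $ i) * (\<Prod>j\<in>UNIV - {i}. F j (x $ j))) (at 0)"
    by (intro DERIV_cmult_right)
      (use DERIV_shift[of "F i" "deriv (F i) (x $ i)" 0 "x $ i"] smooth1_DERIV(1)[OF assms]
        in \<open>simp add: add.commute\<close>)
  ultimately show "partial i (coord_prod F) x = coord_prod (F(i := deriv (F i))) x"
    unfolding partial_def coord_prod_update by (simp add: DERIV_imp_deriv)
qed

lemma has_derivative_coord_prod:
  fixes F :: "'n::finite \<Rightarrow> real \<Rightarrow> real"
  assumes "\<And>i. smooth1 (F i)"
  shows "(coord_prod F has_derivative
    (\<lambda>h. \<Sum>i\<in>UNIV. deriv (F i) (x $ i) * h $ i * (\<Prod>j\<in>UNIV - {i}. F j (x $ j)))) (at x)"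
proof -
  have "((\<lambda>x. F i (x $ i)) has_derivative (\<lambda>h. deriv (F i) (x $ i) * h $ i)) (at x)" for i
    by (rule has_derivative_compose[OF bounded_linear_imp_has_derivative[OF bounded_linear_vec_nth]
        smooth1_DERIV(1)[OF assms, unfolded has_field_derivative_def]])
  then show ?thesis unfolding coord_prod_def[abs_def]
    by (rule has_derivative_prod)
qed

text \<open>Since \<open>partial i\<close> only replaces factor i by its derivative, every iterated
  partial is again a product of smooth factors, and only differentiability of such products remains
  to be shown.\<close>

lemma smooth_coord_prod:
  fixes F :: "'a::finite \<Rightarrow> real \<Rightarrow> real"
  assumes "\<And>i. smooth1 (F i)"
  shows "smooth (coord_prod F)"
proof -
  have ex: "\<exists>G. (\<forall>i. smooth1 (G i)) \<and> foldr partial is (coord_prod F) = coord_prod G" for "is"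
  proof (induction "is")
    case Nil
    with assms show ?case by auto
  next
    case (Cons i "is")
    then obtain G where G: "\<forall>i. smooth1 (G i)" "foldr partial is (coord_prod F) = coord_prod G"
      by blast
    then have "foldr partial (i # is) (coord_prod F) = coord_prod (G(i := deriv (G i)))"
      by (simp add: partial_coord_prod)
    moreover have "\<forall>j. smooth1 ((G(i := deriv (G i))) j)"
      using G(1) smooth1_DERIV(2) by simp
    ultimately show ?case by blast
  qed
  show ?thesis
    unfolding smooth_def
  proof
    fix "is"
    obtain G where G: "\<forall>i. smooth1 (G i)" "foldr partial is (coord_prod F) = coord_prod G"
      using ex by blast
    then show "foldr partial is (coord_prod F) differentiable_on UNIV"
      using has_derivative_coord_prod[of G]
      by (auto simp: differentiable_on_def differentiable_def)
  qed
qed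

lemma smooth_partial: "smooth f \<Longrightarrow> smooth (partial i f)"
  unfolding smooth_def
proof
  fix "is"
  assume "\<forall>is. foldr partial is f differentiable_on UNIV"
  \<comment> \<open>\<open>foldr\<close> applies the last entry of the list first, so the extra
    derivative is appended at the end.\<close>
  from this[THEN spec, of "is @ [i]"] show "foldr partial is (partial i f) differentiable_on UNIV"
    by simp
qed

lemma smooth_differentiable: "smooth f \<Longrightarrow> f differentiable (at x)"
  unfolding smooth_def
  by (drule spec[of _ "[]"]) (simp add: differentiable_on_def)

lemma smooth_continuous_on: "smooth f \<Longrightarrow> continuous_on S f"
  by (simp add: continuous_at_imp_continuous_on differentiable_imp_continuous_within smooth_differentiable)

section \<open>Inner products of square integrable functions\<close>

lemma L2_inner_commute: "L2_inner \<Omega> u v = L2_inner \<Omega> v u"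
  by (simp add: L2_inner_def mult.commute)

lemma L2_mult_integrable:
  assumes "u \<in> L2 \<Omega>" "v \<in> L2 \<Omega>"
  shows "integrable (lebesgue_on \<Omega>) (\<lambda>x. u x * v x)"
proof (rule Bochner_Integration.integrable_bound)
  show "integrable (lebesgue_on \<Omega>) (\<lambda>x. (u x)\<^sup>2 + (v x)\<^sup>2)"
    using assms by (auto simp: L2_def)
  show "(\<lambda>x. u x * v x) \<in> borel_measurable (lebesgue_on \<Omega>)"
    using assms by (auto simp: L2_def)
  have "\<bar>a * c\<bar> \<le> a\<^sup>2 + c\<^sup>2" for a c :: real
  proof -
    have "0 \<le> \<bar>a\<bar> * \<bar>c\<bar>" by simp
    then have "\<bar>a\<bar> * \<bar>c\<bar> \<le> 2 * \<bar>a\<bar> * \<bar>c\<bar>" by linarith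
    also have "\<dots> \<le> a\<^sup>2 + c\<^sup>2"
      using sum_squares_bound[of "\<bar>a\<bar>" "\<bar>c\<bar>"] by simp
    finally show ?thesis by (simp only: abs_mult)
  qed
  then show "AE x in lebesgue_on \<Omega>. norm (u x * v x) \<le> norm ((u x)\<^sup>2 + (v x)\<^sup>2)"
    by (auto intro!: AE_I2)
qed

lemma L2_scale: "u \<in> L2 \<Omega> \<Longrightarrow> (\<lambda>x. c * u x) \<in> L2 \<Omega>"
  by (auto simp: L2_def power_mult_distrib)

lemma L2_add:
  assumes "u \<in> L2 \<Omega>" "v \<in> L2 \<Omega>"
  shows "(\<lambda>x. u x + v x) \<in> L2 \<Omega>"
proof -
  have "integrable (lebesgue_on \<Omega>) (\<lambda>x. (u x)\<^sup>2 + (v x)\<^sup>2 + 2 * (u x * v x))"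
    using assms L2_mult_integrable[OF assms] by (auto simp: L2_def)
  then show ?thesis
    using assms by (auto simp: L2_def power2_sum mult.assoc)
qed

lemma L2_diff: "u \<in> L2 \<Omega> \<Longrightarrow> v \<in> L2 \<Omega> \<Longrightarrow> (\<lambda>x. u x - v x) \<in> L2 \<Omega>"
  using L2_add[OF _ L2_scale[of v \<Omega> "-1"], of u] by simp

lemma L2_zero: "(\<lambda>x. 0) \<in> L2 \<Omega>"
  by (simp add: L2_def)

lemma L2_sum: "(\<And>i. i \<in> I \<Longrightarrow> u i \<in> L2 \<Omega>) \<Longrightarrow> (\<lambda>x. \<Sum>i\<in>I. u i x) \<in> L2 \<Omega>"
  by (induction I rule: infinite_finite_induct) (auto simp: L2_zero intro!: L2_add)

lemma L2_inner_add:
  "u \<in> L2 \<Omega> \<Longrightarrow> v \<in> L2 \<Omega> \<Longrightarrow> w \<in> L2 \<Omega> \<Longrightarrow>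
    L2_inner \<Omega> (\<lambda>x. u x + v x) w = L2_inner \<Omega> u w + L2_inner \<Omega> v w"
  by (simp add: L2_inner_def distrib_right L2_mult_integrable)

lemma L2_inner_scale: "L2_inner \<Omega> (\<lambda>x. c * u x) w = c * L2_inner \<Omega> u w"
  by (simp add: L2_inner_def mult.assoc)

lemma L2_inner_scale_right: "L2_inner \<Omega> w (\<lambda>x. c * u x) = c * L2_inner \<Omega> w u"
  by (simp only: L2_inner_commute[of _ w] L2_inner_scale)

lemma L2_inner_diff:
  "u \<in> L2 \<Omega> \<Longrightarrow> v \<in> L2 \<Omega> \<Longrightarrow> w \<in> L2 \<Omega> \<Longrightarrow>
    L2_inner \<Omega> (\<lambda>x. u x - v x) w = L2_inner \<Omega> u w - L2_inner \<Omega> v w"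
  by (simp add: L2_inner_def left_diff_distrib L2_mult_integrable)

lemma L2_inner_sum:
  "(\<And>i. i \<in> I \<Longrightarrow> u i \<in> L2 \<Omega>) \<Longrightarrow> w \<in> L2 \<Omega> \<Longrightarrow>
    L2_inner \<Omega> (\<lambda>x. \<Sum>i\<in>I. u i x) w = (\<Sum>i\<in>I. L2_inner \<Omega> (u i) w)"
  by (simp add: L2_inner_def sum_distrib_right L2_mult_integrable Bochner_Integration.integral_sum)

lemma L2_inner_self_nonneg: "0 \<le> L2_inner \<Omega> u u"
  by (simp add: L2_inner_def)

lemma L2_Cauchy_Schwarz:
  assumes "u \<in> L2 \<Omega>" "v \<in> L2 \<Omega>"
  shows "\<bar>L2_inner \<Omega> u v\<bar> \<le> L2_norm \<Omega> u * L2_norm \<Omega> v"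
proof -
  let ?a = "L2_inner \<Omega> u u" and ?c = "L2_inner \<Omega> v v" and ?m = "L2_inner \<Omega> u v"
  have q: "0 \<le> s\<^sup>2 * ?a + t\<^sup>2 * ?c - 2 * (s * t) * ?m" for s t
  proof -
    have su: "(\<lambda>x. s * u x) \<in> L2 \<Omega>" and tv: "(\<lambda>x. t * v x) \<in> L2 \<Omega>"
      by (intro L2_scale assms)+
    let ?p = "\<lambda>x. s * u x - t * v x"
    have p: "?p \<in> L2 \<Omega>" by (rule L2_diff[OF su tv])
    have 1: "L2_inner \<Omega> ?p w = s * L2_inner \<Omega> u w - t * L2_inner \<Omega> v w" if "w \<in> L2 \<Omega>" for w
      by (simp only: L2_inner_diff[OF su tv that] L2_inner_scale)
    have "0 \<le> L2_inner \<Omega> ?p ?p"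
      by (rule L2_inner_self_nonneg)
    also have "\<dots> = s * L2_inner \<Omega> ?p u - t * L2_inner \<Omega> ?p v"
      by (simp only: 1[OF p] L2_inner_commute[of \<Omega> u ?p] L2_inner_commute[of \<Omega> v ?p])
    also have "\<dots> = s\<^sup>2 * ?a + t\<^sup>2 * ?c - 2 * (s * t) * ?m"
      by (simp only: 1[OF assms(1)] 1[OF assms(2)] L2_inner_commute[of \<Omega> v u])
        (simp add: power2_eq_square algebra_simps)
    finally show ?thesis .
  qed
  have "?m\<^sup>2 \<le> ?a * ?c"
  proof (cases "?a = 0")
    case True
    have "?m = 0"
    proof (rule ccontr)
      assume m: "?m \<noteq> 0"
      \<comment> \<open>With u of norm 0 the form is linear in s, and this s brings it down to c -
        (c + 1) = -1.\<close>
      have "0 \<le> ?c - 2 * ((?c + 1) / (2 * ?m)) * ?m"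
        using q[of "(?c + 1) / (2 * ?m)" 1] True by (simp add: mult.assoc)
      with m show False by (simp add: field_simps)
    qed
    with True show ?thesis by simp
  next
    case False
    then have a: "?a > 0" using L2_inner_self_nonneg[of \<Omega> u] by simp
    \<comment> \<open>With \<open>s = ?m\<close> and \<open>t = ?a\<close> the form factors into
      \<open>?a\<close> times the quantity to be estimated.\<close>
    have "0 \<le> ?a * (?a * ?c - ?m\<^sup>2)"
      using q[of ?m ?a] by (simp add: power2_eq_square algebra_simps)
    with a show ?thesis by (simp add: zero_le_mult_iff)
  qed
  then have "sqrt (?m\<^sup>2) \<le> sqrt (?a * ?c)" by (rule real_sqrt_le_mono)
  then show ?thesis by (simp add: L2_norm_def real_sqrt_mult)
qed

lemma L2_inner_tendsto:
  assumes "\<And>n. v n \<in> L2 \<Omega>" "u \<in> L2 \<Omega>" "P \<in> L2 \<Omega>"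
    and "(\<lambda>n. L2_norm \<Omega> (\<lambda>x. v n x - u x)) \<longlonglongrightarrow> 0"
  shows "(\<lambda>n. L2_inner \<Omega> (v n) P) \<longlonglongrightarrow> L2_inner \<Omega> u P"
proof -
  have "(\<lambda>n. L2_norm \<Omega> (\<lambda>x. v n x - u x) * L2_norm \<Omega> P) \<longlonglongrightarrow> 0"
    using tendsto_mult_right[OF assms(4)] by simp
  then have "(\<lambda>n. L2_inner \<Omega> (v n) P - L2_inner \<Omega> u P) \<longlonglongrightarrow> 0"
  proof (rule Lim_null_comparison[rotated], intro always_eventually allI)
    fix n
    show "norm (L2_inner \<Omega> (v n) P - L2_inner \<Omega> u P) \<le> L2_norm \<Omega> (\<lambda>x. v n x - u x) * L2_norm \<Omega> P"
      using L2_Cauchy_Schwarz[OF L2_diff[OF assms(1,2)] assms(3), of n]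
      by (simp add: L2_inner_diff assms)
  qed
  then show ?thesis by (simp add: LIM_zero_iff)
qed

lemma bounded_continuous_L2:
  fixes \<Omega> :: "(real ^ 'n::finite) set"
  assumes "open \<Omega>" "bounded \<Omega>" "continuous_on \<Omega> f" "bounded (f ` \<Omega>)"
  shows "f \<in> L2 \<Omega>"
proof -
  have L: "\<Omega> \<in> lmeasurable" using assms(1,2) by (intro lmeasurable_open)
  have m: "f \<in> borel_measurable (lebesgue_on \<Omega>)"
    using assms(1,3) by (intro continuous_imp_measurable_on_sets_lebesgue) auto
  obtain B where B: "\<And>x. x \<in> \<Omega> \<Longrightarrow> \<bar>f x\<bar> \<le> B"
    using assms(4) by (auto simp: bounded_iff)
  have "integrable (lebesgue_on \<Omega>) (\<lambda>x. (f x)\<^sup>2)"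
  proof (rule Bochner_Integration.integrable_bound)
    show "integrable (lebesgue_on \<Omega>) (\<lambda>x. B\<^sup>2)"
      by (rule finite_measure.integrable_const[OF finite_measure_lebesgue_on[OF L]])
    show "(\<lambda>x. (f x)\<^sup>2) \<in> borel_measurable (lebesgue_on \<Omega>)" using m by simp
    have "norm ((f x)\<^sup>2) \<le> norm (B\<^sup>2)" if "x \<in> \<Omega>" for x
      using B[OF that] by (auto simp: abs_le_square_iff[symmetric])
    then show "AE x in lebesgue_on \<Omega>. norm ((f x)\<^sup>2) \<le> norm (B\<^sup>2)"
      by (intro AE_I2) auto
  qed
  with m show ?thesis by (simp add: L2_def)
qed

lemma integrable_L2:
  fixes \<Omega> :: "(real ^ 'n::finite) set"
  assumes "open \<Omega>" "bounded \<Omega>" "u \<in> L2 \<Omega>"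
  shows "integrable (lebesgue_on \<Omega>) u"
proof -
  have "(\<lambda>x. 1) \<in> L2 \<Omega>"
    by (rule bounded_continuous_L2[OF assms(1,2)]) (auto simp: bounded_iff)
  from L2_mult_integrable[OF assms(3) this] show ?thesis by simp
qed

lemma smooth_L2:
  fixes \<Omega> :: "(real ^ 'n::finite) set"
  assumes "open \<Omega>" "bounded \<Omega>" "smooth f"
  shows "f \<in> L2 \<Omega>"
proof (rule bounded_continuous_L2[OF assms(1,2) smooth_continuous_on[OF assms(3)]])
  have "bounded (f ` closure \<Omega>)"
    using assms by (intro compact_imp_bounded compact_continuous_image smooth_continuous_on) auto
  then show "bounded (f ` \<Omega>)"
    by (rule bounded_subset) (use closure_subset in auto)
qed

text \<open>Weak convergence is all that is needed of cut-offs, so a uniform bound and pointwise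
  limits suffice. The dominating function is a multiple of |w|, integrable because the set is
  bounded.\<close>

lemma L2_dominated_convergence:
  fixes \<Omega> :: "(real ^ 'n::finite) set"
  assumes "open \<Omega>" "bounded \<Omega>" "w \<in> L2 \<Omega>"
    and "\<And>n. continuous_on \<Omega> (v n)" "continuous_on \<Omega> u"
    and C: "\<And>n x. x \<in> \<Omega> \<Longrightarrow> \<bar>v n x\<bar> \<le> C" and lim: "\<And>x. x \<in> \<Omega> \<Longrightarrow> (\<lambda>n. v n x) \<longlonglongrightarrow> u x"
  shows "(\<lambda>n. L2_inner \<Omega> w (v n)) \<longlonglongrightarrow> L2_inner \<Omega> w u"
  unfolding L2_inner_def
proof (rule integral_dominated_convergence)
  have m: "f \<in> borel_measurable (lebesgue_on \<Omega>)" if "continuous_on \<Omega> f" for f :: "real ^ 'n \<Rightarrow> real"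
    using assms(1) that by (intro continuous_imp_measurable_on_sets_lebesgue) auto
  have wm: "w \<in> borel_measurable (lebesgue_on \<Omega>)" using assms(3) by (simp add: L2_def)
  show "(\<lambda>x. w x * u x) \<in> borel_measurable (lebesgue_on \<Omega>)"
    "\<And>n. (\<lambda>x. w x * v n x) \<in> borel_measurable (lebesgue_on \<Omega>)"
    using wm m[OF assms(5)] m[OF assms(4)] by auto
  show "integrable (lebesgue_on \<Omega>) (\<lambda>x. \<bar>w x\<bar> * C)"
    using integrable_L2[OF assms(1-3)] by auto
  show "AE x in lebesgue_on \<Omega>. (\<lambda>n. w x * v n x) \<longlonglongrightarrow> w x * u x"
    using lim by (intro AE_I2 tendsto_intros) auto
  show "AE x in lebesgue_on \<Omega>. norm (w x * v n x) \<le> \<bar>w x\<bar> * C" for n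
    using C by (intro AE_I2) (auto simp: abs_mult intro!: mult_left_mono)
qed

text \<open>The integral forces f to vanish almost everywhere; by continuity its nonzero points form
  an open set, and a nonempty open set is never negligible.\<close>

lemma continuous_zero_integral:
  fixes f :: "real ^ 'n::finite \<Rightarrow> real"
  assumes "open \<Omega>" "continuous_on \<Omega> f" "integrable (lebesgue_on \<Omega>) f"
    and nn: "\<And>x. x \<in> \<Omega> \<Longrightarrow> 0 \<le> f x" and "(\<integral>x. f x \<partial>lebesgue_on \<Omega>) = 0" and "x \<in> \<Omega>"
  shows "f x = 0"
proof (rule ccontr)
  assume x: "f x \<noteq> 0"
  have "AE x in lebesgue_on \<Omega>. f x = 0"
    using assms(3,5) nn by (subst integral_nonneg_eq_0_iff_AE[symmetric]) (auto intro!: AE_I2)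
  then have "AE x in lebesgue. x \<in> \<Omega> \<longrightarrow> f x = 0"
    using assms(1) by (subst (asm) AE_restrict_space_iff) auto
  then have "negligible {x. \<not> (x \<in> \<Omega> \<longrightarrow> f x = 0)}"
    by (simp add: negligible_iff_null_sets eventually_ae_filter_negligible)
      (metis (no_types, lifting) Collect_mono_iff negligible_iff_null_sets negligible_subset)
  then have "negligible (\<Omega> \<inter> f -` (- {0}))"
    by (rule negligible_subset) auto
  moreover have "open (\<Omega> \<inter> f -` (- {0}))"
    using assms(1,2) by (intro continuous_open_preimage) auto
  ultimately show False
    using open_not_negligible x assms(6) by blast
qed

section \<open>Integration by parts against test functions\<close>

lemma partial_zero_outside:
  assumes "closed K" "\<And>x. x \<notin> K \<Longrightarrow> f x = 0" "x \<notin> K"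
  shows "partial i f x = 0"
proof -
  have 1: "open ((\<lambda>t::real. x + t *\<^sub>R axis i 1) -` (- K))"
    using assms(1) by (intro open_vimage) (auto intro!: continuous_intros)
  have 2: "0 \<in> (\<lambda>t::real. x + t *\<^sub>R axis i 1) -` (- K)"
    using assms(3) by simp
  have "((\<lambda>t. 0) has_real_derivative 0) (at 0)" by simp
  from has_field_derivative_transform_within_open[OF this 1 2, of "\<lambda>t. f (x + t *\<^sub>R axis i 1)"]
  have "((\<lambda>t. f (x + t *\<^sub>R axis i 1)) has_real_derivative 0) (at 0)"
    by (simp add: assms(2))
  then show ?thesis unfolding partial_def by (rule DERIV_imp_deriv)
qed

lemma partial_DERIV:
  fixes f :: "real ^ 'n::finite \<Rightarrow> real"
  assumes "f differentiable (at (x + t *\<^sub>R axis i 1))"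
  shows "((\<lambda>t. f (x + t *\<^sub>R axis i 1)) has_real_derivative partial i f (x + t *\<^sub>R axis i 1)) (at t)"
proof -
  obtain f' where f': "(f has_derivative f') (at (x + t *\<^sub>R axis i 1))"
    using assms by (auto simp: differentiable_def)
  have "((\<lambda>t::real. x + t *\<^sub>R axis i 1) has_derivative (\<lambda>t. t *\<^sub>R axis i 1)) (at t)"
    by (auto intro!: derivative_eq_intros)
  from has_derivative_compose[OF this f']
  have "(\<lambda>t. f (x + t *\<^sub>R axis i 1)) differentiable (at t)"
    by (auto simp: differentiable_def)
  then obtain D where D: "((\<lambda>t. f (x + t *\<^sub>R axis i 1)) has_real_derivative D) (at t)"
    by (auto simp: real_differentiable_def)
  then have "((\<lambda>h. f (x + (t + h) *\<^sub>R axis i 1)) has_real_derivative D) (at 0)"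
    using DERIV_shift[of "\<lambda>t. f (x + t *\<^sub>R axis i 1)" D 0 t] by (simp add: add.commute)
  then have "D = partial i f (x + t *\<^sub>R axis i 1)"
    unfolding partial_def by (simp add: DERIV_imp_deriv scaleR_left_distrib add.assoc)
  with D show ?thesis by simp
qed

lemma lborel_integral_translate:
  fixes f :: "real ^ 'n::finite \<Rightarrow> real"
  assumes "f \<in> borel_measurable borel"
  shows "(\<integral>x. f (c + x) \<partial>lborel) = (\<integral>x. f x \<partial>lborel)"
proof -
  have "(\<integral>x. f x \<partial>distr lborel borel ((+) c)) = (\<integral>x. f (c + x) \<partial>lborel)"
    using assms by (intro integral_distr) auto
  then show ?thesis by (simp add: lborel_distr_plus)
qed

text \<open>The difference quotients of \<open>f\<close> have integral \<open>0\<close> by translation invariance.\<close>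

lemma integral_partial_eq_0:
  fixes f :: "real ^ 'n::finite \<Rightarrow> real"
  assumes diff: "\<And>x. f differentiable (at x)" and cont: "continuous_on UNIV (partial i f)"
    and K: "compact K" "\<And>x. x \<notin> K \<Longrightarrow> f x = 0"
  shows "(\<integral>x. partial i f x \<partial>lborel) = 0"
proof -
  \<comment> \<open>Step lengths 1 / (n + 1) avoid division by zero and never exceed 1, so all
    quotients vanish outside one common ball.\<close>
  define q where "q n x = real (Suc n) * (f ((1 / real (Suc n)) *\<^sub>R axis i 1 + x) - f x)" for n x
  have cf: "continuous_on UNIV f"
    using diff by (simp add: continuous_at_imp_continuous_on differentiable_imp_continuous_within)
  then have mf: "f \<in> borel_measurable borel" by (rule borel_measurable_continuous_onI)
  have intf: "integrable lborel g" if "continuous_on UNIV g" "\<And>x. x \<notin> K \<Longrightarrow> g x = 0"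
    for g :: "real ^ 'n \<Rightarrow> real"
  proof -
    have "integrable lborel (\<lambda>x. indicator K x *\<^sub>R g x)"
      using borel_integrable_compact[OF K(1) continuous_on_subset[OF that(1)]] by simp
    moreover have "(\<lambda>x. indicator K x *\<^sub>R g x) = g"
      using that(2) by (auto simp: indicator_def fun_eq_iff)
    ultimately show ?thesis by simp
  qed
  have pz: "partial i f x = 0" if "x \<notin> K" for x
    using partial_zero_outside[OF compact_imp_closed[OF K(1)] K(2) that] .
  obtain B where B: "\<And>x. \<bar>partial i f x\<bar> \<le> B"
  proof -
    have "bounded (partial i f ` K)"
      using K(1) cont by (intro compact_imp_bounded compact_continuous_image)
        (auto intro: continuous_on_subset)
    then obtain B where "\<And>x. x \<in> K \<Longrightarrow> \<bar>partial i f x\<bar> \<le> B" by (auto simp: bounded_iff)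
    then have "\<bar>partial i f x\<bar> \<le> max B 0" for x
      using pz[of x] by (cases "x \<in> K") (auto simp: le_max_iff_disj)
    then show ?thesis by (rule that)
  qed
  obtain R where R: "\<And>x. x \<in> K \<Longrightarrow> norm x \<le> R"
    using compact_imp_bounded[OF K(1)] by (auto simp: bounded_iff)
  have qB: "\<bar>q n x\<bar> \<le> B" for n x
  proof -
    \<comment> \<open>By the mean value theorem a quotient is a value of the partial derivative,
      hence bounded by the same B.\<close>
    obtain z where z: "f (x + (1 / real (Suc n)) *\<^sub>R axis i 1) - f (x + 0 *\<^sub>R axis i 1) =
        (1 / real (Suc n) - 0) * partial i f (x + z *\<^sub>R axis i 1)"
      using MVT2[of 0 "1 / real (Suc n)" "\<lambda>t. f (x + t *\<^sub>R axis i 1)" "\<lambda>t. partial i f (x + t *\<^sub>R axis i 1)"]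
        partial_DERIV[OF diff] by auto
    then have "q n x = partial i f (x + z *\<^sub>R axis i 1)"
      by (simp add: q_def add.commute)
    then show ?thesis using B by simp
  qed
  have qz: "q n x = 0" if "x \<notin> cball 0 (R + 1)" for n x
  proof -
    have "norm ((1 / real (Suc n)) *\<^sub>R axis i (1::real)) \<le> (1::real)"
      by (simp add: norm_axis_1)
    moreover have "norm x \<le> norm ((1 / real (Suc n)) *\<^sub>R axis i 1 + x) + norm ((1 / real (Suc n)) *\<^sub>R axis i (1::real))"
      using norm_triangle_ineq4[of "(1 / real (Suc n)) *\<^sub>R axis i 1 + x" "(1 / real (Suc n)) *\<^sub>R axis i (1::real)"]
      by simp
    ultimately have "norm x \<le> norm ((1 / real (Suc n)) *\<^sub>R axis i 1 + x) + 1"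
      by linarith
    then have "x \<notin> K" "(1 / real (Suc n)) *\<^sub>R axis i 1 + x \<notin> K"
      using R[of x] R[of "(1 / real (Suc n)) *\<^sub>R axis i 1 + x"] that by (auto simp del: of_nat_Suc)
    then show ?thesis by (simp add: q_def K(2))
  qed
  have ifn: "integrable lborel f" by (rule intf[OF cf K(2)])
  have int0: "(\<integral>x. q n x \<partial>lborel) = 0" for n
  proof -
    have "integrable (distr lborel borel ((+) ((1 / real (Suc n)) *\<^sub>R axis i 1))) f"
      using ifn by (simp add: lborel_distr_plus)
    then have "integrable lborel (\<lambda>x. f ((1 / real (Suc n)) *\<^sub>R axis i 1 + x))"
      by (subst (asm) integrable_distr_eq) (use mf in auto)
    with ifn show ?thesis
      unfolding q_def by (simp add: lborel_integral_translate[OF mf])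
  qed
  have "(\<lambda>n. \<integral>x. q n x \<partial>lborel) \<longlonglongrightarrow> (\<integral>x. partial i f x \<partial>lborel)"
  proof (rule integral_dominated_convergence)
    show "partial i f \<in> borel_measurable lborel"
      using cont by (simp add: borel_measurable_continuous_onI)
    show "q n \<in> borel_measurable lborel" for n
      unfolding q_def[abs_def] using mf by measurable
    show "integrable lborel (\<lambda>x. indicator (cball 0 (R + 1)) x *\<^sub>R B)"
      by (rule borel_integrable_compact) auto
    show "AE x in lborel. norm (q n x) \<le> indicator (cball 0 (R + 1)) x *\<^sub>R B" for n
      using qB[of n] qz[of _ n] by (intro AE_I2) (auto simp: indicator_def)
    have "(\<lambda>n. q n x) \<longlonglongrightarrow> partial i f x" for x
    proof -
      have "((\<lambda>h. (f (x + h *\<^sub>R axis i 1) - f x) / h) \<longlongrightarrow> partial i f x) (at 0)"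
        using partial_DERIV[OF diff, where t = 0 and x = x and i = i] by (simp add: has_field_derivative_iff)
      moreover have "filterlim (\<lambda>n. 1 / real (Suc n)) (at 0) sequentially"
        using LIMSEQ_inverse_real_of_nat by (auto simp: filterlim_at inverse_eq_divide)
      ultimately have "(\<lambda>n. (f (x + (1 / real (Suc n)) *\<^sub>R axis i 1) - f x) / (1 / real (Suc n))) \<longlonglongrightarrow> partial i f x"
        by (rule filterlim_compose)
      then show ?thesis by (simp add: q_def mult.commute add.commute)
    qed
    then show "AE x in lborel. (\<lambda>n. q n x) \<longlonglongrightarrow> partial i f x" by simp
  qed
  then show ?thesis by (simp add: int0 LIMSEQ_const_iff)
qed

lemma L2_inner_eq_lborel:
  fixes u v :: "real ^ 'n::finite \<Rightarrow> real"
  assumes "open \<Omega>" "\<And>x. x \<notin> \<Omega> \<Longrightarrow> u x * v x = 0" "continuous_on UNIV u" "continuous_on UNIV v"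
  shows "L2_inner \<Omega> u v = (\<integral>x. u x * v x \<partial>lborel)"
proof -
  have "L2_inner \<Omega> u v = (\<integral>x. indicator \<Omega> x *\<^sub>R (u x * v x) \<partial>lebesgue)"
    unfolding L2_inner_def using assms(1) by (intro integral_restrict_space) auto
  also have "(\<lambda>x. indicator \<Omega> x *\<^sub>R (u x * v x)) = (\<lambda>x. u x * v x)"
    using assms(2) by (auto simp: indicator_def fun_eq_iff)
  also have "(\<integral>x. u x * v x \<partial>lebesgue) = (\<integral>x. u x * v x \<partial>lborel)"
    using assms(3,4) by (intro integral_completion)
      (auto intro!: borel_measurable_continuous_onI continuous_on_mult)
  finally show ?thesis .
qed

lemma test_functionsD:
  assumes "v \<in> test_functions \<Omega>"
  shows "smooth v" and "partial i v \<in> test_functions \<Omega>"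
    and "x \<notin> closure {x. v x \<noteq> 0} \<Longrightarrow> v x = 0" and "x \<notin> \<Omega> \<Longrightarrow> v x = 0"
proof -
  let ?K = "closure {x. v x \<noteq> 0}"
  show s: "smooth v" using assms by (simp add: test_functions_def)
  show z: "x \<notin> ?K \<Longrightarrow> v x = 0" for x
    using closure_subset[of "{x. v x \<noteq> 0}"] by blast
  have sub: "?K \<subseteq> \<Omega>" using assms by (simp add: test_functions_def)
  show "x \<notin> \<Omega> \<Longrightarrow> v x = 0" using z[of x] sub by blast
  have "partial i v x = 0" if "x \<notin> ?K" for x
    by (rule partial_zero_outside[OF closed_closure z that])
  then have "{x. partial i v x \<noteq> 0} \<subseteq> ?K" by blast
  then have sub: "closure {x. partial i v x \<noteq> 0} \<subseteq> ?K"
    by (rule closure_minimal) simp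
  have "compact (closure {x. partial i v x \<noteq> 0})"
    using assms compact_Int_closed[OF _ closed_closure, of ?K "{x. partial i v x \<noteq> 0}"] sub
    by (simp add: test_functions_def inf.absorb2)
  with sub show "partial i v \<in> test_functions \<Omega>"
    using assms smooth_partial[OF s] by (auto simp: test_functions_def)
qed

text \<open>The integral of \<open>partial i\<close> of the product v P is zero. Compact support of
  v alone yields this, so P may be nonzero at the boundary, as derivatives of sine modes
  are.\<close>

lemma L2_inner_by_parts:
  fixes v P :: "real ^ 'n::finite \<Rightarrow> real"
  assumes "open \<Omega>" "bounded \<Omega>" "v \<in> test_functions \<Omega>" "smooth P"
  shows "L2_inner \<Omega> (partial i v) P = - L2_inner \<Omega> v (partial i P)"
proof -
  let ?f = "\<lambda>x. v x * P x"
  note t = test_functionsD[OF assms(3)]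
  note d = smooth_differentiable[OF t(1)] smooth_differentiable[OF assms(4)]
  have p: "partial i ?f x = partial i v x * P x + v x * partial i P x" for x
  proof -
    have "((\<lambda>t. v (x + t *\<^sub>R axis i 1) * P (x + t *\<^sub>R axis i 1)) has_real_derivative
      partial i v x * P x + partial i P x * v x) (at 0)"
      using DERIV_mult[OF partial_DERIV[OF d(1), where t = 0 and x = x and i = i] partial_DERIV[OF d(2), where t = 0 and x = x and i = i]]
      by simp
    then show ?thesis by (subst partial_def) (simp add: DERIV_imp_deriv mult.commute)
  qed
  have c: "continuous_on UNIV v" "continuous_on UNIV P" "continuous_on UNIV (partial i v)"
    "continuous_on UNIV (partial i P)"
    using t(1) assms(4) by (auto intro: smooth_continuous_on smooth_partial)
  have "(\<integral>x. partial i ?f x \<partial>lborel) = 0"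
  proof (rule integral_partial_eq_0)
    show "?f differentiable (at x)" for x using d by simp
    show "continuous_on UNIV (partial i ?f)"
      unfolding p[abs_def] using c by (intro continuous_intros)
    show "compact (closure {x. v x \<noteq> 0})" using assms(3) by (simp add: test_functions_def)
    show "?f x = 0" if "x \<notin> closure {x. v x \<noteq> 0}" for x using t(3)[OF that] by simp
  qed
  moreover have "L2_inner \<Omega> (partial i v) P + L2_inner \<Omega> v (partial i P) = L2_inner \<Omega> (partial i ?f) (\<lambda>x. 1)"
  proof -
    have "v \<in> L2 \<Omega>" "P \<in> L2 \<Omega>" "partial i v \<in> L2 \<Omega>" "partial i P \<in> L2 \<Omega>"
      using t(1) assms(4) by (auto intro!: smooth_L2[OF assms(1,2)] smooth_partial)
    then show ?thesis
      by (simp add: L2_inner_def p L2_mult_integrable)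
  qed
  moreover have "L2_inner \<Omega> (partial i ?f) (\<lambda>x. 1) = (\<integral>x. partial i ?f x * 1 \<partial>lborel)"
    using c by (intro L2_inner_eq_lborel assms(1))
      (auto simp: p[abs_def] t(4) test_functionsD(4)[OF t(2)] intro!: continuous_intros)
  ultimately show ?thesis by simp
qed

section \<open>The sine modes of a box\<close>

definition freq :: "real ^ 'n::finite \<Rightarrow> ('n \<Rightarrow> nat) \<Rightarrow> 'n \<Rightarrow> real" where
  "freq b k i = real (k i) * pi / b $ i"

definition sine_mode :: "real ^ 'n::finite \<Rightarrow> ('n \<Rightarrow> nat) \<Rightarrow> real ^ 'n \<Rightarrow> real" where
  "sine_mode b k = coord_prod (\<lambda>i t. sin (freq b k i * t))"

definition eigval :: "real ^ 'n::finite \<Rightarrow> ('n \<Rightarrow> nat) \<Rightarrow> real" where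
  "eigval b k = (\<Sum>i\<in>UNIV. (freq b k i)\<^sup>2)"

text \<open>An index with a zero entry would give the zero function.\<close>

definition modes :: "('n \<Rightarrow> nat) set" where
  "modes = {k. \<forall>i. 1 \<le> k i}"

definition cut_mode :: "real ^ 'n::finite \<Rightarrow> ('n \<Rightarrow> nat) \<Rightarrow> nat \<Rightarrow> real ^ 'n \<Rightarrow> real" where
  "cut_mode b k n = coord_prod (\<lambda>i. cut_sin (b $ i) (k i) n)"

lemma deriv_sin_mult: "deriv (\<lambda>t. sin (c * t)) = (\<lambda>t. c * cos (c * t))" for c :: real
proof
  show "deriv (\<lambda>t. sin (c * t)) t = c * cos (c * t)" for t
    by (rule DERIV_imp_deriv) (auto intro!: derivative_eq_intros)
qed

lemma deriv_deriv_sin_mult: "deriv (deriv (\<lambda>t. sin (c * t))) = (\<lambda>t. - c\<^sup>2 * sin (c * t))" for c :: real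
proof
  show "deriv (deriv (\<lambda>t. sin (c * t))) t = - c\<^sup>2 * sin (c * t)" for t
    unfolding deriv_sin_mult
    by (rule DERIV_imp_deriv) (auto intro!: derivative_eq_intros simp: power2_eq_square)
qed

lemma smooth_sine_mode: "smooth (sine_mode b k)"
  unfolding sine_mode_def by (intro smooth_coord_prod smooth1_sin_mult)

lemma partial_sine_mode:
  "partial i (sine_mode b k) x =
    freq b k i * cos (freq b k i * x $ i) * (\<Prod>j\<in>UNIV - {i}. sin (freq b k j * x $ j))"
  unfolding sine_mode_def
  by (simp add: partial_coord_prod[OF smooth1_sin_mult] coord_prod_update deriv_sin_mult)

lemma partial_partial_sine_mode:
  "partial i (partial i (sine_mode b k)) = (\<lambda>x. - (freq b k i)\<^sup>2 * sine_mode b k x)"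
proof -
  let ?F = "\<lambda>i t. sin (freq b k i * t)"
  have "partial i (partial i (sine_mode b k)) = coord_prod (?F(i := deriv (deriv (?F i))))"
    unfolding sine_mode_def
    using smooth1_DERIV(2)[OF smooth1_sin_mult, of "freq b k i"]
    by (simp add: partial_coord_prod[OF smooth1_sin_mult] partial_coord_prod)
  then show ?thesis
    unfolding deriv_deriv_sin_mult sine_mode_def
    by (auto simp: fun_eq_iff coord_prod_update coord_prod_remove[of _ _ i])
qed

lemma finite_modes_eigval:
  fixes b :: "real ^ 'n::finite"
  assumes "\<And>i. 0 < b $ i"
  shows "finite {k. eigval b k = \<mu>}"
proof (rule finite_subset)
  \<comment> \<open>Each squared frequency is one of the nonnegative summands of the eigenvalue, so
    no frequency exceeds the square root of \<mu>.\<close>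
  let ?B = "\<lambda>i. nat \<lceil>sqrt \<mu> * b $ i / pi\<rceil>"
  show "finite (Pi\<^sub>E UNIV (\<lambda>i. {..?B i}))" by (rule finite_PiE) auto
  show "{k. eigval b k = \<mu>} \<subseteq> Pi\<^sub>E UNIV (\<lambda>i. {..?B i})"
  proof
    fix k assume "k \<in> {k. eigval b k = \<mu>}"
    then have \<mu>: "\<mu> = (\<Sum>i\<in>UNIV. (freq b k i)\<^sup>2)" by (simp add: eigval_def)
    have "k i \<le> ?B i" for i
    proof -
      have "(freq b k i)\<^sup>2 \<le> \<mu>" unfolding \<mu> by (rule member_le_sum) auto
      moreover have "0 \<le> freq b k i" using assms[of i] by (simp add: freq_def)
      ultimately have "freq b k i \<le> sqrt \<mu>" by (simp add: real_le_rsqrt)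
      then have "real (k i) \<le> sqrt \<mu> * b $ i / pi"
        using assms[of i] by (simp add: freq_def field_simps)
      then show ?thesis by linarith
    qed
    then show "k \<in> Pi\<^sub>E UNIV (\<lambda>i. {..?B i})" by auto
  qed
qed

locale positive_box =
  fixes b :: "real ^ 'n::finite"
  assumes pos: "0 < b $ i"
begin

abbreviation \<Omega> :: "(real ^ 'n) set" where "\<Omega> \<equiv> box 0 b"

lemma mem_\<Omega>: "x \<in> \<Omega> \<longleftrightarrow> (\<forall>i. 0 < x $ i \<and> x $ i < b $ i)"
  by (simp add: mem_box_cart)

lemma sine_mode_L2: "sine_mode b k \<in> L2 \<Omega>" "partial i (sine_mode b k) \<in> L2 \<Omega>"
  by (auto intro!: smooth_L2 smooth_partial smooth_sine_mode open_box bounded_box)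

section \<open>Approximation of sine modes by test functions\<close>

lemma cut_mode_test: "cut_mode b k n \<in> test_functions \<Omega>"
proof -
  \<comment> \<open>The closure of the support has to lie in the open box, so it is trapped in a
    closed set: the non-strict bound 1 still keeps every coordinate strictly between its end
    points.\<close>
  let ?S = "{x. \<forall>i. 1 \<le> real n * (x $ i * (b $ i - x $ i))}"
  have S: "closed ?S"
    by (intro closed_Collect_all closed_Collect_le continuous_intros)
  have sub: "?S \<subseteq> \<Omega>"
  proof
    fix x assume x: "x \<in> ?S"
    have "0 < x $ i \<and> x $ i < b $ i" for i
    proof -
      have "0 < real n * (x $ i * (b $ i - x $ i))" using x by (auto intro: less_le_trans[of 0 1])
      then have "0 < x $ i * (b $ i - x $ i)" by (simp add: zero_less_mult_iff)
      then show ?thesis using pos[of i] by (auto simp: zero_less_mult_iff)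
    qed
    then show "x \<in> \<Omega>" by (simp add: mem_\<Omega>)
  qed
  have "{x. cut_mode b k n x \<noteq> 0} \<subseteq> ?S"
    by (auto simp: cut_mode_def coord_prod_def dest: cut_sin_nonzero)
  then have cl: "closure {x. cut_mode b k n x \<noteq> 0} \<subseteq> ?S"
    using S by (rule closure_minimal)
  moreover have "bounded (closure {x. cut_mode b k n x \<noteq> 0})"
    by (rule bounded_subset[OF bounded_box order_trans[OF cl sub]])
  ultimately show ?thesis
    using sub by (auto simp: test_functions_def compact_eq_bounded_closed cut_mode_def
        intro!: smooth_coord_prod smooth1_cut_sin)
qed

lemma cut_mode_approx:
  obtains C where "\<And>n x. x \<in> \<Omega> \<Longrightarrow> \<bar>cut_mode b k n x\<bar> \<le> C"
    and "\<And>n x i. x \<in> \<Omega> \<Longrightarrow> \<bar>partial i (cut_mode b k n) x\<bar> \<le> C"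
    and "\<And>x. x \<in> \<Omega> \<Longrightarrow> (\<lambda>n. cut_mode b k n x) \<longlonglongrightarrow> sine_mode b k x"
    and "\<And>x i. x \<in> \<Omega> \<Longrightarrow> (\<lambda>n. partial i (cut_mode b k n) x) \<longlonglongrightarrow> partial i (sine_mode b k) x"
proof -
  have "\<exists>C. \<forall>t. 0 < t \<longrightarrow> t < b $ i \<longrightarrow>
      (\<forall>n. \<bar>cut_sin (b $ i) (k i) n t\<bar> \<le> C \<and> \<bar>deriv (cut_sin (b $ i) (k i) n) t\<bar> \<le> C) \<and>
      (\<lambda>n. cut_sin (b $ i) (k i) n t) \<longlonglongrightarrow> sin (freq b k i * t) \<and>
      (\<lambda>n. deriv (cut_sin (b $ i) (k i) n) t) \<longlonglongrightarrow> freq b k i * cos (freq b k i * t)" for i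
    unfolding freq_def by (rule cut_sin_approx[OF pos[of i], of "k i"]) blast
  then obtain C where C: "\<And>i t. 0 < t \<Longrightarrow> t < b $ i \<Longrightarrow>
      (\<forall>n. \<bar>cut_sin (b $ i) (k i) n t\<bar> \<le> C i \<and> \<bar>deriv (cut_sin (b $ i) (k i) n) t\<bar> \<le> C i) \<and>
      (\<lambda>n. cut_sin (b $ i) (k i) n t) \<longlonglongrightarrow> sin (freq b k i * t) \<and>
      (\<lambda>n. deriv (cut_sin (b $ i) (k i) n) t) \<longlonglongrightarrow> freq b k i * cos (freq b k i * t)"
    by metis
  have p: "partial i (cut_mode b k n) =
      coord_prod ((\<lambda>i. cut_sin (b $ i) (k i) n)(i := deriv (cut_sin (b $ i) (k i) n)))" for i n
    unfolding cut_mode_def by (rule partial_coord_prod) (rule smooth1_cut_sin)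
  show thesis
  proof (rule that[of "\<Prod>i\<in>UNIV. C i"])
    fix x :: "real ^ 'n" and n i assume x: "x \<in> \<Omega>"
    then have Cx: "(\<forall>n. \<bar>cut_sin (b $ i) (k i) n (x $ i)\<bar> \<le> C i \<and> \<bar>deriv (cut_sin (b $ i) (k i) n) (x $ i)\<bar> \<le> C i)"
        "(\<lambda>n. cut_sin (b $ i) (k i) n (x $ i)) \<longlonglongrightarrow> sin (freq b k i * x $ i)"
        "(\<lambda>n. deriv (cut_sin (b $ i) (k i) n) (x $ i)) \<longlonglongrightarrow> freq b k i * cos (freq b k i * x $ i)"
      for i using C[of "x $ i" i] by (auto simp: mem_\<Omega>)
    show "\<bar>cut_mode b k n x\<bar> \<le> (\<Prod>i\<in>UNIV. C i)"
      unfolding cut_mode_def coord_prod_def abs_prod using Cx(1) by (intro prod_mono) auto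
    show "\<bar>partial i (cut_mode b k n) x\<bar> \<le> (\<Prod>i\<in>UNIV. C i)"
      unfolding p coord_prod_def abs_prod using Cx(1) by (intro prod_mono) auto
    show "(\<lambda>n. cut_mode b k n x) \<longlonglongrightarrow> sine_mode b k x"
      unfolding cut_mode_def coord_prod_def sine_mode_def using Cx(2) by (intro tendsto_prod)
    show "(\<lambda>n. partial i (cut_mode b k n) x) \<longlonglongrightarrow> partial i (sine_mode b k) x"
      unfolding p coord_prod_update partial_sine_mode by (intro tendsto_mult Cx tendsto_prod)
  qed
qed

text \<open>Paired with any function in \<open>L2\<close>, a sine mode and its partials are limits
  of test functions; \<open>cut_mode_approx\<close> supplies the bound and the pointwise limits for
  dominated convergence.\<close>

lemma L2_inner_cut_mode:
  assumes "w \<in> L2 \<Omega>"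
  shows "(\<lambda>n. L2_inner \<Omega> w (cut_mode b k n)) \<longlonglongrightarrow> L2_inner \<Omega> w (sine_mode b k)"
    and "(\<lambda>n. L2_inner \<Omega> w (partial i (cut_mode b k n))) \<longlonglongrightarrow> L2_inner \<Omega> w (partial i (sine_mode b k))"
proof -
  obtain C where C: "\<And>n x. x \<in> \<Omega> \<Longrightarrow> \<bar>cut_mode b k n x\<bar> \<le> C"
    "\<And>n x i. x \<in> \<Omega> \<Longrightarrow> \<bar>partial i (cut_mode b k n) x\<bar> \<le> C"
    "\<And>x. x \<in> \<Omega> \<Longrightarrow> (\<lambda>n. cut_mode b k n x) \<longlonglongrightarrow> sine_mode b k x"
    "\<And>x i. x \<in> \<Omega> \<Longrightarrow> (\<lambda>n. partial i (cut_mode b k n) x) \<longlonglongrightarrow> partial i (sine_mode b k) x"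
    by (rule cut_mode_approx[of k], rule that)
  have s: "smooth (cut_mode b k n)" for n using test_functionsD(1)[OF cut_mode_test] .
  show "(\<lambda>n. L2_inner \<Omega> w (cut_mode b k n)) \<longlonglongrightarrow> L2_inner \<Omega> w (sine_mode b k)"
    by (rule L2_dominated_convergence[OF open_box bounded_box assms _ _ C(1,3)])
      (auto intro!: smooth_continuous_on smooth_partial s smooth_sine_mode)
  show "(\<lambda>n. L2_inner \<Omega> w (partial i (cut_mode b k n))) \<longlonglongrightarrow> L2_inner \<Omega> w (partial i (sine_mode b k))"
    by (rule L2_dominated_convergence[OF open_box bounded_box assms _ _ C(2,4)])
      (auto intro!: smooth_continuous_on smooth_partial s smooth_sine_mode)
qed

text \<open>The formula for compact support passes to the limit over the cut-off modes. No boundary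
  term appears because the sine mode vanishes on the boundary, whatever P does there.\<close>

lemma sine_mode_by_parts:
  assumes "smooth P"
  shows "L2_inner \<Omega> (partial i (sine_mode b k)) P = - L2_inner \<Omega> (sine_mode b k) (partial i P)"
proof -
  have P: "P \<in> L2 \<Omega>" "partial i P \<in> L2 \<Omega>"
    using assms by (auto intro!: smooth_L2 smooth_partial open_box bounded_box)
  have "L2_inner \<Omega> P (partial i (cut_mode b k n)) = - L2_inner \<Omega> (partial i P) (cut_mode b k n)" for n
    using L2_inner_by_parts[OF open_box bounded_box cut_mode_test assms]
    by (simp only: L2_inner_commute[of _ P] L2_inner_commute[of _ "partial i P"])
  then have "(\<lambda>n. - L2_inner \<Omega> (partial i P) (cut_mode b k n)) \<longlonglongrightarrow> L2_inner \<Omega> P (partial i (sine_mode b k))"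
    using L2_inner_cut_mode(2)[OF P(1), where i = i and k = k] by simp
  from LIMSEQ_unique[OF this tendsto_minus[OF L2_inner_cut_mode(1)[OF P(2)]]] show ?thesis
    by (simp only: L2_inner_commute[of _ P] L2_inner_commute[of _ "partial i P"])
qed

text \<open>Take a direction i in which the indices differ. Integrating the product of the two i-th
  partials by parts, onto either factor, gives the inner product times either squared frequency.
  Using one direction instead of the Laplacian also separates modes that share an
  eigenvalue.\<close>

lemma sine_mode_orthogonal:
  assumes "k \<noteq> m"
  shows "L2_inner \<Omega> (sine_mode b k) (sine_mode b m) = 0"
proof -
  obtain i where i: "k i \<noteq> m i" using assms by auto
  let ?I = "L2_inner \<Omega> (sine_mode b k) (sine_mode b m)"
  have parts: "L2_inner \<Omega> (partial i (sine_mode b p)) (partial i (sine_mode b q)) =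
      (freq b q i)\<^sup>2 * L2_inner \<Omega> (sine_mode b p) (sine_mode b q)" for p q
    unfolding sine_mode_by_parts[OF smooth_partial[OF smooth_sine_mode]] partial_partial_sine_mode
    by (subst L2_inner_scale_right) simp
  have "(freq b m i)\<^sup>2 * ?I = (freq b k i)\<^sup>2 * ?I"
    using parts[of k m] parts[of m k]
    by (simp add: L2_inner_commute[of _ "sine_mode b m" "sine_mode b k"]
        L2_inner_commute[of _ "partial i (sine_mode b m)" "partial i (sine_mode b k)"])
  moreover have "(freq b m i)\<^sup>2 \<noteq> (freq b k i)\<^sup>2"
    using i pos[of i] by (auto simp: freq_def power_divide power_mult_distrib less_imp_neq)
  ultimately show ?thesis by simp
qed

lemma sine_mode_norm_pos:
  assumes "k \<in> modes"
  shows "0 < L2_inner \<Omega> (sine_mode b k) (sine_mode b k)"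
proof -
  \<comment> \<open>Here every sine has argument pi / 2, so the mode equals 1 and its continuous
    square cannot have integral 0.\<close>
  define x where "x = (\<chi> i. b $ i / (2 * real (k i)))"
  have k: "1 \<le> real (k i)" for i using assms by (simp add: modes_def)
  have x: "x \<in> \<Omega>"
  proof -
    have "0 < b $ i / (2 * real (k i)) \<and> b $ i / (2 * real (k i)) < b $ i" for i
      using k[of i] pos[of i] by (simp add: field_simps)
    then show ?thesis by (simp add: mem_\<Omega> x_def)
  qed
  have "freq b k i * x $ i = pi / 2" for i
    using k[of i] pos[of i] by (simp add: freq_def x_def field_simps)
  then have "sin (freq b k i * x $ i) = 1" for i by (simp only: sin_pi_half)
  then have "sine_mode b k x * sine_mode b k x = 1"
    by (simp add: sine_mode_def coord_prod_def)
  moreover have "continuous_on \<Omega> (\<lambda>x. sine_mode b k x * sine_mode b k x)"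
    by (intro continuous_intros smooth_continuous_on smooth_sine_mode)
  ultimately have "L2_inner \<Omega> (sine_mode b k) (sine_mode b k) \<noteq> 0"
    using continuous_zero_integral[OF open_box _ L2_mult_integrable[OF sine_mode_L2(1) sine_mode_L2(1)] _ _ x]
    unfolding L2_inner_def by fastforce
  then show ?thesis using L2_inner_self_nonneg[of \<Omega> "sine_mode b k"] by simp
qed

text \<open>The pairing of the weak gradient of u with the gradient of the mode is computed twice:
  approximating u by test functions moves the derivatives onto the mode and yields
  \<open>eigval b k\<close>; approximating the mode by test functions brings in the weak equation
  and yields \<mu>. A nonzero coefficient thus forces the two numbers to agree.\<close>

lemma eigenfunction_sine_mode:
  assumes "dirichlet_eigenfunction \<Omega> \<mu> u"
  shows "\<mu> * L2_inner \<Omega> u (sine_mode b k) = eigval b k * L2_inner \<Omega> u (sine_mode b k)"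
proof -
  let ?s = "sine_mode b k"
  obtain w v where u: "u \<in> L2 \<Omega>" and wg: "weak_gradient \<Omega> u w" and w: "\<And>i. (\<lambda>x. w x $ i) \<in> L2 \<Omega>"
    and v: "\<And>n::nat. v n \<in> test_functions \<Omega>"
    and vu: "(\<lambda>n. L2_norm \<Omega> (\<lambda>x. v n x - u x)) \<longlonglongrightarrow> 0"
    and vw: "\<And>i. (\<lambda>n. L2_norm \<Omega> (\<lambda>x. partial i (v n) x - w x $ i)) \<longlonglongrightarrow> 0"
    using assms unfolding dirichlet_eigenfunction_def H10_def by blast
  have eq: "- L2_inner \<Omega> u (laplacian \<eta>) = \<mu> * L2_inner \<Omega> u \<eta>" if "\<eta> \<in> test_functions \<Omega>" for \<eta>
    using assms that by (simp add: dirichlet_eigenfunction_def)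
  have tL2: "\<eta> \<in> L2 \<Omega>" if "\<eta> \<in> test_functions \<Omega>" for \<eta>
    using smooth_L2[OF open_box bounded_box test_functionsD(1)[OF that]] .
  \<comment> \<open>Here the zero boundary values of u enter: the approximants \<open>v n\<close>
    have compact support, so moving the derivative leaves no boundary term.\<close>
  have 1: "L2_inner \<Omega> (\<lambda>x. w x $ i) (partial i ?s) = (freq b k i)\<^sup>2 * L2_inner \<Omega> u ?s" for i
  proof -
    let ?P = "partial i ?s"
    have "(\<lambda>n. L2_inner \<Omega> (partial i (v n)) ?P) \<longlonglongrightarrow> L2_inner \<Omega> (\<lambda>x. w x $ i) ?P"
      by (rule L2_inner_tendsto[OF tL2[OF test_functionsD(2)[OF v]] w sine_mode_L2(2) vw])
    moreover have "L2_inner \<Omega> (partial i (v n)) ?P = (freq b k i)\<^sup>2 * L2_inner \<Omega> (v n) ?s" for n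
      unfolding L2_inner_by_parts[OF open_box bounded_box v smooth_partial[OF smooth_sine_mode]]
        partial_partial_sine_mode
      by (subst L2_inner_scale_right) simp
    moreover have "(\<lambda>n. (freq b k i)\<^sup>2 * L2_inner \<Omega> (v n) ?s) \<longlonglongrightarrow> (freq b k i)\<^sup>2 * L2_inner \<Omega> u ?s"
      by (intro tendsto_intros L2_inner_tendsto[OF tL2[OF v] u sine_mode_L2(1) vu])
    ultimately show ?thesis using LIMSEQ_unique by simp
  qed
  \<comment> \<open>Only first derivatives of the cut-off modes are controlled, so the equation is
    rewritten with the weak gradient, which spares a second derivative of the test function.\<close>
  have 2: "(\<Sum>i\<in>UNIV. L2_inner \<Omega> (\<lambda>x. w x $ i) (partial i \<eta>)) = \<mu> * L2_inner \<Omega> u \<eta>"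
    if \<eta>: "\<eta> \<in> test_functions \<Omega>" for \<eta>
  proof -
    have "L2_inner \<Omega> (\<lambda>x. w x $ i) (partial i \<eta>) = - L2_inner \<Omega> u (partial i (partial i \<eta>))" for i
      using wg test_functionsD(2)[OF \<eta>] by (simp add: weak_gradient_def)
    then have "(\<Sum>i\<in>UNIV. L2_inner \<Omega> (\<lambda>x. w x $ i) (partial i \<eta>)) =
        - (\<Sum>i\<in>UNIV. L2_inner \<Omega> (partial i (partial i \<eta>)) u)"
      by (simp add: sum_negf L2_inner_commute[of _ u])
    also have "\<dots> = - L2_inner \<Omega> (\<lambda>x. \<Sum>i\<in>UNIV. partial i (partial i \<eta>) x) u"
      using tL2[OF test_functionsD(2)[OF test_functionsD(2)[OF \<eta>]]] u by (simp add: L2_inner_sum)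
    also have "\<dots> = \<mu> * L2_inner \<Omega> u \<eta>"
      using eq[OF \<eta>] by (simp add: laplacian_def[abs_def] L2_inner_commute[of _ u])
    finally show ?thesis .
  qed
  have "(\<lambda>n. \<Sum>i\<in>UNIV. L2_inner \<Omega> (\<lambda>x. w x $ i) (partial i (cut_mode b k n))) \<longlonglongrightarrow>
      (\<Sum>i\<in>UNIV. L2_inner \<Omega> (\<lambda>x. w x $ i) (partial i ?s))"
    by (intro tendsto_sum L2_inner_cut_mode(2) w)
  then have "(\<lambda>n. \<mu> * L2_inner \<Omega> u (cut_mode b k n)) \<longlonglongrightarrow> (\<Sum>i\<in>UNIV. L2_inner \<Omega> (\<lambda>x. w x $ i) (partial i ?s))"
    by (simp add: 2[OF cut_mode_test])
  moreover have "(\<lambda>n. \<mu> * L2_inner \<Omega> u (cut_mode b k n)) \<longlonglongrightarrow> \<mu> * L2_inner \<Omega> u ?s"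
    by (intro tendsto_intros L2_inner_cut_mode(1) u)
  ultimately have "\<mu> * L2_inner \<Omega> u ?s = (\<Sum>i\<in>UNIV. L2_inner \<Omega> (\<lambda>x. w x $ i) (partial i ?s))"
    using LIMSEQ_unique by blast
  then show ?thesis by (simp add: 1 eigval_def sum_distrib_right)
qed

end

section \<open>Completeness of the sine modes\<close>

inductive_set mode_span :: "real ^ 'n::finite \<Rightarrow> (real ^ 'n \<Rightarrow> real) set" for b where
  mode: "k \<in> modes \<Longrightarrow> sine_mode b k \<in> mode_span b"
| combine: "u \<in> mode_span b \<Longrightarrow> v \<in> mode_span b \<Longrightarrow> (\<lambda>x. s * u x + t * v x) \<in> mode_span b"

lemma mode_span_scale: "u \<in> mode_span b \<Longrightarrow> (\<lambda>x. c * u x) \<in> mode_span b"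
  using mode_span.combine[of u b u c 0] by simp

lemma mode_span_add: "u \<in> mode_span b \<Longrightarrow> v \<in> mode_span b \<Longrightarrow> (\<lambda>x. u x + v x) \<in> mode_span b"
  using mode_span.combine[of u b v 1 1] by simp

lemma sin_Suc_add_sin_pred:
  fixes t :: real
  assumes "1 \<le> m"
  shows "sin (real (m + 1) * t) + sin (real (m - 1) * t) = 2 * (cos t * sin (real m * t))"
proof -
  have "real (m + 1) * t = real m * t + t" "real (m - 1) * t = real m * t - t"
    using assms by (simp_all add: of_nat_diff algebra_simps)
  then show ?thesis by (simp only: sin_add sin_diff) simp
qed

text \<open>The product of cos t and sin (m t) is half the sum of sin ((m + 1) t) and sin ((m - 1)
  t), so this cosine shifts one index up and down. It is checked on modes and extended by
  linearity.\<close>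

lemma cos_mult_mode_span:
  assumes "v \<in> mode_span b"
  shows "(\<lambda>x. cos (pi / b $ i * x $ i) * v x) \<in> mode_span b"
  using assms
proof induction
  case (mode k)
  let ?up = "sine_mode b (k(i := k i + 1))" and ?dn = "sine_mode b (k(i := k i - 1))"
  have k: "1 \<le> k i" using mode by (simp add: modes_def)
  have eq: "cos (pi / b $ i * x $ i) * sine_mode b k x = (1/2) * ?up x + (1/2) * ?dn x" for x
  proof -
    let ?t = "pi / b $ i * x $ i" and ?Q = "\<Prod>j\<in>UNIV - {i}. sin (freq b k j * x $ j)"
    have s: "sine_mode b (k(i := m)) x = sin (real m * ?t) * ?Q" for m
      unfolding sine_mode_def coord_prod_remove[of _ _ i]
      by (intro arg_cong2[where f = "(*)"] prod.cong) (auto simp: freq_def mult.assoc)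
    have "sin (real (k i + 1) * ?t) + sin (real (k i - 1) * ?t) = 2 * (cos ?t * sin (real (k i) * ?t))"
      by (rule sin_Suc_add_sin_pred[OF k])
    then have "(1/2) * (sin (real (k i + 1) * ?t) * ?Q) + (1/2) * (sin (real (k i - 1) * ?t) * ?Q) =
        cos ?t * (sin (real (k i) * ?t) * ?Q)"
      by algebra
    then show ?thesis using s[of "k i"] by (simp only: s fun_upd_triv)
  qed
  have up: "?up \<in> mode_span b"
    using mode by (intro mode_span.mode) (auto simp: modes_def)
  show ?case
  proof (cases "k i = 1")
    case True
    \<comment> \<open>The lower neighbour has index 0 and is outside \<open>modes\<close>, but it is
      the zero function.\<close>
    then have "?dn x = 0" for x
      unfolding sine_mode_def coord_prod_remove[of _ _ i] by (simp add: freq_def)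
    then show ?thesis
      unfolding eq using mode_span_scale[OF up, of "1/2"] by simp
  next
    case False
    with k have "1 \<le> k i - 1" by linarith
    then have "?dn \<in> mode_span b"
      using mode by (intro mode_span.mode) (auto simp: modes_def)
    then show ?thesis unfolding eq by (rule mode_span.combine[OF up])
  qed
next
  case (combine u v s t)
  then have "(\<lambda>x. s * (cos (pi / b $ i * x $ i) * u x) + t * (cos (pi / b $ i * x $ i) * v x)) \<in> mode_span b"
    by (intro mode_span.combine)
  then show ?case by (simp add: algebra_simps)
qed

text \<open>Multipliers of a linear space form a ring with constants. Points are separated by cos
  (pi x_i / b_i), which is injective for x_i between 0 and b_i.\<close>

lemma (in positive_box) function_ring_multipliers:
  "function_ring_on {f. continuous_on UNIV f \<and> (\<forall>v\<in>mode_span b. (\<lambda>x. f x * v x) \<in> mode_span b)} (cbox 0 b)"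
  (is "function_ring_on ?R _")
proof
  show "compact (cbox 0 b)" by (rule compact_cbox)
  show "f \<in> ?R \<Longrightarrow> continuous_on (cbox 0 b) f" for f by (auto intro: continuous_on_subset)
  show "(\<lambda>x. f x + g x) \<in> ?R" if "f \<in> ?R" "g \<in> ?R" for f g
    using that by (auto simp: distrib_right intro!: continuous_on_add mode_span_add)
  show "(\<lambda>x. f x * g x) \<in> ?R" if "f \<in> ?R" "g \<in> ?R" for f g
    using that by (auto simp: mult.assoc intro!: continuous_on_mult)
  show "(\<lambda>_. c) \<in> ?R" for c using mode_span_scale by auto
  show "\<exists>f\<in>?R. f x \<noteq> f y" if xy: "x \<in> cbox 0 b" "y \<in> cbox 0 b" "x \<noteq> y" for x y
  proof -
    obtain i where i: "x $ i \<noteq> y $ i" using xy(3) by (auto simp: vec_eq_iff)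
    have "0 \<le> pi / b $ i * z $ i \<and> pi / b $ i * z $ i \<le> pi" if "z \<in> cbox 0 b" for z
      using that pos[of i] by (auto simp: mem_box_cart field_simps)
    moreover have "pi / b $ i * x $ i \<noteq> pi / b $ i * y $ i"
      using i pos[of i] by simp
    ultimately have "cos (pi / b $ i * x $ i) \<noteq> cos (pi / b $ i * y $ i)"
      using cos_inj_pi xy by blast
    moreover have "continuous_on UNIV (\<lambda>x::real ^ 'n. cos (pi / b $ i * x $ i))"
      by (intro continuous_on_cos continuous_on_mult_left continuous_on_component continuous_on_id)
    ultimately show ?thesis
      using cos_mult_mode_span by (intro bexI[of _ "\<lambda>x. cos (pi / b $ i * x $ i)"]) blast+
  qed
qed

context positive_box
begin

lemma sine_mode_bound: "\<bar>sine_mode b k x\<bar> \<le> 1"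
  unfolding sine_mode_def coord_prod_def abs_prod by (intro prod_le_1) auto

lemma mode_span_L2: "v \<in> mode_span b \<Longrightarrow> v \<in> L2 \<Omega>"
  by (induction rule: mode_span.induct) (auto intro!: sine_mode_L2 L2_add L2_scale)

lemma orthogonal_mode_span:
  assumes "r \<in> L2 \<Omega>" "\<And>k. k \<in> modes \<Longrightarrow> L2_inner \<Omega> r (sine_mode b k) = 0" "v \<in> mode_span b"
  shows "L2_inner \<Omega> r v = 0"
  using assms(3)
proof induction
  case (combine u v s t)
  then show ?case
    using L2_inner_add[OF L2_scale[OF mode_span_L2[of u]] L2_scale[OF mode_span_L2[of v]] assms(1), of s t]
    by (simp add: L2_inner_commute[of _ r] L2_inner_scale)
qed (rule assms(2))

text \<open>A multiplier g close to f sends the mode into the span, where r is orthogonal to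
  everything; the error is at most the uniform distance times the integral of |r|. That f may be any
  continuous function is what allows localising at a point.\<close>

lemma orthogonal_continuous_mult:
  assumes r: "r \<in> L2 \<Omega>" "\<And>k. k \<in> modes \<Longrightarrow> L2_inner \<Omega> r (sine_mode b k) = 0"
    and f: "continuous_on (cbox 0 b) f" and k: "k \<in> modes"
  shows "L2_inner \<Omega> r (\<lambda>x. f x * sine_mode b k x) = 0"
proof (rule ccontr)
  let ?s = "sine_mode b k"
  assume "L2_inner \<Omega> r (\<lambda>x. f x * ?s x) \<noteq> 0"
  then have I: "\<bar>L2_inner \<Omega> r (\<lambda>x. f x * ?s x)\<bar> > 0" (is "?I > 0") by simp
  let ?J = "\<integral>x. \<bar>r x\<bar> \<partial>lebesgue_on \<Omega>"
  have J: "?J \<ge> 0" by simp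
  \<comment> \<open>This tolerance makes \<open>?J * e\<close> smaller than \<open>?I\<close>;
    adding 1 covers the case \<open>?J = 0\<close>.\<close>
  define e where "e = ?I / (?J + 1)"
  have e: "e > 0" unfolding e_def using J by (intro divide_pos_pos I) linarith
  obtain g where g: "continuous_on UNIV g" "\<And>v. v \<in> mode_span b \<Longrightarrow> (\<lambda>x. g x * v x) \<in> mode_span b"
    "\<And>x. x \<in> cbox 0 b \<Longrightarrow> \<bar>f x - g x\<bar> < e"
    using function_ring_on.Stone_Weierstrass_basic[OF function_ring_multipliers f e] by auto
  have L: "(\<lambda>x. h x * ?s x) \<in> L2 \<Omega>" if "continuous_on (cbox 0 b) h" for h
  proof (rule bounded_continuous_L2[OF open_box bounded_box])
    have c: "continuous_on (cbox 0 b) (\<lambda>x. h x * ?s x)"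
      by (intro continuous_on_mult that smooth_continuous_on smooth_sine_mode)
    show "continuous_on \<Omega> (\<lambda>x. h x * ?s x)"
      by (rule continuous_on_subset[OF c box_subset_cbox])
    show "bounded ((\<lambda>x. h x * ?s x) ` \<Omega>)"
      using compact_imp_bounded[OF compact_continuous_image[OF c compact_cbox]]
      by (rule bounded_subset) (intro image_mono box_subset_cbox)
  qed
  have gc: "continuous_on (cbox 0 b) g" using g(1) by (rule continuous_on_subset) simp
  have d: "(\<lambda>x. f x * ?s x - g x * ?s x) \<in> L2 \<Omega>" by (intro L2_diff L f gc)
  have "L2_inner \<Omega> r (\<lambda>x. g x * ?s x) = 0"
    by (rule orthogonal_mode_span[OF r g(2)[OF mode_span.mode[OF k]]])
  then have "?I = \<bar>L2_inner \<Omega> r (\<lambda>x. f x * ?s x - g x * ?s x)\<bar>"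
    using L2_inner_diff[OF L[OF f] L[OF gc] r(1)] by (simp add: L2_inner_commute[of _ r])
  also have "\<dots> \<le> (\<integral>x. \<bar>r x * (f x * ?s x - g x * ?s x)\<bar> \<partial>lebesgue_on \<Omega>)"
    unfolding L2_inner_def by (rule integral_abs_bound)
  also have "\<dots> \<le> (\<integral>x. \<bar>r x\<bar> * e \<partial>lebesgue_on \<Omega>)"
  proof (rule integral_mono)
    show "integrable (lebesgue_on \<Omega>) (\<lambda>x. \<bar>r x * (f x * ?s x - g x * ?s x)\<bar>)"
      by (intro integrable_abs L2_mult_integrable r(1) d)
    show "integrable (lebesgue_on \<Omega>) (\<lambda>x. \<bar>r x\<bar> * e)"
      using integrable_L2[OF open_box bounded_box r(1)] by auto
    fix x assume "x \<in> space (lebesgue_on \<Omega>)"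
    then have x: "x \<in> cbox 0 b" using box_subset_cbox by auto
    have "\<bar>f x * ?s x - g x * ?s x\<bar> = \<bar>f x - g x\<bar> * \<bar>?s x\<bar>"
      by (simp add: left_diff_distrib[symmetric] abs_mult)
    also have "\<dots> \<le> e * 1"
      using g(3)[OF x] sine_mode_bound[of k x] by (intro mult_mono) auto
    finally show "\<bar>r x * (f x * ?s x - g x * ?s x)\<bar> \<le> \<bar>r x\<bar> * e"
      by (simp add: abs_mult mult_left_mono)
  qed
  also have "\<dots> = ?J * e" by simp
  also have "\<dots> < ?I"
  proof -
    have "j * (i / (j + 1)) < i" if "i > 0" "j \<ge> 0" for i j :: real
      using that by (simp add: field_simps)
    from this[OF I J] show ?thesis by (simp only: e_def)
  qed
  finally show False by simp
qed

text \<open>If r x is nonzero, let f be a tent around x carrying the sign of r x, so narrow that r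
  keeps this sign on it. The all-ones mode is positive in the box, so its product with r f is
  nonnegative with integral 0 and vanishes at x, a contradiction.\<close>

lemma complete_sine_modes:
  assumes r: "r \<in> L2 \<Omega>" "\<And>k. k \<in> modes \<Longrightarrow> L2_inner \<Omega> r (sine_mode b k) = 0"
    and c: "continuous_on \<Omega> r" and x: "x \<in> \<Omega>"
  shows "r x = 0"
proof (rule ccontr)
  assume rx: "r x \<noteq> 0"
  define k :: "'n \<Rightarrow> nat" where "k = (\<lambda>_. 1)"
  have k: "k \<in> modes" by (simp add: k_def modes_def)
  have s: "0 < sine_mode b k y" if "y \<in> \<Omega>" for y
  proof -
    have "0 < freq b k i * y $ i \<and> freq b k i * y $ i < pi" for i
      using that pos[of i] by (auto simp: mem_\<Omega> freq_def k_def field_simps)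
    then show ?thesis
      unfolding sine_mode_def coord_prod_def by (auto intro!: prod_pos sin_gt_zero)
  qed
  have "open {y \<in> \<Omega>. r x * r y > 0}"
    using continuous_open_preimage[of \<Omega> "\<lambda>y. r x * r y" "{0<..}"] c
    by (auto simp: vimage_def Int_def intro!: continuous_on_mult_left)
  moreover have "x \<in> {y \<in> \<Omega>. r x * r y > 0}" using x rx by (simp add: not_sum_power2_lt_zero flip: power2_eq_square)
  ultimately obtain \<rho> where \<rho>: "\<rho> > 0" "ball x \<rho> \<subseteq> {y \<in> \<Omega>. r x * r y > 0}"
    by (meson open_contains_ball)
  define f where "f y = r x * max 0 (\<rho> - dist x y)" for y
  have cf: "continuous_on S f" for S
    unfolding f_def by (intro continuous_intros)
  have I: "L2_inner \<Omega> r (\<lambda>x. f x * sine_mode b k x) = 0"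
    by (rule orthogonal_continuous_mult[OF r cf k])
  have "(\<lambda>x. f x * sine_mode b k x) \<in> L2 \<Omega>"
  proof (rule bounded_continuous_L2[OF open_box bounded_box])
    have c: "continuous_on (cbox 0 b) (\<lambda>x. f x * sine_mode b k x)"
      by (intro continuous_on_mult cf smooth_continuous_on smooth_sine_mode)
    show "continuous_on \<Omega> (\<lambda>x. f x * sine_mode b k x)"
      by (rule continuous_on_subset[OF c box_subset_cbox])
    show "bounded ((\<lambda>x. f x * sine_mode b k x) ` \<Omega>)"
      using compact_imp_bounded[OF compact_continuous_image[OF c compact_cbox]]
      by (rule bounded_subset) (intro image_mono box_subset_cbox)
  qed
  from L2_mult_integrable[OF r(1) this]
  have int: "integrable (lebesgue_on \<Omega>) (\<lambda>x. r x * (f x * sine_mode b k x))" .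
  have "r x * (f x * sine_mode b k x) = 0"
  proof (rule continuous_zero_integral[OF open_box _ int _ _ x])
    show "continuous_on \<Omega> (\<lambda>x. r x * (f x * sine_mode b k x))"
      by (intro continuous_on_mult cf c smooth_continuous_on smooth_sine_mode)
    show "(\<integral>x. r x * (f x * sine_mode b k x) \<partial>lebesgue_on \<Omega>) = 0"
      using I by (simp add: L2_inner_def)
    fix y assume y: "y \<in> \<Omega>"
    show "0 \<le> r y * (f y * sine_mode b k y)"
    proof (cases "y \<in> ball x \<rho>")
      case True
      then have "0 < r x * r y" using \<rho>(2) by auto
      then have "0 \<le> (r x * r y) * (max 0 (\<rho> - dist x y) * sine_mode b k y)"
        using s[OF y] by (intro mult_nonneg_nonneg[of "r x * r y"]) auto
      then show ?thesis by (simp add: f_def mult_ac)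
    qed (simp add: f_def)
  qed
  then show False using rx s[OF x] \<rho>(1) by (simp add: f_def)
qed

end

section \<open>Expansion of Dirichlet eigenfunctions\<close>

lemma L2_inner_cong:
  "(\<And>x. x \<in> \<Omega> \<Longrightarrow> u x = u' x) \<Longrightarrow> L2_inner \<Omega> u v = L2_inner \<Omega> u' v"
  unfolding L2_inner_def by (intro Bochner_Integration.integral_cong) auto

lemma Parseval:
  assumes "L2_orthonormal_basis \<Omega> \<phi>" "u \<in> L2 \<Omega>" "v \<in> L2 \<Omega>"
  shows "(\<lambda>N. \<Sum>l=1..N. L2_inner \<Omega> u (\<phi> l) * L2_inner \<Omega> v (\<phi> l)) \<longlonglongrightarrow> L2_inner \<Omega> u v"
proof -
  let ?S = "\<lambda>N x. \<Sum>l=1..N. L2_inner \<Omega> u (\<phi> l) * \<phi> l x"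
  have \<phi>: "\<phi> l \<in> L2 \<Omega>" if "l \<ge> 1" for l
    using assms(1) that by (simp add: L2_orthonormal_basis_def)
  have S: "?S N \<in> L2 \<Omega>" for N by (intro L2_sum L2_scale \<phi>) simp
  have "L2_norm \<Omega> (\<lambda>x. ?S N x - u x) = L2_norm \<Omega> (\<lambda>x. u x - ?S N x)" for N
    unfolding L2_norm_def L2_inner_def by (intro arg_cong[where f = sqrt] Bochner_Integration.integral_cong)
      (auto simp: algebra_simps)
  then have "(\<lambda>N. L2_norm \<Omega> (\<lambda>x. ?S N x - u x)) \<longlonglongrightarrow> 0"
    using assms(1,2) by (simp add: L2_orthonormal_basis_def)
  from L2_inner_tendsto[OF S assms(2,3) this]
  have "(\<lambda>N. L2_inner \<Omega> (?S N) v) \<longlonglongrightarrow> L2_inner \<Omega> u v" .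
  moreover have "L2_inner \<Omega> (?S N) v = (\<Sum>l=1..N. L2_inner \<Omega> u (\<phi> l) * L2_inner \<Omega> v (\<phi> l))" for N
    using \<phi> L2_scale by (subst L2_inner_sum) (auto simp: assms(3) L2_inner_scale L2_inner_commute[of _ v] intro!: sum.cong)
  ultimately show ?thesis by simp
qed

locale box_eigenbasis = positive_box b for b :: "real ^ 'n::finite" +
  fixes ev \<phi>
  assumes eigenbasis: "dirichlet_eigenbasis \<Omega> ev \<phi>"
begin

definition level :: "real \<Rightarrow> ('n \<Rightarrow> nat) set" where
  "level \<mu> = {k \<in> modes. eigval b k = \<mu>}"

text \<open>Sine modes are not normalised, hence the squared norm in the denominator.\<close>

definition coeff :: "nat \<Rightarrow> ('n \<Rightarrow> nat) \<Rightarrow> real" where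
  "coeff l k = L2_inner \<Omega> (\<phi> l) (sine_mode b k) / L2_inner \<Omega> (sine_mode b k) (sine_mode b k)"

lemma finite_level: "finite (level \<mu>)"
  using finite_modes_eigval[OF pos] by (auto simp: level_def intro: finite_subset[rotated])

lemma eigenfunction: "1 \<le> l \<Longrightarrow> dirichlet_eigenfunction \<Omega> (ev l) (\<phi> l)"
  and basis: "L2_orthonormal_basis \<Omega> \<phi>"
  using eigenbasis by (auto simp: dirichlet_eigenbasis_def)

lemma \<phi>_L2: "1 \<le> l \<Longrightarrow> \<phi> l \<in> L2 \<Omega>"
  using basis by (simp add: L2_orthonormal_basis_def)

lemma orthogonal_level:
  assumes "1 \<le> l" "eigval b k \<noteq> ev l"
  shows "L2_inner \<Omega> (\<phi> l) (sine_mode b k) = 0"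
  using eigenfunction_sine_mode[OF eigenfunction[OF assms(1)], of k] assms(2) by auto

text \<open>The difference of the two sides is continuous and orthogonal to every mode: inside the
  level by the choice of coefficients, outside it because the eigenvalues differ. Equality holds at
  each point, so it can be differentiated.\<close>

lemma eigenfunction_expansion:
  assumes "1 \<le> l" "x \<in> \<Omega>"
  shows "\<phi> l x = (\<Sum>k\<in>level (ev l). coeff l k * sine_mode b k x)"
proof -
  let ?T = "\<lambda>x. \<Sum>k\<in>level (ev l). coeff l k * sine_mode b k x"
  have T: "?T \<in> L2 \<Omega>" by (intro L2_sum L2_scale sine_mode_L2)
  have "\<phi> l x - ?T x = 0"
  proof (rule complete_sine_modes[OF L2_diff[OF \<phi>_L2[OF assms(1)] T] _ _ assms(2)])
    show "continuous_on \<Omega> (\<lambda>x. \<phi> l x - ?T x)"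
    proof (intro continuous_on_diff)
      show "continuous_on \<Omega> (\<phi> l)"
        using eigenfunction[OF assms(1)] by (simp add: dirichlet_eigenfunction_def)
      show "continuous_on \<Omega> ?T"
        by (intro continuous_on_sum continuous_on_mult_left smooth_continuous_on smooth_sine_mode)
    qed
    fix m :: "'n \<Rightarrow> nat" assume m: "m \<in> modes"
    have "L2_inner \<Omega> ?T (sine_mode b m) =
        (\<Sum>k\<in>level (ev l). coeff l k * L2_inner \<Omega> (sine_mode b k) (sine_mode b m))"
      by (subst L2_inner_sum) (auto simp: L2_inner_scale intro!: L2_scale sine_mode_L2)
    also have "\<dots> = (\<Sum>k\<in>level (ev l). if k = m then L2_inner \<Omega> (\<phi> l) (sine_mode b m) else 0)"
      using less_imp_neq[OF sine_mode_norm_pos[of m], symmetric]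
      by (intro sum.cong) (auto simp: sine_mode_orthogonal coeff_def level_def less_imp_neq)
    also have "\<dots> = (if m \<in> level (ev l) then L2_inner \<Omega> (\<phi> l) (sine_mode b m) else 0)"
      using finite_level by simp
    also have "\<dots> = L2_inner \<Omega> (\<phi> l) (sine_mode b m)"
      using orthogonal_level[OF assms(1)] m by (auto simp: level_def)
    finally show "L2_inner \<Omega> (\<lambda>x. \<phi> l x - ?T x) (sine_mode b m) = 0"
      using L2_inner_diff[OF \<phi>_L2[OF assms(1)] T sine_mode_L2(1)] by simp
  qed
  then show ?thesis by simp
qed

section \<open>Finite multiplicity and the orthogonal change of basis\<close>

lemma sum_coeff_squares:
  assumes "1 \<le> l"
  shows "(\<Sum>k\<in>level (ev l). (L2_inner \<Omega> (sine_mode b k) (\<phi> l))\<^sup>2 / L2_inner \<Omega> (sine_mode b k) (sine_mode b k)) = 1"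
proof -
  have "1 = L2_inner \<Omega> (\<phi> l) (\<phi> l)"
    using basis assms by (simp add: L2_orthonormal_basis_def)
  also have "\<dots> = L2_inner \<Omega> (\<lambda>x. \<Sum>k\<in>level (ev l). coeff l k * sine_mode b k x) (\<phi> l)"
    by (rule L2_inner_cong) (rule eigenfunction_expansion[OF assms])
  also have "\<dots> = (\<Sum>k\<in>level (ev l). coeff l k * L2_inner \<Omega> (sine_mode b k) (\<phi> l))"
    by (subst L2_inner_sum) (auto simp: L2_inner_scale intro!: L2_scale sine_mode_L2 \<phi>_L2 assms)
  finally show ?thesis
    by (simp add: coeff_def power2_eq_square L2_inner_commute[of _ "\<phi> l"])
qed

text \<open>For a finite set G of indices, the double sum of squared normalised coefficients equals
  card G when summed over modes first, and by Bessel's inequality it is at most the number of modes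
  in the level. Finiteness matters because a sum over an infinite index set is 0 by
  convention.\<close>

lemma finite_multiplicity: "finite {l. 1 \<le> l \<and> ev l = \<mu>}" (is "finite ?S")
proof -
  let ?N = "\<lambda>k. L2_inner \<Omega> (sine_mode b k) (sine_mode b k)"
  have bessel: "(\<Sum>l\<in>G. (L2_inner \<Omega> (sine_mode b k) (\<phi> l))\<^sup>2) \<le> ?N k" if G: "finite G" "G \<subseteq> {1..}" for G k
  proof -
    let ?p = "\<lambda>N. \<Sum>l=1..N. L2_inner \<Omega> (sine_mode b k) (\<phi> l) * L2_inner \<Omega> (sine_mode b k) (\<phi> l)"
    have "incseq ?p" by (intro incseq_SucI) simp
    then have "?p N \<le> ?N k" for N
      by (rule incseq_le[OF _ Parseval[OF basis sine_mode_L2(1) sine_mode_L2(1)]])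
    \<comment> \<open>\<open>insert 0\<close> keeps the maximum meaningful for empty G.\<close>
    moreover have "(\<Sum>l\<in>G. (L2_inner \<Omega> (sine_mode b k) (\<phi> l))\<^sup>2) \<le> ?p (Max (insert 0 G))"
      unfolding power2_eq_square using G by (intro sum_mono2) auto
    ultimately show ?thesis by (rule order_trans[rotated])
  qed
  have "card G \<le> card (level \<mu>)" if G: "G \<subseteq> ?S" "finite G" for G
  proof -
    have "real (card G) = (\<Sum>l\<in>G. \<Sum>k\<in>level \<mu>. (L2_inner \<Omega> (sine_mode b k) (\<phi> l))\<^sup>2 / ?N k)"
    proof -
      have "(\<Sum>k\<in>level \<mu>. (L2_inner \<Omega> (sine_mode b k) (\<phi> l))\<^sup>2 / ?N k) = 1" if "l \<in> G" for l
        using sum_coeff_squares[of l] that G(1) by auto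
      then show ?thesis by simp
    qed
    also have "\<dots> = (\<Sum>k\<in>level \<mu>. (\<Sum>l\<in>G. (L2_inner \<Omega> (sine_mode b k) (\<phi> l))\<^sup>2) / ?N k)"
      by (subst sum.swap) (simp add: sum_divide_distrib)
    also have "\<dots> \<le> (\<Sum>k\<in>level \<mu>. 1)"
    proof (rule sum_mono)
      fix k assume "k \<in> level \<mu>"
      then have "0 < ?N k" by (intro sine_mode_norm_pos) (simp add: level_def)
      then show "(\<Sum>l\<in>G. (L2_inner \<Omega> (sine_mode b k) (\<phi> l))\<^sup>2) / ?N k \<le> 1"
        using bessel[OF G(2), of k] G(1) by auto
    qed
    finally show ?thesis by simp
  qed
  then show ?thesis using finite_if_finite_subsets_card_bdd[of ?S] by blast
qed

text \<open>Parseval for two modes of one level: basis functions with another eigenvalue contribute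
  0, so the series is a finite sum. The coefficient matrix thus has orthogonal columns.\<close>

lemma sum_coeff_products:
  assumes "k \<in> level \<mu>" "m \<in> level \<mu>"
  shows "(\<Sum>l | 1 \<le> l \<and> ev l = \<mu>. coeff l k * coeff l m) =
    (if k = m then 1 / L2_inner \<Omega> (sine_mode b k) (sine_mode b k) else 0)"
proof -
  let ?S = "{l. 1 \<le> l \<and> ev l = \<mu>}"
  let ?t = "\<lambda>l. L2_inner \<Omega> (sine_mode b k) (\<phi> l) * L2_inner \<Omega> (sine_mode b m) (\<phi> l)"
  let ?N = "\<lambda>k. L2_inner \<Omega> (sine_mode b k) (sine_mode b k)"
  have "(\<lambda>N. \<Sum>l=1..N. ?t l) \<longlonglongrightarrow> (\<Sum>l\<in>?S. ?t l)"
  proof (rule tendsto_eventually, rule eventually_sequentiallyI)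
    fix N assume "N \<ge> Max (insert 0 ?S)"
    then have "?S \<subseteq> {1..N}" using finite_multiplicity[of \<mu>] by auto
    moreover have "?t l = 0" if "l \<in> {1..N} - ?S" for l
      using orthogonal_level[of l k] assms(1) that
      by (auto simp: level_def L2_inner_commute[of _ "sine_mode b k"])
    ultimately show "(\<Sum>l=1..N. ?t l) = (\<Sum>l\<in>?S. ?t l)"
      by (intro sum.mono_neutral_right) auto
  qed
  from LIMSEQ_unique[OF this Parseval[OF basis sine_mode_L2(1) sine_mode_L2(1)]]
  have "(\<Sum>l\<in>?S. ?t l) = L2_inner \<Omega> (sine_mode b k) (sine_mode b m)" .
  moreover have "(\<Sum>l\<in>?S. coeff l k * coeff l m) = (\<Sum>l\<in>?S. ?t l) / (?N k * ?N m)"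
    by (simp add: coeff_def sum_divide_distrib L2_inner_commute[of _ "\<phi> _"])
  ultimately show ?thesis
    using sine_mode_norm_pos[of k] assms sine_mode_orthogonal[of k m] by (auto simp: level_def)
qed

text \<open>The left side does not depend on the basis chosen in the eigenspace. \<open>A\<close>
  and \<open>D\<close> are values of two linear functionals on the modes: the boundary pairing with
  g and the derivative at a point.\<close>

lemma sum_over_multiplicity:
  "(\<Sum>l | 1 \<le> l \<and> ev l = \<mu>. (\<Sum>k\<in>level \<mu>. coeff l k * A k) * (\<Sum>k\<in>level \<mu>. coeff l k * D k)) =
    (\<Sum>k\<in>level \<mu>. A k * D k / L2_inner \<Omega> (sine_mode b k) (sine_mode b k))"
proof -
  let ?S = "{l. 1 \<le> l \<and> ev l = \<mu>}"
  have "(\<Sum>l\<in>?S. (\<Sum>k\<in>level \<mu>. coeff l k * A k) * (\<Sum>k\<in>level \<mu>. coeff l k * D k)) =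
      (\<Sum>l\<in>?S. \<Sum>k\<in>level \<mu>. \<Sum>m\<in>level \<mu>. coeff l k * coeff l m * (A k * D m))"
    by (simp add: sum_product mult_ac)
  also have "\<dots> = (\<Sum>k\<in>level \<mu>. \<Sum>m\<in>level \<mu>. \<Sum>l\<in>?S. coeff l k * coeff l m * (A k * D m))"
    by (subst sum.swap) (intro sum.cong refl sum.swap)
  also have "\<dots> = (\<Sum>k\<in>level \<mu>. \<Sum>m\<in>level \<mu>.
      if k = m then A k * D k / L2_inner \<Omega> (sine_mode b k) (sine_mode b k) else 0)"
    by (intro sum.cong refl) (simp add: sum_distrib_right[symmetric] sum_coeff_products del: One_nat_def)
  also have "\<dots> = (\<Sum>k\<in>level \<mu>. A k * D k / L2_inner \<Omega> (sine_mode b k) (sine_mode b k))"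
    using finite_level by simp
  finally show ?thesis .
qed

end

section \<open>Pairing with normal derivatives on the boundary\<close>

text \<open>The nonzero component of the outer unit normal on the face where one coordinate equals
  s.\<close>

definition normal_sign :: "real \<Rightarrow> real" where
  "normal_sign s = (if s = 0 then - 1 else 1)"

text \<open>Eigenfunctions are constrained only inside the box, so their expansion may be
  differentiated only through values near a point.\<close>

lemma partial_cong_open:
  assumes "open U" "x \<in> U" "\<And>y. y \<in> U \<Longrightarrow> f y = g y"
  shows "partial i f x = partial i g x"
proof -
  have "isCont (\<lambda>t::real. x + t *\<^sub>R axis i 1) 0" by (intro continuous_intros)
  then have "\<forall>\<^sub>F t in at (0::real). x + t *\<^sub>R axis i 1 \<in> U"
    using assms(1,2) by (auto simp: isCont_def dest!: topological_tendstoD[of _ _ _ U])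
  then have "\<forall>\<^sub>F t in nhds (0::real). x + t *\<^sub>R axis i 1 \<in> U"
    using assms(2) by (simp add: eventually_nhds_conv_at)
  then have "\<forall>\<^sub>F t in nhds (0::real). f (x + t *\<^sub>R axis i 1) = g (x + t *\<^sub>R axis i 1)"
    by eventually_elim (rule assms(3))
  then show ?thesis unfolding partial_def by (intro deriv_cong_ev) auto
qed

lemma partial_lincomb:
  assumes "\<And>k. k \<in> K \<Longrightarrow> F k differentiable (at x)"
  shows "partial i (\<lambda>x. \<Sum>k\<in>K. c k * F k x) x = (\<Sum>k\<in>K. c k * partial i (F k) x)"
proof -
  have "((\<lambda>t. F k (x + t *\<^sub>R axis i 1)) has_real_derivative partial i (F k) x) (at 0)" if "k \<in> K" for k
    using partial_DERIV[of "F k" x 0 i] assms[OF that] by simp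
  then have "((\<lambda>t. \<Sum>k\<in>K. c k * F k (x + t *\<^sub>R axis i 1)) has_real_derivative
      (\<Sum>k\<in>K. c k * partial i (F k) x)) (at 0)"
    by (intro DERIV_sum DERIV_cmult)
  then show ?thesis by (subst partial_def) (rule DERIV_imp_deriv)
qed

context positive_box
begin

abbreviation face_measure :: "'n \<Rightarrow> ('n \<Rightarrow> real) measure" where
  "face_measure i \<equiv> \<Pi>\<^sub>M j\<in>UNIV - {i}. lborel"

abbreviation open_face :: "'n \<Rightarrow> ('n \<Rightarrow> real) set" where
  "open_face i \<equiv> \<Pi>\<^sub>E j\<in>UNIV - {i}. {0<..<b $ j}"

text \<open>The boundary inner product of g with the normal derivative of a mode. Modes are smooth
  on the whole space, so the derivative is evaluated on the face itself instead of as a limit from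
  inside.\<close>

definition boundary_pairing :: "(real ^ 'n \<Rightarrow> real) \<Rightarrow> ('n \<Rightarrow> nat) \<Rightarrow> real" where
  "boundary_pairing g k = (\<Sum>i\<in>UNIV. \<Sum>s\<in>{0, b $ i}.
     LINT z:open_face i|face_measure i.
       g (face_point i s z) * (normal_sign s * partial i (sine_mode b k) (face_point i s z)))"

lemma box_nonempty: "\<Omega> \<noteq> {}"
proof -
  have "(1 / 2) *\<^sub>R b \<in> \<Omega>" using pos by (simp add: mem_\<Omega>)
  then show ?thesis by blast
qed

lemma closure_\<Omega>: "closure \<Omega> = cbox 0 b"
  using box_nonempty by (rule closure_box)

lemma face_point_in_cbox:
  assumes "s \<in> {0, b $ i}" "z \<in> open_face i"
  shows "face_point i s z \<in> cbox 0 b"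
  using assms pos[of i] by (auto simp: mem_box_cart face_point_def PiE_iff less_imp_le)

lemma box_normal_face_point:
  assumes "s \<in> {0, b $ i}" "z \<in> open_face i"
  shows "box_normal b (face_point i s z) = normal_sign s *\<^sub>R axis i 1"
proof -
  have "z j \<noteq> 0 \<and> z j \<noteq> b $ j" if "j \<noteq> i" for j
    using PiE_mem[OF assms(2), of j] that by auto
  then show ?thesis
    using assms(1) pos[of i]
    by (auto simp: vec_eq_iff box_normal_def face_point_def axis_def normal_sign_def)
qed

lemma normal_derivative_lincomb:
  assumes "\<And>k. k \<in> K \<Longrightarrow> smooth (F k)"
    and u: "\<And>x. x \<in> \<Omega> \<Longrightarrow> u x = (\<Sum>k\<in>K. c k * F k x)"
    and "s \<in> {0, b $ i}" "z \<in> open_face i"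
  shows "normal_derivative b u (face_point i s z) =
    (\<Sum>k\<in>K. c k * (normal_sign s * partial i (F k) (face_point i s z)))"
proof -
  let ?y = "face_point i s z"
  \<comment> \<open>\<open>Lim\<close> picks the intended value only if limits within the box are
    unique, that is, at a limit point of the box.\<close>
  have y: "?y islimpt \<Omega>"
  proof (cases "?y \<in> \<Omega>")
    case True
    then show ?thesis using interior_limit_point interior_open[OF open_box] by metis
  next
    case False
    then show ?thesis
      using face_point_in_cbox[OF assms(3,4)] by (auto simp: closure_\<Omega>[symmetric] closure_def)
  qed
  have eq: "grad u x \<bullet> box_normal b ?y = (\<Sum>k\<in>K. c k * (normal_sign s * partial i (F k) x))"
    if x: "x \<in> \<Omega>" for x
  proof -
    have "grad u x \<bullet> box_normal b ?y = normal_sign s * partial i u x"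
      by (simp add: box_normal_face_point[OF assms(3,4)] inner_axis grad_def)
    also have "partial i u x = partial i (\<lambda>x. \<Sum>k\<in>K. c k * F k x) x"
      by (rule partial_cong_open[OF open_box x u])
    also have "\<dots> = (\<Sum>k\<in>K. c k * partial i (F k) x)"
      by (intro partial_lincomb smooth_differentiable assms(1))
    finally show ?thesis by (simp add: sum_distrib_left mult_ac)
  qed
  have "((\<lambda>x. \<Sum>k\<in>K. c k * (normal_sign s * partial i (F k) x)) \<longlongrightarrow>
      (\<Sum>k\<in>K. c k * (normal_sign s * partial i (F k) ?y))) (at ?y within \<Omega>)"
  proof (intro tendsto_sum tendsto_mult tendsto_const)
    fix k assume "k \<in> K"
    then have "isCont (partial i (F k)) ?y"
      using smooth_continuous_on[OF smooth_partial[OF assms(1)], of k UNIV]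
      by (simp add: continuous_on_eq_continuous_at)
    then show "(partial i (F k) \<longlongrightarrow> partial i (F k) ?y) (at ?y within \<Omega>)"
      using isCont_def tendsto_within_subset by blast
  qed
  then have "((\<lambda>x. grad u x \<bullet> box_normal b ?y) \<longlongrightarrow>
      (\<Sum>k\<in>K. c k * (normal_sign s * partial i (F k) ?y))) (at ?y within \<Omega>)"
    by (rule Lim_transform_eventually) (auto simp: eventually_at_filter eq)
  then show ?thesis
    unfolding normal_derivative_def using y by (intro tendsto_Lim) (auto simp: trivial_limit_within)
qed

section \<open>Integrals over the faces of the box\<close>

lemma face_point_measurable: "(\<lambda>z. face_point i s z) \<in> borel_measurable (face_measure i)"
proof (subst borel_measurable_euclidean_space, intro ballI)
  fix e :: "real ^ 'n" assume "e \<in> Basis"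
  then obtain j where e: "e = axis j 1" by (auto simp: Basis_vec_def)
  show "(\<lambda>z. face_point i s z \<bullet> e) \<in> borel_measurable (face_measure i)"
  proof (cases "j = i")
    case False
    then have "(\<lambda>z. z j) \<in> borel_measurable (face_measure i)"
      using measurable_component_singleton[of j "UNIV - {i}" "\<lambda>_. lborel"] by simp
    with False show ?thesis by (simp add: e inner_axis face_point_def)
  qed (simp add: e inner_axis face_point_def)
qed

lemma open_face_sets: "open_face i \<in> sets (face_measure i)"
  by (intro sets_PiM_I_finite) auto

lemma integrable_open_face: "integrable (face_measure i) (indicator (open_face i) :: _ \<Rightarrow> real)"
proof -
  interpret product_sigma_finite "\<lambda>_::'n. lborel :: real measure" by standard
  have "emeasure (face_measure i) (open_face i) = (\<Prod>j\<in>UNIV - {i}. emeasure lborel {0<..<b $ j})"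
    by (rule emeasure_PiM) auto
  also have "\<dots> < \<infinity>"
    using pos by (auto simp: less_imp_le prod_ennreal ennreal_less_top)
  finally show ?thesis using open_face_sets by (intro integrable_real_indicator)
qed

lemma face_integrable:
  fixes f :: "real ^ 'n \<Rightarrow> real"
  assumes "s \<in> {0, b $ i}" "continuous_on (cbox 0 b) f"
  shows "set_integrable (face_measure i) (open_face i) (\<lambda>z. f (face_point i s z))"
proof -
  \<comment> \<open>f is only known to be continuous on the closed box; setting it to 0 elsewhere
    yields a Borel function that agrees with f on the face.\<close>
  let ?g = "\<lambda>y. indicator (cbox 0 b) y *\<^sub>R f y"
  have g: "?g \<in> borel_measurable borel"
    by (rule borel_measurable_continuous_on_indicator) (use assms(2) in auto)
  obtain B where B: "\<And>y. y \<in> cbox 0 b \<Longrightarrow> \<bar>f y\<bar> \<le> B"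
    using compact_imp_bounded[OF compact_continuous_image[OF assms(2) compact_cbox]]
    by (auto simp: bounded_iff)
  have eq: "indicator (open_face i) z *\<^sub>R f (face_point i s z) =
      indicator (open_face i) z *\<^sub>R ?g (face_point i s z)" for z
    using face_point_in_cbox[OF assms(1), of z] by (auto simp: indicator_def)
  show ?thesis
    unfolding set_integrable_def eq
  proof (rule Bochner_Integration.integrable_bound)
    show "integrable (face_measure i) (\<lambda>z. B * indicator (open_face i) z)"
      by (intro integrable_mult_right integrable_open_face)
    have "(\<lambda>z. ?g (face_point i s z)) \<in> borel_measurable (face_measure i)"
      by (rule measurable_compose[OF face_point_measurable g])
    then show "(\<lambda>z. indicator (open_face i) z *\<^sub>R ?g (face_point i s z)) \<in> borel_measurable (face_measure i)"
      by (rule borel_measurable_scaleR[OF borel_measurable_indicator[OF open_face_sets]])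
    show "AE z in face_measure i. norm (indicator (open_face i) z *\<^sub>R ?g (face_point i s z)) \<le>
        norm (B * indicator (open_face i) z)"
    proof (intro AE_I2)
      fix z
      show "norm (indicator (open_face i) z *\<^sub>R ?g (face_point i s z)) \<le> norm (B * indicator (open_face i) z)"
      proof (cases "z \<in> open_face i")
        case True
        note y = face_point_in_cbox[OF assms(1) True]
        have "\<bar>f (face_point i s z)\<bar> \<le> \<bar>B\<bar>" using B[OF y] by linarith
        then show ?thesis using True y by simp
      qed simp
    qed
  qed
qed

lemma continuous_on_partial_sine_mode: "continuous_on S (\<lambda>y. c * partial i (sine_mode b k) y)"
  by (intro continuous_on_mult_left smooth_continuous_on smooth_partial smooth_sine_mode)

lemma L2_boundary_inner_lincomb:
  assumes u: "\<And>x. x \<in> \<Omega> \<Longrightarrow> u x = (\<Sum>k\<in>K. c k * sine_mode b k x)"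
    and g: "continuous_on (cbox 0 b) g"
  shows "L2_boundary_inner b g (normal_derivative b u) = (\<Sum>k\<in>K. c k * boundary_pairing g k)"
proof -
  let ?h = "\<lambda>i s k y. g y * (normal_sign s * partial i (sine_mode b k) y)"
  have face: "(LINT z:open_face i|face_measure i. g (face_point i s z) * normal_derivative b u (face_point i s z)) =
      (\<Sum>k\<in>K. c k * (LINT z:open_face i|face_measure i. ?h i s k (face_point i s z)))"
    if s: "s \<in> {0, b $ i}" for i s
  proof -
    have int: "set_integrable (face_measure i) (open_face i) (\<lambda>z. ?h i s k (face_point i s z))" for k
      using face_integrable[OF s continuous_on_mult[OF g continuous_on_partial_sine_mode]] .
    have "(LINT z:open_face i|face_measure i. g (face_point i s z) * normal_derivative b u (face_point i s z)) =
        (LINT z:open_face i|face_measure i. \<Sum>k\<in>K. c k * ?h i s k (face_point i s z))"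
    proof (rule set_lebesgue_integral_cong[OF open_face_sets], intro allI impI)
      fix z assume z: "z \<in> open_face i"
      show "g (face_point i s z) * normal_derivative b u (face_point i s z) =
          (\<Sum>k\<in>K. c k * ?h i s k (face_point i s z))"
        using normal_derivative_lincomb[where F = "sine_mode b", OF smooth_sine_mode u s z]
        by (simp add: sum_distrib_left mult.left_commute[of "g _"])
    qed
    also have "\<dots> = (\<Sum>k\<in>K. c k * (LINT z:open_face i|face_measure i. ?h i s k (face_point i s z)))"
    proof -
      have "integrable (face_measure i) (\<lambda>z. indicator (open_face i) z *\<^sub>R (c k * ?h i s k (face_point i s z)))" for k
        using int[of k] unfolding set_integrable_def
        by (simp add: mult.left_commute[of _ "c k"])
      then show ?thesis
        unfolding set_lebesgue_integral_def scaleR_sum_right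
        by (subst Bochner_Integration.integral_sum) (simp_all add: mult.left_commute[of _ "c _"])
    qed
    finally show ?thesis .
  qed
  have "L2_boundary_inner b g (normal_derivative b u) = (\<Sum>i\<in>UNIV. \<Sum>s\<in>{0, b $ i}. \<Sum>k\<in>K.
      c k * (LINT z:open_face i|face_measure i. ?h i s k (face_point i s z)))"
    unfolding L2_boundary_inner_def box_boundary_integral_def by (intro sum.cong refl face)
  also have "\<dots> = (\<Sum>i\<in>UNIV. \<Sum>k\<in>K. \<Sum>s\<in>{0, b $ i}.
      c k * (LINT z:open_face i|face_measure i. ?h i s k (face_point i s z)))"
    by (intro sum.cong refl sum.swap)
  also have "\<dots> = (\<Sum>k\<in>K. c k * boundary_pairing g k)"
    unfolding boundary_pairing_def sum_distrib_left by (rule sum.swap)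
  finally show ?thesis .
qed

text \<open>The scalar serves two ends: c = 1 for openness, and a small multiple of a fixed function
  for density.\<close>

lemma boundary_pairing_diff:
  assumes "continuous_on (cbox 0 b) g" "continuous_on (cbox 0 b) h"
  shows "boundary_pairing (\<lambda>x. g x - c * h x) k = boundary_pairing g k - c * boundary_pairing h k"
proof -
  let ?p = "\<lambda>i s y. normal_sign s * partial i (sine_mode b k) y"
  have "(LINT z:open_face i|face_measure i. (g (face_point i s z) - c * h (face_point i s z)) * ?p i s (face_point i s z)) =
      (LINT z:open_face i|face_measure i. g (face_point i s z) * ?p i s (face_point i s z)) -
      c * (LINT z:open_face i|face_measure i. h (face_point i s z) * ?p i s (face_point i s z))"
    if s: "s \<in> {0, b $ i}" for i s
  proof -
    have 1: "set_integrable (face_measure i) (open_face i) (\<lambda>z. g (face_point i s z) * ?p i s (face_point i s z))"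
      using face_integrable[OF s continuous_on_mult[OF assms(1) continuous_on_partial_sine_mode]] .
    have 2: "set_integrable (face_measure i) (open_face i) (\<lambda>z. c * (h (face_point i s z) * ?p i s (face_point i s z)))"
      using face_integrable[OF s continuous_on_mult_left[OF continuous_on_mult[OF assms(2) continuous_on_partial_sine_mode]]] .
    show ?thesis
      using set_integral_diff(2)[OF 1 2] by (simp add: left_diff_distrib mult.assoc)
  qed
  then show ?thesis
    unfolding boundary_pairing_def sum_distrib_left sum_subtractf[symmetric]
    by (intro sum.cong refl) blast
qed

text \<open>The constant is the integral of the absolute normal derivative over all faces.
  Continuity in the supremum norm implies continuity on the Hoelder space.\<close>

lemma boundary_pairing_bound:
  obtains M where "M \<ge> 0" "\<And>g e. continuous_on (cbox 0 b) g \<Longrightarrow> \<forall>x\<in>cbox 0 b. \<bar>g x\<bar> \<le> e \<Longrightarrow>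
    \<bar>boundary_pairing g k\<bar> \<le> M * e"
proof -
  let ?p = "\<lambda>i s y. normal_sign s * partial i (sine_mode b k) y"
  let ?M = "\<lambda>i s. LINT z:open_face i|face_measure i. \<bar>?p i s (face_point i s z)\<bar>"
  show thesis
  proof (rule that)
    show "0 \<le> (\<Sum>i\<in>UNIV. \<Sum>s\<in>{0, b $ i}. ?M i s)"
      unfolding set_lebesgue_integral_def by (intro sum_nonneg Bochner_Integration.integral_nonneg) simp
    fix g :: "real ^ 'n \<Rightarrow> real" and e
    assume g: "continuous_on (cbox 0 b) g" "\<forall>x\<in>cbox 0 b. \<bar>g x\<bar> \<le> e"
    have "\<bar>LINT z:open_face i|face_measure i. g (face_point i s z) * ?p i s (face_point i s z)\<bar> \<le> ?M i s * e"
      if s: "s \<in> {0, b $ i}" for i s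
    proof -
      have 1: "set_integrable (face_measure i) (open_face i) (\<lambda>z. g (face_point i s z) * ?p i s (face_point i s z))"
        using face_integrable[OF s continuous_on_mult[OF g(1) continuous_on_partial_sine_mode]] .
      have 2: "set_integrable (face_measure i) (open_face i) (\<lambda>z. e * \<bar>?p i s (face_point i s z)\<bar>)"
        using face_integrable[OF s continuous_on_mult_left[OF continuous_on_rabs[OF continuous_on_partial_sine_mode]]] .
      have "\<bar>LINT z:open_face i|face_measure i. g (face_point i s z) * ?p i s (face_point i s z)\<bar> \<le>
          (LINT z:open_face i|face_measure i. \<bar>g (face_point i s z) * ?p i s (face_point i s z)\<bar>)"
        using set_integral_norm_bound[OF 1] by simp
      also have "\<dots> \<le> (LINT z:open_face i|face_measure i. e * \<bar>?p i s (face_point i s z)\<bar>)"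
      proof (rule set_integral_mono[OF set_integrable_abs[OF 1] 2])
        fix z assume "z \<in> open_face i"
        from bspec[OF g(2) face_point_in_cbox[OF s this]]
        show "\<bar>g (face_point i s z) * ?p i s (face_point i s z)\<bar> \<le> e * \<bar>?p i s (face_point i s z)\<bar>"
          unfolding abs_mult[of "g _"] by (intro mult_right_mono) auto
      qed
      also have "\<dots> = ?M i s * e" by (simp add: mult.commute)
      finally show ?thesis .
    qed
    then show "\<bar>boundary_pairing g k\<bar> \<le> (\<Sum>i\<in>UNIV. \<Sum>s\<in>{0, b $ i}. ?M i s) * e"
      unfolding boundary_pairing_def sum_distrib_right
      by (intro order_trans[OF sum_abs] sum_mono) blast
  qed
qed

end

section \<open>A function with nonzero boundary pairing\<close>

lemma integral_sin_squared_pos: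
  assumes "0 < \<beta>"
  shows "0 < (\<integral>t. indicator {0<..<\<beta>} t * (sin (pi / \<beta> * t))\<^sup>2 \<partial>lborel)" (is "0 < integral\<^sup>L _ ?f")
    and "integrable lborel (\<lambda>t. indicator {0<..<\<beta>} t * (sin (pi / \<beta> * t))\<^sup>2)"
proof -
  have i: "integrable lborel (indicator {0<..<\<beta>} :: real \<Rightarrow> real)"
    using assms by (intro integrable_real_indicator) auto
  show int: "integrable lborel ?f"
  proof (rule Bochner_Integration.integrable_bound[OF i])
    show "AE t in lborel. norm (?f t) \<le> norm (indicator {0<..<\<beta>} t :: real)"
    proof (intro AE_I2)
      show "norm (?f t) \<le> norm (indicator {0<..<\<beta>} t :: real)" for t
        using abs_sin_le_one[of "pi / \<beta> * t"] abs_square_le_1[of "sin (pi / \<beta> * t)"]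
        by (cases "t \<in> {0<..<\<beta>}") auto
    qed
    have "(\<lambda>t. (sin (pi / \<beta> * t))\<^sup>2) \<in> borel_measurable borel"
      by (intro borel_measurable_continuous_onI continuous_on_power continuous_on_sin
          continuous_on_mult_left continuous_on_id)
    then show "?f \<in> borel_measurable lborel"
      by (simp add: borel_measurable_times)
  qed
  have nn: "0 \<le> ?f t" for t by simp
  have "integral\<^sup>L lborel ?f \<noteq> 0"
  proof
    assume "integral\<^sup>L lborel ?f = 0"
    then have "AE t in lborel. ?f t = 0"
      using integral_nonneg_eq_0_iff_AE[OF int] nn by simp
    moreover have "?f t \<noteq> 0" if "t \<in> {0<..<\<beta>}" for t
    proof -
      have "0 < pi / \<beta> * t" "pi / \<beta> * t < pi" using that assms by (auto simp: field_simps)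
      from sin_gt_zero[OF this] that show ?thesis by simp
    qed
    ultimately have "AE t in lborel. t \<notin> {0<..<\<beta>}" by (auto elim!: eventually_mono)
    then have "{0<..<\<beta>} \<in> null_sets lborel"
      by (subst AE_iff_null_sets) auto
    then have "emeasure lborel {0<..<\<beta>} = 0" by (rule null_setsD1)
    then show False using assms by simp
  qed
  moreover have "0 \<le> integral\<^sup>L lborel ?f"
    by (rule Bochner_Integration.integral_nonneg) (rule nn)
  ultimately show "0 < integral\<^sup>L lborel ?f" by linarith
qed

text \<open>Vanishes on every face except \<open>x $ i0 = b $ i0\<close>, so only one term of the boundary pairing
  survives.\<close>

definition probe :: "real ^ 'n::finite \<Rightarrow> 'n \<Rightarrow> real ^ 'n \<Rightarrow> real" where
  "probe b i0 = coord_prod (\<lambda>i. if i = i0 then (\<lambda>t. t) else (\<lambda>t. sin (pi / b $ i * t)))"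

lemma smooth_probe: "smooth (probe b i0)"
  unfolding probe_def
proof (rule smooth_coord_prod)
  show "smooth1 (if i = i0 then (\<lambda>t. t) else (\<lambda>t. sin (pi / b $ i * t)))" for i
    by (cases "i = i0") (simp_all only: if_True if_False simp_thms smooth1_ident smooth1_sin_mult)
qed

context positive_box
begin

lemma boundary_pairing_cong:
  assumes "\<And>x. x \<in> cbox 0 b \<Longrightarrow> g x = h x"
  shows "boundary_pairing g k = boundary_pairing h k"
  unfolding boundary_pairing_def
  by (intro sum.cong refl set_lebesgue_integral_cong[OF open_face_sets])
    (auto simp: assms face_point_in_cbox)

text \<open>All entries of k other than \<open>k i0\<close> are 1, so on the surviving face
  \<open>probe\<close> and the normal derivative are multiples of the same product of sines. The
  integral is a constant times a product of positive one-dimensional integrals of squares; the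
  constant is nonzero since cos (k pi) is 1 or -1.\<close>

lemma boundary_pairing_probe:
  assumes "1 \<le> k i0" "\<And>j. j \<noteq> i0 \<Longrightarrow> k j = 1"
  shows "boundary_pairing (probe b i0) k \<noteq> 0"
proof -
  let ?T = "\<lambda>i s. LINT z:open_face i|face_measure i.
    probe b i0 (face_point i s z) * (normal_sign s * partial i (sine_mode b k) (face_point i s z))"
  have T0: "?T i s = 0" if "s \<in> {0, b $ i}" "i \<noteq> i0 \<or> s = 0" for i s
  proof -
    have "probe b i0 (face_point i s z) = 0" for z
      unfolding probe_def coord_prod_remove[of _ _ i]
      using that pos[of i] by (auto simp: face_point_def)
    then show ?thesis by (simp add: set_lebesgue_integral_def)
  qed
  let ?C = "b $ i0 * (freq b k i0 * cos (real (k i0) * pi))"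
  let ?q = "\<lambda>j t. indicator {0<..<b $ j} t * (sin (pi / b $ j * t))\<^sup>2"
  have "?T i0 (b $ i0) = (\<integral>z. ?C * (\<Prod>j\<in>UNIV - {i0}. ?q j (z j)) \<partial>face_measure i0)"
    unfolding set_lebesgue_integral_def
  proof (intro Bochner_Integration.integral_cong refl)
    fix z assume z: "z \<in> space (face_measure i0)"
    let ?y = "face_point i0 (b $ i0) z"
    have ind: "indicator (open_face i0) z = (\<Prod>j\<in>UNIV - {i0}. indicator {0<..<b $ j} (z j) :: real)"
      using z by (auto simp: indicator_def space_PiM PiE_iff prod_zero_iff)
    have p: "probe b i0 ?y = b $ i0 * (\<Prod>j\<in>UNIV - {i0}. sin (pi / b $ j * z j))"
      unfolding probe_def coord_prod_remove[of _ _ i0]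
      by (intro arg_cong2[where f = "(*)"] prod.cong) (auto simp: face_point_def)
    have d: "partial i0 (sine_mode b k) ?y =
        freq b k i0 * cos (real (k i0) * pi) * (\<Prod>j\<in>UNIV - {i0}. sin (pi / b $ j * z j))"
      unfolding partial_sine_mode using pos[of i0]
      by (intro arg_cong2[where f = "(*)"] prod.cong) (auto simp: face_point_def freq_def assms(2))
    show "indicator (open_face i0) z *\<^sub>R (probe b i0 ?y * (normal_sign (b $ i0) * partial i0 (sine_mode b k) ?y)) =
        ?C * (\<Prod>j\<in>UNIV - {i0}. ?q j (z j))"
      unfolding ind p d using pos[of i0]
      by (simp add: normal_sign_def prod.distrib power2_eq_square mult_ac)
  qed
  also have "\<dots> = ?C * (\<Prod>j\<in>UNIV - {i0}. \<integral>t. ?q j t \<partial>lborel)"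
  proof -
    interpret product_sigma_finite "\<lambda>_::'n. lborel :: real measure" by standard
    have "(\<integral>z. (\<Prod>j\<in>UNIV - {i0}. ?q j (z j)) \<partial>face_measure i0) = (\<Prod>j\<in>UNIV - {i0}. \<integral>t. ?q j t \<partial>lborel)"
      by (rule product_integral_prod[OF _ integral_sin_squared_pos(2)[OF pos]]) simp
    then show ?thesis by simp
  qed
  finally have Tb: "?T i0 (b $ i0) = ?C * (\<Prod>j\<in>UNIV - {i0}. \<integral>t. ?q j t \<partial>lborel)" .
  have "(\<Prod>j\<in>UNIV - {i0}. \<integral>t. ?q j t \<partial>lborel) \<noteq> 0"
    using less_imp_neq[OF integral_sin_squared_pos(1)[OF pos], symmetric] by (simp only: prod_zero_iff finite) blast
  moreover have "?C \<noteq> 0"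
    using pos[of i0] assms(1) by (simp add: freq_def)
  moreover have "boundary_pairing (probe b i0) k = ?T i0 (b $ i0)"
  proof -
    have "boundary_pairing (probe b i0) k = (\<Sum>s\<in>{0, b $ i0}. ?T i0 s) + (\<Sum>i\<in>UNIV - {i0}. \<Sum>s\<in>{0, b $ i}. ?T i s)"
      unfolding boundary_pairing_def by (rule sum.remove) auto
    also have "(\<Sum>i\<in>UNIV - {i0}. \<Sum>s\<in>{0, b $ i}. ?T i s) = 0"
      by (intro sum.neutral ballI T0) auto
    also have "(\<Sum>s\<in>{0, b $ i0}. ?T i0 s) = ?T i0 0 + ?T i0 (b $ i0)"
      using pos[of i0] by (subst sum.insert) auto
    finally show ?thesis using T0[of 0 i0] by simp
  qed
  ultimately show ?thesis unfolding Tb by simp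
qed

end

section \<open>Elements of the Hoelder space\<close>

lemma grad_cong_open:
  assumes "open U" "x \<in> U" "\<And>y. y \<in> U \<Longrightarrow> f y = g y"
  shows "grad f x = grad g x"
  unfolding grad_def using partial_cong_open[OF assms] by simp

text \<open>The gradient is bounded on the compact closure, and convexity lets the mean value
  inequality act along segments in S.\<close>

lemma smooth_lipschitz:
  fixes f :: "real ^ 'n::finite \<Rightarrow> real"
  assumes "smooth f" "convex S" "bounded S"
  obtains B where "\<And>x y. x \<in> S \<Longrightarrow> y \<in> S \<Longrightarrow> \<bar>f x - f y\<bar> \<le> B * dist x y"
proof -
  have "continuous_on (closure S) (grad f)"
    unfolding grad_def[abs_def]
    by (intro continuous_on_vec_lambda smooth_continuous_on smooth_partial assms(1))
  then have "bounded (grad f ` closure S)"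
    using assms(3) by (intro compact_imp_bounded compact_continuous_image) auto
  then obtain B where B: "\<And>x. x \<in> closure S \<Longrightarrow> norm (grad f x) \<le> B"
    by (auto simp: bounded_iff)
  have "norm (f x - f y) \<le> B * norm (x - y)" if xy: "x \<in> S" "y \<in> S" for x y
  proof (rule differentiable_bound[OF assms(2) _ _ xy])
    fix z assume z: "z \<in> S"
    show "(f has_derivative (\<lambda>h. h \<bullet> grad f z)) (at z within S)"
      using GDERIV_grad[OF smooth_differentiable[OF assms(1)], of z]
      by (auto simp: gderiv_def intro: has_derivative_at_withinI)
    have "norm (h \<bullet> grad f z) \<le> B * norm h" for h
      using Cauchy_Schwarz_ineq2[of h "grad f z"] mult_left_mono[OF B[of z], of "norm h"] z closure_subset[of S]
      by (auto simp: mult.commute)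
    then show "onorm (\<lambda>h. h \<bullet> grad f z) \<le> B" by (rule onorm_le)
  qed
  then show ?thesis by (intro that[of B]) (simp add: dist_norm)
qed

text \<open>Members of the space are zero outside the closure, so f is truncated there, which leaves
  its derivatives in \<Omega> unchanged. Its partials are Lipschitz, and on a bounded set this
  implies Hoelder continuity.\<close>

lemma smooth_C1alpha:
  fixes \<Omega> :: "(real ^ 'n::finite) set"
  assumes "open \<Omega>" "convex \<Omega>" "bounded \<Omega>" "\<alpha> < 1" "smooth f"
  shows "(\<lambda>x. if x \<in> closure \<Omega> then f x else 0) \<in> C1alpha \<alpha> \<Omega>" (is "?g \<in> _")
proof -
  have eq: "?g x = f x" if "x \<in> \<Omega>" for x using that closure_subset[of \<Omega>] by auto
  have gr: "grad ?g x = grad f x" if "x \<in> \<Omega>" for x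
    by (rule grad_cong_open[OF assms(1) that eq])
  have cg: "continuous_on (closure \<Omega>) (grad f)"
    unfolding grad_def[abs_def]
    by (intro continuous_on_vec_lambda smooth_continuous_on smooth_partial assms(5))
  have bdd: "bounded (h ` \<Omega>)" if "continuous_on (closure \<Omega>) h" for h :: "real ^ 'n \<Rightarrow> 'c::metric_space"
  proof -
    have "compact (closure \<Omega>)" using assms(3) by simp
    from compact_imp_bounded[OF compact_continuous_image[OF that this]] show ?thesis
      by (rule bounded_subset) (intro image_mono closure_subset)
  qed
  have "\<exists>B. \<forall>x\<in>\<Omega>. \<forall>y\<in>\<Omega>. \<bar>partial i f x - partial i f y\<bar> \<le> B * dist x y" for i
    by (rule smooth_lipschitz[OF smooth_partial[OF assms(5)] assms(2,3), of i]) blast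
  then obtain B where B: "\<And>i x y. x \<in> \<Omega> \<Longrightarrow> y \<in> \<Omega> \<Longrightarrow> \<bar>partial i f x - partial i f y\<bar> \<le> B i * dist x y"
    by metis
  obtain D where D: "\<And>x y. x \<in> \<Omega> \<Longrightarrow> y \<in> \<Omega> \<Longrightarrow> dist x y \<le> D"
    using assms(3) by (meson bounded_two_points)
  let ?B = "\<Sum>i\<in>UNIV. \<bar>B i\<bar>"
  have hoelder: "norm (grad ?g x - grad ?g y) \<le> (?B * D powr (1 - \<alpha>)) * dist x y powr \<alpha>"
    if xy: "x \<in> \<Omega>" "y \<in> \<Omega>" for x y
  proof (cases "x = y")
    case False
    have "norm (grad ?g x - grad ?g y) \<le> (\<Sum>i\<in>UNIV. \<bar>(grad f x - grad f y) $ i\<bar>)"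
      unfolding gr[OF xy(1)] gr[OF xy(2)] by (rule norm_le_l1_cart)
    also have "\<dots> \<le> (\<Sum>i\<in>UNIV. \<bar>B i\<bar> * dist x y)"
    proof (rule sum_mono)
      fix i
      have "B i * dist x y \<le> \<bar>B i\<bar> * dist x y" by (intro mult_right_mono) auto
      with B[OF xy, of i] show "\<bar>(grad f x - grad f y) $ i\<bar> \<le> \<bar>B i\<bar> * dist x y"
        by (simp add: grad_def)
    qed
    also have "\<dots> = ?B * dist x y" by (simp add: sum_distrib_right)
    \<comment> \<open>The surplus power 1 - \<alpha> of the distance is positive and can be absorbed
      by the diameter bound D.\<close>
    also have "dist x y = dist x y powr (1 - \<alpha>) * dist x y powr \<alpha>"
      using False by (simp add: powr_add[symmetric])
    also have "?B * \<dots> \<le> ?B * (D powr (1 - \<alpha>) * dist x y powr \<alpha>)"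
      using D[OF xy] assms(4) by (intro mult_left_mono mult_right_mono powr_mono2) (auto intro: sum_nonneg)
    finally show ?thesis by (simp add: mult.assoc)
  qed simp
  have "continuous_on (closure \<Omega>) ?g"
    using smooth_continuous_on[OF assms(5), of "closure \<Omega>"] by (simp cong: continuous_on_cong_simp)
  moreover have "bounded (?g ` \<Omega>)"
    using bdd[OF smooth_continuous_on[OF assms(5)]] eq by (simp cong: image_cong)
  moreover have "?g differentiable_on \<Omega>"
  proof -
    have "?g differentiable (at x)" if "x \<in> \<Omega>" for x
    proof -
      obtain f' where "(f has_derivative f') (at x)"
        using smooth_differentiable[OF assms(5), of x] by (auto simp: differentiable_def)
      from has_derivative_transform_within_open[OF this assms(1) that, of ?g] show ?thesis
        using eq by (auto simp: differentiable_def)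
    qed
    then show ?thesis using assms(1) by (simp add: differentiable_on_eq_differentiable_at)
  qed
  moreover have "bounded (grad ?g ` \<Omega>)"
    using bdd[OF cg] gr by (simp cong: image_cong)
  ultimately show ?thesis
    unfolding C1alpha_def using hoelder by auto
qed

lemma grad_scale:
  assumes "f differentiable (at x)"
  shows "grad (\<lambda>x. c * f x) x = c *\<^sub>R grad f x"
proof (rule grad_eqI)
  have "((\<lambda>x. c * f x) has_derivative (\<lambda>h. c * (h \<bullet> grad f x))) (at x)"
    using GDERIV_grad[OF assms] unfolding gderiv_def by (rule has_derivative_mult_right)
  then show "GDERIV (\<lambda>x. c * f x) x :> c *\<^sub>R grad f x"
    by (simp add: gderiv_def)
qed

lemma C1alpha_scale:
  fixes \<Omega> :: "(real ^ 'n::finite) set"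
  assumes "open \<Omega>" "\<Omega> \<noteq> {}" "h \<in> C1alpha \<alpha> \<Omega>"
  shows "(\<lambda>x. c * h x) \<in> C1alpha \<alpha> \<Omega>"
    and "C1alpha_norm \<alpha> \<Omega> (\<lambda>x. c * h x) \<le> \<bar>c\<bar> * C1alpha_norm \<alpha> \<Omega> h"
proof -
  have d: "h differentiable (at x)" if "x \<in> \<Omega>" for x
    using assms that by (auto simp: C1alpha_def differentiable_on_eq_differentiable_at)
  have gr: "grad (\<lambda>x. c * h x) x = c *\<^sub>R grad h x" if "x \<in> \<Omega>" for x
    by (rule grad_scale[OF d[OF that]])
  have gd: "norm (grad (\<lambda>x. c * h x) x - grad (\<lambda>x. c * h x) y) = \<bar>c\<bar> * norm (grad h x - grad h y)"
    if "x \<in> \<Omega>" "y \<in> \<Omega>" for x y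
    by (simp add: gr that scaleR_diff_right[symmetric])
  obtain A where A: "\<And>x y. x \<in> \<Omega> \<Longrightarrow> y \<in> \<Omega> \<Longrightarrow> norm (grad h x - grad h y) \<le> A * dist x y powr \<alpha>"
    using assms(3) unfolding C1alpha_def by blast
  have "norm (grad (\<lambda>x. c * h x) x - grad (\<lambda>x. c * h x) y) \<le> (\<bar>c\<bar> * A) * dist x y powr \<alpha>"
    if "x \<in> \<Omega>" "y \<in> \<Omega>" for x y
    unfolding gd[OF that] mult.assoc by (intro mult_left_mono A that) simp
  moreover have "bounded ((\<lambda>x. c * h x) ` \<Omega>)"
    using bounded_scaling[of "h ` \<Omega>" c] assms(3) by (simp add: C1alpha_def image_image)
  moreover have "bounded (grad (\<lambda>x. c * h x) ` \<Omega>)"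
    using bounded_scaling[of "grad h ` \<Omega>" c] assms(3) gr by (simp add: C1alpha_def image_image cong: image_cong)
  ultimately show "(\<lambda>x. c * h x) \<in> C1alpha \<alpha> \<Omega>"
    using assms(3) unfolding C1alpha_def by (auto intro!: continuous_on_mult_left differentiable_on_mult)
  let ?Q = "\<lambda>u. {norm (grad u x - grad u y) / dist x y powr \<alpha> | x y. x \<in> \<Omega> \<and> y \<in> \<Omega> \<and> x \<noteq> y}"
  note bh = C1alpha_norm_bounds[OF assms(3)]
  obtain u v where uv: "u \<in> \<Omega>" "v \<in> \<Omega>" "u \<noteq> v" by (rule open_two_points[OF assms(1,2)])
  have "(SUP x\<in>\<Omega>. \<bar>c * h x\<bar>) \<le> \<bar>c\<bar> * (SUP x\<in>\<Omega>. \<bar>h x\<bar>)"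
    using bh(1) by (intro cSUP_least assms(2)) (auto simp: abs_mult intro: mult_left_mono)
  moreover have "(SUP x\<in>\<Omega>. norm (grad (\<lambda>x. c * h x) x)) \<le> \<bar>c\<bar> * (SUP x\<in>\<Omega>. norm (grad h x))"
    using bh(2) by (intro cSUP_least assms(2)) (auto simp: gr intro: mult_left_mono)
  moreover have "Sup (?Q (\<lambda>x. c * h x)) \<le> \<bar>c\<bar> * Sup (?Q h)"
  proof (rule cSup_least)
    show "?Q (\<lambda>x. c * h x) \<noteq> {}" using uv by blast
    fix z assume "z \<in> ?Q (\<lambda>x. c * h x)"
    then obtain x y where xy: "x \<in> \<Omega>" "y \<in> \<Omega>" "x \<noteq> y"
      and z: "z = norm (grad (\<lambda>x. c * h x) x - grad (\<lambda>x. c * h x) y) / dist x y powr \<alpha>" by blast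
    have "z = \<bar>c\<bar> * (norm (grad h x - grad h y) / dist x y powr \<alpha>)"
      unfolding z gd[OF xy(1,2)] by simp
    also have "\<dots> \<le> \<bar>c\<bar> * Sup (?Q h)"
      by (intro mult_left_mono bh(3)[OF xy]) simp
    finally show "z \<le> \<bar>c\<bar> * Sup (?Q h)" .
  qed
  ultimately show "C1alpha_norm \<alpha> \<Omega> (\<lambda>x. c * h x) \<le> \<bar>c\<bar> * C1alpha_norm \<alpha> \<Omega> h"
    unfolding C1alpha_norm_def distrib_left by linarith
qed

section \<open>Genericity of nonzero boundary pairings\<close>

context positive_box
begin

lemma C1alpha_continuous: "g \<in> C1alpha \<alpha> \<Omega> \<Longrightarrow> continuous_on (cbox 0 b) g"
  by (simp add: C1alpha_def closure_\<Omega>)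

text \<open>The norm takes suprema over the open box; continuity extends the bound to the closed
  box, where the faces lie.\<close>

lemma C1alpha_dist_bound:
  assumes "g \<in> C1alpha \<alpha> \<Omega>" "h \<in> C1alpha \<alpha> \<Omega>" "x \<in> cbox 0 b"
  shows "\<bar>g x - h x\<bar> \<le> C1alpha_dist \<alpha> \<Omega> g h"
proof -
  have d: "(\<lambda>x. g x - h x) \<in> C1alpha \<alpha> \<Omega>"
    by (rule C1alpha_diff(1)[OF open_box assms(1,2)])
  have "norm (g x - h x) \<le> C1alpha_norm \<alpha> \<Omega> (\<lambda>x. g x - h x)"
  proof (rule continuous_on_closure_norm_le[where f = "\<lambda>x. g x - h x"])
    show "continuous_on (closure \<Omega>) (\<lambda>x. g x - h x)"
      using C1alpha_continuous[OF d] by (simp add: closure_\<Omega>)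
    show "\<forall>y\<in>\<Omega>. norm (g y - h y) \<le> C1alpha_norm \<alpha> \<Omega> (\<lambda>x. g x - h x)"
      using C1alpha_norm_nonneg(2)[OF open_box box_nonempty d] by simp
    show "x \<in> closure \<Omega>" using assms(3) by (simp add: closure_\<Omega>)
  qed
  then show ?thesis using assms(1,2) by (simp add: C1alpha_dist_def)
qed

lemma topspace_C1alpha: "topspace (C1alpha_topology \<alpha> \<Omega>) = C1alpha \<alpha> \<Omega>"
  unfolding C1alpha_topology_def
  by (rule Metric_space.topspace_mtopology[OF Metric_space_C1alpha[OF open_box box_nonempty]])

lemma openin_boundary_pairing:
  "openin (C1alpha_topology \<alpha> \<Omega>) {g \<in> C1alpha \<alpha> \<Omega>. boundary_pairing g k \<noteq> 0}" (is "openin _ ?U")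
proof -
  interpret Metric_space "C1alpha \<alpha> \<Omega>" "C1alpha_dist \<alpha> \<Omega>"
    by (rule Metric_space_C1alpha[OF open_box box_nonempty])
  obtain M where M: "M \<ge> 0" "\<And>g e. continuous_on (cbox 0 b) g \<Longrightarrow> \<forall>x\<in>cbox 0 b. \<bar>g x\<bar> \<le> e \<Longrightarrow>
    \<bar>boundary_pairing g k\<bar> \<le> M * e"
    by (rule boundary_pairing_bound[of k], rule that)
  have "\<exists>r>0. mball g r \<subseteq> ?U" if g: "g \<in> ?U" for g
  proof (intro exI conjI)
    \<comment> \<open>Chosen so that M times the radius stays below the size of the pairing; M + 1
      covers M = 0.\<close>
    let ?r = "\<bar>boundary_pairing g k\<bar> / (M + 1)"
    show "?r > 0" using g M(1) by simp
    show "mball g ?r \<subseteq> ?U"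
    proof
      fix h assume "h \<in> mball g ?r"
      then have h: "h \<in> C1alpha \<alpha> \<Omega>" and d: "C1alpha_dist \<alpha> \<Omega> g h < ?r" by auto
      have cg: "continuous_on (cbox 0 b) g" and ch: "continuous_on (cbox 0 b) h"
        using g h by (auto intro: C1alpha_continuous)
      have "\<bar>boundary_pairing (\<lambda>x. g x - h x) k\<bar> \<le> M * C1alpha_dist \<alpha> \<Omega> g h"
        using g h by (intro M(2) continuous_on_diff cg ch ballI C1alpha_dist_bound) auto
      also have "\<dots> \<le> M * ?r" using d M(1) by (intro mult_left_mono) auto
      also have "\<dots> < \<bar>boundary_pairing g k\<bar>"
        using g M(1) by (simp add: field_simps)
      finally have "boundary_pairing h k \<noteq> 0"
        using boundary_pairing_diff[OF cg ch, of 1 k] by auto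
      with h show "h \<in> ?U" by simp
    qed
  qed
  then show ?thesis unfolding C1alpha_topology_def openin_mtopology by blast
qed

text \<open>The kernel of a nonzero linear functional has no interior: from any of its points a
  small multiple of the truncated \<open>probe\<close> leads out.\<close>

lemma dense_boundary_pairing:
  assumes "\<alpha> < 1" and k: "1 \<le> k i0" "\<And>j. j \<noteq> i0 \<Longrightarrow> k j = 1"
  shows "C1alpha_topology \<alpha> \<Omega> closure_of {g \<in> C1alpha \<alpha> \<Omega>. boundary_pairing g k \<noteq> 0} =
    topspace (C1alpha_topology \<alpha> \<Omega>)" (is "?X closure_of ?U = _")
proof -
  interpret Metric_space "C1alpha \<alpha> \<Omega>" "C1alpha_dist \<alpha> \<Omega>"
    by (rule Metric_space_C1alpha[OF open_box box_nonempty])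
  define h where "h = (\<lambda>x. if x \<in> closure \<Omega> then probe b i0 x else 0)"
  have h: "h \<in> C1alpha \<alpha> \<Omega>"
    unfolding h_def by (rule smooth_C1alpha[OF open_box _ bounded_box assms(1) smooth_probe]) simp
  have "boundary_pairing h k = boundary_pairing (probe b i0) k"
    by (rule boundary_pairing_cong) (simp add: h_def closure_\<Omega>)
  then have hk: "boundary_pairing h k \<noteq> 0"
    using boundary_pairing_probe[of k i0] k by simp
  have "g \<in> ?X closure_of ?U" if g: "g \<in> C1alpha \<alpha> \<Omega>" for g
  proof (cases "boundary_pairing g k = 0")
    case False
    then have "g \<in> ?U" using g by simp
    moreover have "?U \<subseteq> topspace ?X" by (auto simp: topspace_C1alpha)
    ultimately show ?thesis using closure_of_subset[of ?U ?X] by blast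
  next
    case True
    show ?thesis
      unfolding in_closure_of
    proof (intro conjI allI impI)
      show "g \<in> topspace ?X" using g by (simp add: topspace_C1alpha)
      fix T assume "g \<in> T \<and> openin ?X T"
      then obtain r where r: "r > 0" "mball g r \<subseteq> T"
        unfolding C1alpha_topology_def openin_mtopology by blast
      let ?N = "C1alpha_norm \<alpha> \<Omega> h"
      have N: "?N \<ge> 0" by (rule C1alpha_norm_nonneg(1)[OF open_box box_nonempty h])
      \<comment> \<open>The scaled function has norm at most \<open>e * ?N\<close>, which is below
        r.\<close>
      define e where "e = r / (?N + 1)"
      have e: "e > 0" using r N by (simp add: e_def)
      note eh = C1alpha_scale[OF open_box box_nonempty h, of e]
      define f where "f = (\<lambda>x. g x - e * h x)"
      have f: "f \<in> C1alpha \<alpha> \<Omega>"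
        unfolding f_def by (rule C1alpha_diff(1)[OF open_box g eh(1)])
      have "C1alpha_dist \<alpha> \<Omega> g f \<le> \<bar>e\<bar> * ?N"
        using g f eh(2) by (simp add: C1alpha_dist_def f_def)
      also have "\<dots> < r" using r N by (simp add: e_def field_simps)
      finally have "f \<in> mball g r" using g f by simp
      moreover have "boundary_pairing f k \<noteq> 0"
        unfolding f_def boundary_pairing_diff[OF C1alpha_continuous[OF g] C1alpha_continuous[OF h]]
        using True e hk by simp
      ultimately show "\<exists>y. y \<in> ?U \<and> y \<in> T" using f r by blast
    qed
  qed
  then show ?thesis
    using closure_of_subset_topspace[of ?X ?U] by (auto simp: topspace_C1alpha)
qed

end

section \<open>The lowest mode and its neighbour\<close>

definition mode_with :: "'n \<Rightarrow> nat \<Rightarrow> 'n \<Rightarrow> nat" where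
  "mode_with i0 m = (\<lambda>_. 1)(i0 := m)"

context positive_box
begin

lemma freq_mono: "freq b k i \<le> freq b m i \<longleftrightarrow> k i \<le> m i" "0 \<le> freq b k i"
  using pos[of i] by (auto simp: freq_def field_simps)

text \<open>No squared frequency decreases from k to m, and one larger entry makes the sum strictly
  larger.\<close>

lemma eigval_eq_imp_eq:
  assumes "\<And>i. k i \<le> m i" "eigval b m = eigval b k"
  shows "m = k"
proof (rule ccontr)
  assume "m \<noteq> k"
  then obtain i where "m i \<noteq> k i" by auto
  then have i: "k i < m i" using assms(1)[of i] by simp
  have "eigval b k < eigval b m"
    unfolding eigval_def
  proof (rule sum_strict_mono_ex1)
    show "\<forall>i\<in>UNIV. (freq b k i)\<^sup>2 \<le> (freq b m i)\<^sup>2"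
      using assms(1) freq_mono by (auto intro!: power_mono)
    have "freq b k i < freq b m i" using i freq_mono(1)[of m i k] by linarith
    then show "\<exists>i\<in>UNIV. (freq b k i)\<^sup>2 < (freq b m i)\<^sup>2"
      using freq_mono(2)[of k i] by (auto intro!: bexI[of _ i] power_strict_mono)
  qed simp
  with assms(2) show False by simp
qed

text \<open>The other factors are sines of index 1, positive inside the box, so only the cosine
  could vanish.\<close>

lemma partial_mode_with_nonzero:
  assumes "x \<in> \<Omega>" "1 \<le> m" "cos (real m * pi / b $ i0 * x $ i0) \<noteq> 0"
  shows "partial i0 (sine_mode b (mode_with i0 m)) x \<noteq> 0"
proof -
  have "sin (pi / b $ j * x $ j) \<noteq> 0" for j
  proof -
    have "0 < pi / b $ j * x $ j" "pi / b $ j * x $ j < pi"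
      using assms(1) pos[of j] by (auto simp: mem_\<Omega> field_simps)
    from sin_gt_zero[OF this] show ?thesis by simp
  qed
  then have "(\<Prod>j\<in>UNIV - {i0}. sin (freq b (mode_with i0 m) j * x $ j)) \<noteq> 0"
    by (auto simp: prod_zero_iff freq_def mode_with_def)
  then show ?thesis
    unfolding partial_sine_mode using assms(2,3) pos[of i0]
    by (simp add: freq_def mode_with_def)
qed

lemma isolating_mode:
  assumes x: "x \<in> \<Omega>"
  obtains m where "m \<in> {1, 2}" "partial i0 (sine_mode b (mode_with i0 m)) x \<noteq> 0"
    "\<And>k. k \<in> modes \<Longrightarrow> eigval b k = eigval b (mode_with i0 m) \<Longrightarrow> k \<noteq> mode_with i0 m \<Longrightarrow>
      partial i0 (sine_mode b k) x = 0"
proof (cases "x $ i0 = b $ i0 / 2")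
  case False
  \<comment> \<open>Cosine is injective on [0, pi], so inside the box this factor vanishes only on
    the middle plane.\<close>
  have "cos (real 1 * pi / b $ i0 * x $ i0) \<noteq> 0"
  proof
    assume "cos (real 1 * pi / b $ i0 * x $ i0) = 0"
    then have "cos (pi / b $ i0 * x $ i0) = cos (pi / 2)" by simp
    moreover have "0 \<le> pi / b $ i0 * x $ i0" "pi / b $ i0 * x $ i0 \<le> pi"
      using x pos[of i0] by (auto simp: mem_\<Omega> field_simps less_imp_le)
    ultimately have "pi / b $ i0 * x $ i0 = pi / 2"
      using cos_inj_pi[of "pi / b $ i0 * x $ i0" "pi / 2"] by simp
    with False pos[of i0] show False by (simp add: field_simps)
  qed
  with x have "partial i0 (sine_mode b (mode_with i0 1)) x \<noteq> 0"
    by (intro partial_mode_with_nonzero) auto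
  moreover have "k = mode_with i0 1" if "k \<in> modes" "eigval b k = eigval b (mode_with i0 1)" for k
    using that by (intro eigval_eq_imp_eq) (auto simp: modes_def mode_with_def)
  ultimately show thesis by (intro that[of 1]) auto
next
  case True
  have half: "real m * pi / b $ i0 * x $ i0 = pi * real m / 2" for m
    unfolding True using pos[of i0] by simp
  have "cos (real 2 * pi / b $ i0 * x $ i0) \<noteq> 0"
    unfolding half by simp
  with x have "partial i0 (sine_mode b (mode_with i0 2)) x \<noteq> 0"
    by (intro partial_mode_with_nonzero) auto
  moreover have "partial i0 (sine_mode b k) x = 0"
    if k: "k \<in> modes" "eigval b k = eigval b (mode_with i0 2)" "k \<noteq> mode_with i0 2" for k
  proof (cases "even (k i0)")
    case True
    have "1 \<le> k i" for i using k(1) by (simp add: modes_def)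
    moreover from this[of i0] True have "2 \<le> k i0" by presburger
    ultimately have "mode_with i0 2 i \<le> k i" for i by (simp add: mode_with_def)
    with k(2,3) eigval_eq_imp_eq[of "mode_with i0 2" k] show ?thesis by simp
  next
    case False
    then obtain m where m: "k i0 = Suc (2 * m)" by (auto elim: oddE)
    have "cos (freq b k i0 * x $ i0) = 0"
      unfolding freq_def half m by (rule cos_pi_eq_zero)
    then show ?thesis unfolding partial_sine_mode by simp
  qed
  ultimately show thesis by (intro that[of 2]) auto
qed

end

context box_eigenbasis
begin

text \<open>Expanding both functionals in modes and changing basis turns the sum over
  \<open>l\<close> into a sum over one level, where the hypothesis \<open>iso\<close> leaves a
  single summand.\<close>

lemma sum_level_isolated:
  assumes x: "x \<in> \<Omega>" and g: "continuous_on (cbox 0 b) g" and k: "k \<in> modes"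
    and iso: "\<And>m. m \<in> modes \<Longrightarrow> eigval b m = eigval b k \<Longrightarrow> m \<noteq> k \<Longrightarrow> partial i (sine_mode b m) x = 0"
  shows "(\<Sum>l | 1 \<le> l \<and> ev l = eigval b k.
      L2_boundary_inner b g (normal_derivative b (\<phi> l)) * partial i (\<phi> l) x) =
    boundary_pairing g k * partial i (sine_mode b k) x / L2_inner \<Omega> (sine_mode b k) (sine_mode b k)"
proof -
  let ?\<mu> = "eigval b k"
  let ?t = "\<lambda>m. boundary_pairing g m * partial i (sine_mode b m) x / L2_inner \<Omega> (sine_mode b m) (sine_mode b m)"
  have "(\<Sum>l | 1 \<le> l \<and> ev l = ?\<mu>. L2_boundary_inner b g (normal_derivative b (\<phi> l)) * partial i (\<phi> l) x) =
      (\<Sum>l | 1 \<le> l \<and> ev l = ?\<mu>. (\<Sum>m\<in>level ?\<mu>. coeff l m * boundary_pairing g m) *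
        (\<Sum>m\<in>level ?\<mu>. coeff l m * partial i (sine_mode b m) x))"
  proof (rule sum.cong[OF refl])
    fix l assume "l \<in> {l. 1 \<le> l \<and> ev l = ?\<mu>}"
    then have l: "\<phi> l x = (\<Sum>m\<in>level ?\<mu>. coeff l m * sine_mode b m x)" if "x \<in> \<Omega>" for x
      using eigenfunction_expansion[OF _ that, of l] by auto
    have "partial i (\<phi> l) x = partial i (\<lambda>x. \<Sum>m\<in>level ?\<mu>. coeff l m * sine_mode b m x) x"
      by (rule partial_cong_open[OF open_box x l])
    also have "\<dots> = (\<Sum>m\<in>level ?\<mu>. coeff l m * partial i (sine_mode b m) x)"
      by (intro partial_lincomb smooth_differentiable smooth_sine_mode)
    finally show "L2_boundary_inner b g (normal_derivative b (\<phi> l)) * partial i (\<phi> l) x =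
        (\<Sum>m\<in>level ?\<mu>. coeff l m * boundary_pairing g m) * (\<Sum>m\<in>level ?\<mu>. coeff l m * partial i (sine_mode b m) x)"
      by (simp only: L2_boundary_inner_lincomb[OF l g])
  qed
  also have "\<dots> = (\<Sum>m\<in>level ?\<mu>. ?t m)" by (rule sum_over_multiplicity)
  also have "\<dots> = (\<Sum>m\<in>{k}. ?t m)"
    using k iso finite_level by (intro sum.mono_neutral_right) (auto simp: level_def)
  finally show ?thesis by simp
qed

text \<open>The squared coefficients of k over its eigenvalue sum to the inverse squared norm, which
  is nonzero, so the index set is not empty.\<close>

lemma eigval_in_spectrum:
  assumes "k \<in> modes"
  shows "eigval b k \<in> ev ` {1..}"
proof -
  have "k \<in> level (eigval b k)" using assms by (simp add: level_def)
  from sum_coeff_products[OF this this]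
  have "(\<Sum>l | 1 \<le> l \<and> ev l = eigval b k. coeff l k * coeff l k) \<noteq> 0"
    using sine_mode_norm_pos[OF assms] by simp
  then obtain l where "1 \<le> l" "ev l = eigval b k"
    using sum.not_neutral_contains_not_neutral by blast
  then show ?thesis by force
qed

text \<open>Which of the two modes works depends on x, but the two conditions on g do not, so a
  fixed pair of open dense sets serves all points at once.\<close>

theorem generic_observability:
  assumes "\<alpha> < 1"
  shows "generic_in (C1alpha_topology \<alpha> \<Omega>)
    (\<lambda>g. \<forall>x\<in>\<Omega>. \<exists>\<mu>\<in>ev ` {1..}.
      (\<Sum>l | 1 \<le> l \<and> ev l = \<mu>.
         L2_boundary_inner b g (normal_derivative b (\<phi> l)) * partial i (\<phi> l) x) \<noteq> 0)"
proof -
  let ?X = "C1alpha_topology \<alpha> \<Omega>"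
  let ?U = "\<lambda>m. {g \<in> C1alpha \<alpha> \<Omega>. boundary_pairing g (mode_with i m) \<noteq> 0}"
  have U: "openin ?X (?U m)" "?X closure_of ?U m = topspace ?X" if "m \<in> {1, 2}" for m
    using that by (auto intro!: openin_boundary_pairing dense_boundary_pairing[OF assms, where ?i0.0 = i]
        simp: mode_with_def)
  have nonzero: "\<exists>\<mu>\<in>ev ` {1..}. (\<Sum>l | 1 \<le> l \<and> ev l = \<mu>.
      L2_boundary_inner b g (normal_derivative b (\<phi> l)) * partial i (\<phi> l) x) \<noteq> 0"
    if g: "g \<in> ?U 1" "g \<in> ?U 2" and x: "x \<in> \<Omega>" for g x
  proof -
    obtain m where m: "m \<in> {1, 2}" "partial i (sine_mode b (mode_with i m)) x \<noteq> 0"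
      "\<And>k. k \<in> modes \<Longrightarrow> eigval b k = eigval b (mode_with i m) \<Longrightarrow> k \<noteq> mode_with i m \<Longrightarrow>
        partial i (sine_mode b k) x = 0"
      by (rule isolating_mode[OF x, of i], rule that)
    have k: "mode_with i m \<in> modes" using m(1) by (auto simp: modes_def mode_with_def)
    have "continuous_on (cbox 0 b) g" using g(1) by (auto intro: C1alpha_continuous)
    from sum_level_isolated[OF x this k m(3)]
    have "(\<Sum>l | 1 \<le> l \<and> ev l = eigval b (mode_with i m).
      L2_boundary_inner b g (normal_derivative b (\<phi> l)) * partial i (\<phi> l) x) \<noteq> 0"
      using g m(1,2) sine_mode_norm_pos[OF k] by auto
    with eigval_in_spectrum[OF k] show ?thesis by blast
  qed
  show ?thesis
    unfolding generic_in_def residual_in_def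
  proof (intro conjI exI)
    show "countable {?U 1, ?U 2}" by simp
    show "\<forall>V\<in>{?U 1, ?U 2}. openin ?X V \<and> ?X closure_of V = topspace ?X"
      using U by blast
    show "topspace ?X \<inter> \<Inter>{?U 1, ?U 2} \<subseteq> {g \<in> topspace ?X. \<forall>x\<in>\<Omega>. \<exists>\<mu>\<in>ev ` {1..}.
      (\<Sum>l | 1 \<le> l \<and> ev l = \<mu>.
         L2_boundary_inner b g (normal_derivative b (\<phi> l)) * partial i (\<phi> l) x) \<noteq> 0}"
    proof (intro subsetI CollectI conjI ballI)
      fix g assume g: "g \<in> topspace ?X \<inter> \<Inter>{?U 1, ?U 2}"
      then show "g \<in> topspace ?X" by (rule IntD1)
      fix x assume "x \<in> \<Omega>"
      with g show "\<exists>\<mu>\<in>ev ` {1..}. (\<Sum>l | 1 \<le> l \<and> ev l = \<mu>.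
        L2_boundary_inner b g (normal_derivative b (\<phi> l)) * partial i (\<phi> l) x) \<noteq> 0"
        by (intro nonzero) simp_all
    qed
  qed (rule Collect_restrict)
qed

end

theorem lemma4:
  fixes \<alpha> :: real and b :: "real ^ 3" and ev :: "nat \<Rightarrow> real" and \<phi> :: "nat \<Rightarrow> real ^ 3 \<Rightarrow> real"
  assumes "0 < \<alpha>" "\<alpha> < 1" and "\<And>i. 0 < b $ i"
    and "dirichlet_eigenbasis (box 0 b) ev \<phi>"
  shows "generic_in (C1alpha_topology \<alpha> (box 0 b))
    (\<lambda>g. \<forall>x\<in>box 0 b. \<exists>\<mu>\<in>ev ` {1..}.
      (\<Sum>l | 1 \<le> l \<and> ev l = \<mu>.
         L2_boundary_inner b g (normal_derivative b (\<phi> l)) * partial 1 (\<phi> l) x) \<noteq> 0)"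
proof -
  interpret box_eigenbasis b ev \<phi>
    using assms(3,4) by unfold_locales auto
  show ?thesis using assms(2) by (rule generic_observability)
qed

end
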